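(* Let $\rho,\mu>0$ and $\lambda\ge0$ be constants, $\omega>0$, $\vartheta_{\rm S}:=\sqrt{\mu/\rho}$, $k_{\rm S}:=\omega/\vartheta_{\rm S}$, $k_{\rm P}:=\omega\sqrt{\rho/(2\mu+\lambda)}$, and $$\mathbf G(\boldsymbol y):=\frac1{4\pi\vartheta_{\rm S}^2}\Big(\frac{e^{ik_{\rm S}|\boldsymbol y|}}{|\boldsymbol y|}I+\frac1{k_{\rm S}^2}\nabla^2\Big(\frac{e^{ik_{\rm S}|\boldsymbol y|}}{|\boldsymbol y|}-\frac{e^{ik_{\rm P}|\boldsymbol y|}}{|\boldsymbol y|}\Big)\Big),\qquad\boldsymbol y\in\mathbb R^3,$$ the outgoing Green's function of $-\omega^2\rho\boldsymbol u-\operatorname{div}\sigma(\boldsymbol u)=\rho\boldsymbol f$ in $\mathbb R^3$. Fix $\ell>0$ and $\boldsymbol f\in L^2(\mathbb R^3)^3$ with $\operatorname{supp}\boldsymbol f\subset B_\ell$ (ball of radius $\ell$ centred at the origin). Then $\boldsymbol u:=\mathbf G\star\boldsymbol f$ satisfies $$\omega^2\|\boldsymbol u\|_{\rho,B_\ell}\le(4+17\kappa_{\rm S})\|\boldsymbol f\|_{\rho,B_\ell},\qquad\kappa_{\rm S}:=k_{\rm S}\ell.$$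
   Context: $\star$ denotes convolution (matrix times vector inside the integral), $\nabla^2$ the Hessian, $\sigma(\boldsymbol u)=\mu(\nabla\boldsymbol u+(\nabla\boldsymbol u)^T)+\lambda(\operatorname{div}\boldsymbol u)I$, and $\|\boldsymbol v\|^2_{\rho,B_\ell}=\int_{B_\ell}\rho|\boldsymbol v|^2$. *)

theory Defs
  imports "HOL-Analysis.Analysis"
begin

definition partial3 :: "3 \<Rightarrow> (real^3 \<Rightarrow> complex) \<Rightarrow> real^3 \<Rightarrow> complex" where
  "partial3 i f y = vector_derivative (\<lambda>t. f (y + t *\<^sub>R axis i 1)) (at 0)"

definition hessian3 :: "(real^3 \<Rightarrow> complex) \<Rightarrow> real^3 \<Rightarrow> complex^3^3" where
  "hessian3 f y = (\<chi> i j. partial3 i (partial3 j f) y)"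

definition outgoing_wave :: "real \<Rightarrow> real^3 \<Rightarrow> complex" where
  "outgoing_wave k y = exp (\<i> * complex_of_real (k * norm y)) / complex_of_real (norm y)"

text \<open>Outgoing Green's function of -omega^2 rho u - div sigma(u) = rho f in R^3.\<close>
definition elastic_green :: "real \<Rightarrow> real \<Rightarrow> real \<Rightarrow> real \<Rightarrow> real^3 \<Rightarrow> complex^3^3" where
  "elastic_green rho mu lam omega y =
     (let thS = sqrt (mu / rho); kS = omega / thS; kP = omega * sqrt (rho / (2 * mu + lam));
          H = hessian3 (\<lambda>z. outgoing_wave kS z - outgoing_wave kP z) y
      in (\<chi> i j. complex_of_real (1 / (4 * pi * thS ^ 2)) *
            ((if i = j then outgoing_wave kS y else 0) + complex_of_real (1 / kS ^ 2) * H $ i $ j)))"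

definition conv3 :: "(real^3 \<Rightarrow> complex^3^3) \<Rightarrow> (real^3 \<Rightarrow> complex^3) \<Rightarrow> real^3 \<Rightarrow> complex^3" where
  "conv3 G f x = integral\<^sup>L lborel (\<lambda>y. G (x - y) *v f y)"

definition rho_norm :: "real \<Rightarrow> (real^3) set \<Rightarrow> (real^3 \<Rightarrow> complex^3) \<Rightarrow> real" where
  "rho_norm rho B v = sqrt (LINT x:B|lborel. rho * (norm (v x))^2)"

end

(* If x and y lie in the ball of radius l, then |x - y| < 2 l, so the Green function may be replaced by a
   kernel truncated at radius 4 l. Convolution with a compactly supported kernel is bounded on L^2 by the
   supremum of the Fourier transform of the kernel. For the truncated waves b_S and b_P the transform of
   k_S^2 b_S I + Hess (b_S - b_P) is k_S^2 b_S^ I - (b_S^ - b_P^) xi xi^T, and integrations by parts in the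
   radial variable give k^2 |b^| <= 4 pi 8 k l and |xi|^2 |b^| <= 4 pi (2 + 4 k l). With k_P <= k_S this
   yields the constant 4 + 16 k_S l. To work with continuous kernels, |y| is first replaced by
   sqrt (|y|^2 + e), and e tends to 0 at the end by dominated convergence and Fatou's lemma. *)

theory Submission
  imports Defs "HOL-Probability.Characteristic_Functions" "HOL-Complex_Analysis.Complex_Analysis"
begin

section \<open>Fourier integrals of Gaussians\<close>

text \<open>The Hessian of a single outgoing wave behaves like |y|^-3 and is not locally integrable;
  only the Hessian of the difference of the two waves is of order 1/|y|. With the regularised radius
  the profiles are C^2 on all of R^3, so the transform of the Hessian follows from two integrations
  by parts that see no singularity. For e > 0 each wave has its own transform and the two may be
  estimated separately; the cancellation matters only for e -> 0, where it supplies a dominating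
  kernel independent of e. The cutoff multiplies the radial profiles before differentiation, so the
  truncated kernel contains a genuine Hessian. The cutoff is monotone, and its descent from 1 to 0
  therefore costs only its total variation. The multiplier bound needs no Fourier inversion: for the
  data an upper bound on Gaussian-weighted energies is enough, and for the output, which is
  continuous and bounded, their limit can be computed.\<close>

lemma integral_gaussian_cis_real:
  fixes a t :: real
  assumes a: "a > 0"
  shows "has_bochner_integral lborel (\<lambda>x. exp (- a * x\<^sup>2) *\<^sub>R cis (t * x)) (of_real (sqrt (pi / a) * exp (- t\<^sup>2 / (4 * a))))"
proof -
  \<comment> \<open>\<open>a * x\<^sup>2 = (c * x)\<^sup>2 / 2\<close>, so the substitution
    \<open>c * x\<close> reduces the integral to the characteristic function of the standard normal
    law.\<close>
  define c where "c = sqrt (2 * a)"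
  have c: "c > 0" "c\<^sup>2 = 2 * a" using a by (auto simp: c_def)
  have int: "integrable lborel (\<lambda>x. std_normal_density x *\<^sub>R cis (s * x))" for s
    by (rule Bochner_Integration.integrable_bound[where f=std_normal_density])
       (auto simp: cis_conv_exp normal_density_def intro!: borel_measurable_continuous_onI continuous_intros integrable_normal_density[of 1 0, simplified])
  have "(LINT x|lborel. std_normal_density x *\<^sub>R cis (s * x)) = of_real (exp (- s\<^sup>2 / 2))" for s
    using fun_cong[OF char_std_normal_distribution, of s]
    by (simp add: char_def integral_density normal_density_nonneg cis_conv_exp mult.assoc)
  with int have H: "has_bochner_integral lborel (\<lambda>x. std_normal_density x *\<^sub>R cis (s * x)) (of_real (exp (- s\<^sup>2 / 2)))" for s
    by (simp add: has_bochner_integral_iff)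
  have "has_bochner_integral lborel (\<lambda>x. std_normal_density (0 + c * x) *\<^sub>R cis (t / c * (0 + c * x))) 
      (of_real (exp (- (t / c)\<^sup>2 / 2)) /\<^sub>R \<bar>c\<bar>)"
    using H[of "t / c"] c by (subst (asm) lborel_has_bochner_integral_real_affine_iff[where c=c and t=0]) auto
  from has_bochner_integral_scaleR_right[OF this, of "sqrt (2 * pi)"]
  have "has_bochner_integral lborel (\<lambda>x. (sqrt (2 * pi) * std_normal_density (c * x)) *\<^sub>R cis (t / c * (c * x))) 
      (sqrt (2 * pi) *\<^sub>R (of_real (exp (- (t / c)\<^sup>2 / 2)) /\<^sub>R \<bar>c\<bar>))"
    by simp
  also have "(\<lambda>x. (sqrt (2 * pi) * std_normal_density (c * x)) *\<^sub>R cis (t / c * (c * x))) = (\<lambda>x. exp (- a * x\<^sup>2) *\<^sub>R cis (t * x))"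
    using c by (auto simp: normal_density_def fun_eq_iff power_mult_distrib)
  also have "sqrt (2 * pi) *\<^sub>R (of_real (exp (- (t / c)\<^sup>2 / 2)) /\<^sub>R \<bar>c\<bar>) = of_real (sqrt (pi / a) * exp (- t\<^sup>2 / (4 * a)))"
  proof -
    have "sqrt (2 * pi) / \<bar>c\<bar> = sqrt (pi / a)"
      using a by (simp add: c_def real_sqrt_divide[symmetric] field_simps)
    moreover have "- (t / c)\<^sup>2 / 2 = - t\<^sup>2 / (4 * a)"
      using c by (simp add: power_divide)
    ultimately show ?thesis 
      by (simp only: scaleR_conv_of_real scaleR_scaleR of_real_mult [symmetric] mult.assoc [symmetric] divide_inverse [symmetric])
  qed
  finally show ?thesis .
qed

text \<open>The Gaussian and the character both factor over \<open>Basis\<close>, and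
  \<open>lborel\<close> is the image of the product measure, so the integral is a product of
  one-dimensional ones.\<close>

lemma integral_gaussian_cis:
  fixes z :: "'a::euclidean_space"
  assumes a: "a > 0"
  shows "has_bochner_integral lborel (\<lambda>x. exp (- a * (norm x)\<^sup>2) *\<^sub>R cis (z \<bullet> x))
     (of_real (sqrt (pi / a) ^ DIM('a) * exp (- (norm z)\<^sup>2 / (4 * a))))"
proof -
  let ?g = "\<lambda>b x. exp (- a * x\<^sup>2) *\<^sub>R cis ((z \<bullet> b) * x)"
  interpret product_sigma_finite "\<lambda>_::'a. lborel :: real measure" by standard
  have g: "integrable lborel (?g b)" "(LINT x|lborel. ?g b x) = of_real (sqrt (pi / a) * exp (- (z \<bullet> b)\<^sup>2 / (4 * a)))" for b
    using integral_gaussian_cis_real[OF a, of "z \<bullet> b"] by (auto simp: has_bochner_integral_iff)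
  have eq: "exp (- a * (norm x)\<^sup>2) *\<^sub>R cis (z \<bullet> x) = (\<Prod>b\<in>Basis. ?g b (f b))" if "x = (\<Sum>b\<in>Basis. f b *\<^sub>R b)" for f and x :: 'a
  proof -
    have xb: "x \<bullet> b = f b" if "b \<in> Basis" for b using that \<open>x = _\<close> by simp
    have "(norm x)\<^sup>2 = (\<Sum>b\<in>Basis. (f b)\<^sup>2)"
      unfolding power2_norm_eq_inner euclidean_inner[of x x] by (rule sum.cong) (simp_all add: xb power2_eq_square)
    moreover have "z \<bullet> x = (\<Sum>b\<in>Basis. (z \<bullet> b) * f b)"
      unfolding euclidean_inner[of z x] by (rule sum.cong) (simp_all add: xb)
    ultimately have "exp (- a * (norm x)\<^sup>2) *\<^sub>R cis (z \<bullet> x) = exp (\<Sum>b\<in>Basis. of_real (- a * (f b)\<^sup>2) + \<i> * of_real ((z \<bullet> b) * f b))"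
      by (simp add: cis_conv_exp scaleR_conv_of_real exp_of_real[symmetric] exp_add[symmetric] sum.distrib sum_distrib_left sum_negf sum_subtractf)
    also have "\<dots> = (\<Prod>b\<in>Basis. ?g b (f b))"
      by (subst exp_sum, simp, simp only: exp_add scaleR_conv_of_real cis_conv_exp exp_of_real)
    finally show ?thesis .
  qed
  have "integrable (Pi\<^sub>M Basis (\<lambda>_::'a. lborel)) (\<lambda>f. \<Prod>b\<in>Basis. ?g b (f b))"
    by (rule product_integrable_prod[OF finite_Basis g(1)])
  moreover have "(LINT f|(Pi\<^sub>M Basis (\<lambda>_::'a. lborel)). (\<Prod>b\<in>Basis. ?g b (f b))) = (\<Prod>b\<in>Basis. integral\<^sup>L lborel (?g b))"
    by (rule product_integral_prod[OF finite_Basis g(1)])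
  moreover have "(\<Prod>b\<in>Basis. integral\<^sup>L lborel (?g b)) = of_real (sqrt (pi / a) ^ DIM('a) * exp (- (norm z)\<^sup>2 / (4 * a)))"
  proof -
    have "(norm z)\<^sup>2 = (\<Sum>b\<in>Basis. (z \<bullet> b)\<^sup>2)"
      unfolding power2_norm_eq_inner euclidean_inner[of z z] by (simp add: power2_eq_square)
    then have "exp (- (norm z)\<^sup>2 / (4 * a)) = (\<Prod>b\<in>Basis. exp (- (z \<bullet> b)\<^sup>2 / (4 * a)))"
      by (simp add: exp_sum[symmetric] sum_divide_distrib sum_negf)
    then show ?thesis unfolding g by (simp add: prod.distrib)
  qed
  ultimately have "has_bochner_integral (Pi\<^sub>M Basis (\<lambda>_::'a. lborel)) (\<lambda>f. \<Prod>b\<in>Basis. ?g b (f b)) (of_real (sqrt (pi / a) ^ DIM('a) * exp (- (norm z)\<^sup>2 / (4 * a))))"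
    by (simp add: has_bochner_integral_iff)
  then have "has_bochner_integral (distr (\<Pi>\<^sub>M b\<in>Basis. lborel) borel (\<lambda>f. \<Sum>b\<in>Basis. f b *\<^sub>R b)) (\<lambda>x::'a. exp (- a * (norm x)\<^sup>2) *\<^sub>R cis (z \<bullet> x))
     (of_real (sqrt (pi / a) ^ DIM('a) * exp (- (norm z)\<^sup>2 / (4 * a))))"
  proof (intro has_bochner_integral_distr)
    show "(\<lambda>x::'a. exp (- a * (norm x)\<^sup>2) *\<^sub>R cis (z \<bullet> x)) \<in> borel_measurable borel"
      unfolding cis_conv_exp by (intro borel_measurable_continuous_onI continuous_intros)
  qed (simp_all only: eq[OF refl], simp)
  then show ?thesis by (subst lborel_eq)
qed

lemma integral_gaussian:
  assumes a: "a > 0"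
  shows "has_bochner_integral lborel (\<lambda>x::'a::euclidean_space. exp (- a * (norm x)\<^sup>2)) (sqrt (pi / a) ^ DIM('a))"
proof -
  have "has_bochner_integral lborel (\<lambda>x::'a::euclidean_space. of_real (exp (- a * (norm x)\<^sup>2)) :: complex) (of_real (sqrt (pi / a) ^ DIM('a)))"
    using integral_gaussian_cis[OF a, of "0::'a"] by (simp add: scaleR_conv_of_real)
  from has_bochner_integral_bounded_linear[OF bounded_linear_Re this] show ?thesis by simp
qed

text \<open>The radial side of the three-dimensional Gaussian transform. Over the whole line, the
  derivative of \<open>exp (- a * r\<^sup>2) * sin (s * r)\<close> ties the integrand to the cosine
  integral, which is known; evenness of \<open>r * sin (s * r)\<close> then halves the
  result.\<close>

lemma integral_gaussian_sin:
  fixes a s :: real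
  assumes a: "a > 0"
  shows "has_bochner_integral lborel (\<lambda>r. indicator {0..} r *\<^sub>R (exp (- a * r\<^sup>2) * r * sin (s * r)))
    (s / (4 * a) * sqrt (pi / a) * exp (- s\<^sup>2 / (4 * a)))"
proof -
  let ?h = "\<lambda>r. exp (- a * r\<^sup>2) * r * sin (s * r)"
  let ?F = "\<lambda>r. - exp (- a * r\<^sup>2) * sin (s * r) / (2 * a)"
  let ?f = "\<lambda>r. ?h r - s / (2 * a) * (exp (- a * r\<^sup>2) * cos (s * r))"
  have cosI: "has_bochner_integral lborel (\<lambda>r. exp (- a * r\<^sup>2) * cos (s * r)) (sqrt (pi / a) * exp (- s\<^sup>2 / (4 * a)))"
    using has_bochner_integral_bounded_linear[OF bounded_linear_Re integral_gaussian_cis_real[OF a, of s]] by simp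
  have hI: "integrable lborel ?h"
  \<comment> \<open>The factor \<open>r\<close> is absorbed by half of the Gaussian decay:
    \<open>\<bar>r\<bar> \<le> 1 + r\<^sup>2\<close>, and \<open>r\<^sup>2\<close> is at most
    \<open>2 / a * exp (a / 2 * r\<^sup>2)\<close>.\<close>
  proof (rule Bochner_Integration.integrable_bound[where f="\<lambda>r. (2 / a) *\<^sub>R exp (- (a / 2) * r\<^sup>2) + exp (- a * r\<^sup>2)"])
    show "integrable lborel (\<lambda>r. (2 / a) *\<^sub>R exp (- (a / 2) * r\<^sup>2) + exp (- a * r\<^sup>2))"
      using integral_gaussian[where 'a=real, of "a/2"] integral_gaussian[where 'a=real, of a] a
      by (intro Bochner_Integration.integrable_add integrable_scaleR_right) (auto simp: has_bochner_integral_iff)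
    show "AE r in lborel. norm (?h r) \<le> norm ((2 / a) *\<^sub>R exp (- (a / 2) * r\<^sup>2) + exp (- a * r\<^sup>2))"
    proof (rule AE_I2)
      fix r :: real
      have "a / 2 * r\<^sup>2 \<le> exp (a / 2 * r\<^sup>2)"
        using exp_ge_add_one_self[of "a / 2 * r\<^sup>2"] by linarith
      then have *: "r\<^sup>2 \<le> 2 / a * exp (a / 2 * r\<^sup>2)" using a by (simp add: field_simps)
      have "\<bar>r\<bar> \<le> 1 + r\<^sup>2" using zero_le_power2[of "\<bar>r\<bar> - 1"] by (simp add: power2_eq_square algebra_simps)
      then have "norm (?h r) \<le> exp (- a * r\<^sup>2) * (1 + r\<^sup>2)"
        using abs_sin_le_one[of "s * r"] mult_mono[of "\<bar>r\<bar>" "1 + r\<^sup>2" "\<bar>sin (s * r)\<bar>" 1] by (simp add: abs_mult mult.assoc)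
      also have "\<dots> \<le> exp (- a * r\<^sup>2) * (1 + 2 / a * exp (a / 2 * r\<^sup>2))"
        using * by (intro mult_left_mono) auto
      also have "\<dots> = (2 / a) *\<^sub>R exp (- (a / 2) * r\<^sup>2) + exp (- a * r\<^sup>2)"
        by (simp add: algebra_simps exp_add[symmetric])
      finally show "norm (?h r) \<le> norm ((2 / a) *\<^sub>R exp (- (a / 2) * r\<^sup>2) + exp (- a * r\<^sup>2))" by simp
    qed
  qed simp
  have fI: "integrable lborel ?f"
    using hI cosI by (intro Bochner_Integration.integrable_diff integrable_mult_right) (auto simp: has_bochner_integral_iff)
  have lim: "((\<lambda>r. ?F r) \<longlongrightarrow> 0) at_top" "((\<lambda>r. ?F r) \<longlongrightarrow> 0) at_bot"
  proof -
    have 1: "((\<lambda>r::real. exp (- a * r\<^sup>2) / (2 * a)) \<longlongrightarrow> 0) at_top"  "((\<lambda>r::real. exp (- a * r\<^sup>2) / (2 * a)) \<longlongrightarrow> 0) at_bot"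
      using a by real_asymp+
    have 2: "norm (?F r) \<le> exp (- a * r\<^sup>2) / (2 * a)" for r
      using a abs_sin_le_one[of "s * r"] by (simp add: abs_mult field_simps)
    show "((\<lambda>r. ?F r) \<longlongrightarrow> 0) at_top" "((\<lambda>r. ?F r) \<longlongrightarrow> 0) at_bot"
      by (rule Lim_null_comparison[OF always_eventually], use 2 1 in auto)+
  qed
  have "(LBINT r=-\<infinity>..\<infinity>. ?f r) = 0 - 0"
  proof (rule interval_integral_FTC_integrable[where F="?F"])
    show "(?F has_vector_derivative ?f r) (at r)" for r
      using a unfolding has_real_derivative_iff_has_vector_derivative[symmetric]
      by (auto intro!: derivative_eq_intros simp: field_simps)
    show "set_integrable lborel (einterval (-\<infinity>) \<infinity>) ?f"
      using fI by (simp add: set_integrable_def einterval_def)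
    show "((?F \<circ> real_of_ereal) \<longlongrightarrow> 0) (at_right (-\<infinity>))" "((?F \<circ> real_of_ereal) \<longlongrightarrow> 0) (at_left \<infinity>)"
      unfolding ereal_tendsto_simps using lim by auto
  qed (use a in \<open>auto intro!: continuous_intros\<close>)
  then have "(LINT r|lborel. ?f r) = 0"
    by (simp add: interval_lebesgue_integral_def einterval_def set_lebesgue_integral_def)
  then have hval: "(LINT r|lborel. ?h r) = s / (2 * a) * (sqrt (pi / a) * exp (- s\<^sup>2 / (4 * a)))"
    using hI cosI by (subst (asm) Bochner_Integration.integral_diff) (auto simp: has_bochner_integral_iff)
  have ind: "integrable lborel (\<lambda>r. indicator {0..} r *\<^sub>R ?h r)"
    by (rule integrable_mult_indicator) (use hI in auto)
  then have "has_bochner_integral lborel ?h (2 *\<^sub>R (LINT r|lborel. indicator {0..} r *\<^sub>R ?h r))"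
    by (intro has_bochner_integral_even_function) (auto simp: has_bochner_integral_iff)
  then have "2 * (LINT r|lborel. indicator {0..} r *\<^sub>R ?h r) = s / (2 * a) * (sqrt (pi / a) * exp (- s\<^sup>2 / (4 * a)))"
    using hval by (simp add: has_bochner_integral_iff)
  then show ?thesis using ind by (simp add: has_bochner_integral_iff field_simps)
qed

section \<open>Fourier transforms of radial functions\<close>

lemma integrable_continuous_bounded_support:
  fixes f :: "'a::euclidean_space \<Rightarrow> 'b::{banach, second_countable_topology}"
  assumes "continuous_on UNIV f" and "\<And>x. norm x > R \<Longrightarrow> f x = 0"
  shows "integrable lborel f"
proof -
  have "integrable lborel (\<lambda>x. indicator (cball 0 R) x *\<^sub>R f x)"
    by (rule borel_integrable_compact) (use assms(1) continuous_on_subset in auto)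
  also have "(\<lambda>x. indicator (cball 0 R) x *\<^sub>R f x) = f"
    using assms(2) by (force simp: indicator_def)
  finally show ?thesis .
qed

text \<open>Both sides are continuous in \<open>\<Psi>\<close> for the norm \<open>sup \<bar>\<Psi> r\<bar> exp (r\<^sup>2)\<close>, and they agree on the functions
  \<open>exp (- a r\<^sup>2)\<close> with \<open>a \<ge> 1\<close>. By the Weierstrass theorem, applied in the variable \<open>exp (- r\<^sup>2)\<close>, the span of
  these Gaussians is dense. This avoids polar coordinates.\<close>

lemma radial_fourier_real:
  fixes \<Psi> :: "real \<Rightarrow> real" and \<xi> :: "real^3"
  assumes cont: "continuous_on {0..} \<Psi>" and supp: "\<And>r. r \<ge> R \<Longrightarrow> \<Psi> r = 0" and R: "R > 0" and \<xi>: "\<xi> \<noteq> 0"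
  shows "(LINT x|lborel. \<Psi> (norm x) *\<^sub>R cis (\<xi> \<bullet> x)) =
    of_real (4 * pi / norm \<xi> * integral {0..R} (\<lambda>r. \<Psi> r * r * sin (norm \<xi> * r)))"
proof -
  define s where "s = norm \<xi>"
  have s: "s > 0" using \<xi> by (simp add: s_def)
  define \<delta> where "\<delta> = exp (- R\<^sup>2)"
  have \<delta>: "\<delta> > 0" "\<delta> \<le> 1" by (auto simp: \<delta>_def)
  \<comment> \<open>This is \<open>\<Psi>\<close> in the variable
    \<open>x = exp (- r\<^sup>2)\<close>, divided by \<open>x\<close>. Since \<open>\<Psi>\<close>
    vanishes from \<open>R\<close> on, \<open>x\<close> may be replaced by
    \<open>max x \<delta>\<close>, which keeps the logarithm and the quotient continuous down to
    \<open>x = 0\<close>.\<close>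
  define h where "h x = \<Psi> (sqrt (- ln (max x \<delta>))) / max x \<delta>" for x
  have h_cont: "continuous_on {0..1} h"
    unfolding h_def using \<delta> 
    by (intro continuous_intros continuous_on_compose2[OF cont]) (auto simp: max_def)
  have h_eq: "\<Psi> r = h (exp (- r\<^sup>2)) * exp (- r\<^sup>2)" if "r \<ge> 0" for r
  proof (cases "r \<le> R")
    case True
    then have "max (exp (- r\<^sup>2)) \<delta> = exp (- r\<^sup>2)" using that by (auto simp: \<delta>_def max_def power_mono)
    then show ?thesis using that by (simp add: h_def)
  next
    case False
    then have "max (exp (- r\<^sup>2)) \<delta> = \<delta>" using that R by (auto simp: \<delta>_def max_def power_mono)
    then show ?thesis using False R by (simp add: h_def \<delta>_def supp)
  qed
  define A where "A = (\<lambda>\<Phi>. LINT x|lborel. \<Phi> (norm x) *\<^sub>R cis (\<xi> \<bullet> x))"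
  define b where "b = (\<lambda>\<Phi> r. indicator {0..} r *\<^sub>R (\<Phi> r * r * sin (s * r)) :: real)"
  define B where "B = (\<lambda>\<Phi>. LINT r|lborel. b \<Phi> r)"
  have cis_meas[measurable]: "(\<lambda>x::real^3. cis (\<xi> \<bullet> x)) \<in> borel_measurable borel"
    by (auto simp: cis_conv_exp intro!: borel_measurable_continuous_onI continuous_intros)
  have \<Psi>_cont: "continuous_on UNIV (\<lambda>x::real^3. \<Psi> (norm x))"
    by (intro continuous_on_compose2[OF cont]) (auto intro!: continuous_intros)
  have A\<Psi>: "integrable lborel (\<lambda>x::real^3. \<Psi> (norm x) *\<^sub>R cis (\<xi> \<bullet> x))"
    by (rule integrable_continuous_bounded_support[where R=R])
       (auto intro!: \<Psi>_cont continuous_intros simp: cis_conv_exp supp)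
  have b\<Psi>_eq: "b \<Psi> = (\<lambda>r. indicator {0..R} r *\<^sub>R (\<Psi> r * r * sin (s * r)))"
    using supp by (auto simp: b_def fun_eq_iff indicator_def)
  have sub: "continuous_on {0..R} \<Psi>" using cont by (rule continuous_on_subset) auto
  have b\<Psi>: "integrable lborel (b \<Psi>)" unfolding b\<Psi>_eq
    by (rule borel_integrable_compact) (auto intro!: sub continuous_intros)
  \<comment> \<open>The exponents start at 1 because a polynomial in
    \<open>exp (- r\<^sup>2)\<close> is multiplied by the weight \<open>exp (- r\<^sup>2)\<close>
    that was divided out of \<open>\<Psi>\<close>.\<close>
  define G where "G = (\<lambda>a n r. \<Sum>i\<le>n. a i * exp (- (real i + 1) * r\<^sup>2))" for a :: "nat \<Rightarrow> real" and n :: nat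
  have AG: "has_bochner_integral lborel (\<lambda>x::real^3. G a n (norm x) *\<^sub>R cis (\<xi> \<bullet> x))
      (\<Sum>i\<le>n. a i *\<^sub>R of_real (sqrt (pi / (real i + 1)) ^ 3 * exp (- s\<^sup>2 / (4 * (real i + 1)))))" for a n
  proof -
    have "has_bochner_integral lborel (\<lambda>x::real^3. \<Sum>i\<le>n. a i *\<^sub>R (exp (- (real i + 1) * (norm x)\<^sup>2) *\<^sub>R cis (\<xi> \<bullet> x)))
      (\<Sum>i\<le>n. a i *\<^sub>R of_real (sqrt (pi / (real i + 1)) ^ 3 * exp (- s\<^sup>2 / (4 * (real i + 1)))))"
      using integral_gaussian_cis[where 'a="real^3" and z=\<xi> and a="real i + 1" for i]
      by (intro has_bochner_integral_sum has_bochner_integral_scaleR_right) (simp add: s_def)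
    then show ?thesis by (simp add: G_def scaleR_sum_left)
  qed
  have BG: "has_bochner_integral lborel (b (G a n))
      (\<Sum>i\<le>n. a i *\<^sub>R (s / (4 * (real i + 1)) * sqrt (pi / (real i + 1)) * exp (- s\<^sup>2 / (4 * (real i + 1)))))" for a n
  proof -
    have "has_bochner_integral lborel (\<lambda>r. \<Sum>i\<le>n. a i *\<^sub>R (indicator {0..} r *\<^sub>R (exp (- (real i + 1) * r\<^sup>2) * r * sin (s * r))))
      (\<Sum>i\<le>n. a i *\<^sub>R (s / (4 * (real i + 1)) * sqrt (pi / (real i + 1)) * exp (- s\<^sup>2 / (4 * (real i + 1)))))"
      by (intro has_bochner_integral_sum has_bochner_integral_scaleR_right integral_gaussian_sin) auto
    moreover have "(\<lambda>r. \<Sum>i\<le>n. a i *\<^sub>R (indicator {0..} r *\<^sub>R (exp (- (real i + 1) * r\<^sup>2) * r * sin (s * r)))) = b (G a n)"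
      by (rule ext) (simp add: b_def G_def sum_distrib_left sum_distrib_right mult_ac)
    ultimately show ?thesis by simp
  qed
  \<comment> \<open>For each rate \<open>q = real i + 1\<close> the exponentials agree, and
    \<open>sqrt (pi / q) ^ 3 = pi / q * sqrt (pi / q)\<close> is \<open>4 * pi / s\<close> times the
    radial coefficient \<open>s / (4 * q) * sqrt (pi / q)\<close>.\<close>
  have ABG: "A (G a n) = of_real (4 * pi / s * B (G a n))" for a n
  proof -
    have "sqrt (pi / (real i + 1)) ^ 3 = 4 * pi / s * (s / (4 * (real i + 1)) * sqrt (pi / (real i + 1)))" for i
    proof -
      have "sqrt (pi / (real i + 1)) ^ 3 = (sqrt (pi / (real i + 1)))\<^sup>2 * sqrt (pi / (real i + 1))"
        by (simp add: power3_eq_cube power2_eq_square)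
      then show ?thesis using s by (simp add: field_simps)
    qed
    then have "(\<Sum>i\<le>n. a i * (sqrt (pi / (real i + 1)) ^ 3 * exp (- s\<^sup>2 / (4 * (real i + 1))))) = 
        4 * pi / s * (\<Sum>i\<le>n. a i * (s / (4 * (real i + 1)) * sqrt (pi / (real i + 1)) * exp (- s\<^sup>2 / (4 * (real i + 1)))))"
      unfolding sum_distrib_left by (intro sum.cong) (simp_all only: mult_ac)
    moreover have "A (G a n) = of_real (\<Sum>i\<le>n. a i * (sqrt (pi / (real i + 1)) ^ 3 * exp (- s\<^sup>2 / (4 * (real i + 1)))))"
      using AG[of a n] unfolding A_def has_bochner_integral_iff by (simp only: scaleR_conv_of_real of_real_mult of_real_sum)
    moreover have "B (G a n) = (\<Sum>i\<le>n. a i * (s / (4 * (real i + 1)) * sqrt (pi / (real i + 1)) * exp (- s\<^sup>2 / (4 * (real i + 1)))))"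
      using BG[of a n] unfolding B_def has_bochner_integral_iff by (simp only: real_scaleR_def)
    ultimately show ?thesis by (simp only:)
  qed
  have gauss3: "has_bochner_integral lborel (\<lambda>x::real^3. exp (- (norm x)\<^sup>2)) (sqrt pi ^ 3)"
    using integral_gaussian[where 'a="real^3", of 1] by simp
  have gauss1: "has_bochner_integral lborel (\<lambda>x::real. indicator {0..} x *\<^sub>R (exp (- x\<^sup>2) * x)) (1 / 2)"
    by (rule gaussian_moment_1)
  \<comment> \<open>The masses that turn the weighted sup norm into bounds for the two functionals:
    \<open>sqrt pi ^ 3\<close> for the weight in space, and \<open>1 / 2\<close> for the weight
    times \<open>r\<close> on the half-line, scaled by \<open>4 * pi / s\<close>.\<close>
  define C where "C = sqrt pi ^ 3 + 4 * pi / s * (1 / 2)"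
  have C: "C > 0" using s by (simp add: C_def add_pos_pos)
  have est: "norm (A \<Psi> - of_real (4 * pi / s * B \<Psi>)) \<le> e * C" if e: "e > 0" for e
  proof -
    obtain g where g: "real_polynomial_function g" and ge: "\<And>x. x \<in> {0..1} \<Longrightarrow> \<bar>h x - g x\<bar> < e"
      using Stone_Weierstrass_real_polynomial_function[OF compact_Icc h_cont e] by blast
    obtain a n where gs: "g = (\<lambda>x. \<Sum>i\<le>n. a i * x ^ i)" using g unfolding real_polynomial_function_iff_sum by blast
    have "G a n r = g (exp (- r\<^sup>2)) * exp (- r\<^sup>2)" for r
      unfolding G_def gs sum_distrib_right
      by (rule sum.cong) (auto simp: exp_of_nat_mult[symmetric] exp_add[symmetric] algebra_simps)
    then have diff: "\<bar>\<Psi> r - G a n r\<bar> \<le> e * exp (- r\<^sup>2)" if "r \<ge> 0" for r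
      using ge[of "exp (- r\<^sup>2)"] h_eq[OF that] by (simp add: left_diff_distrib[symmetric] abs_mult)
    have "norm (A \<Psi> - A (G a n)) = norm (LINT x|lborel. (\<Psi> (norm x) - G a n (norm x)) *\<^sub>R cis (\<xi> \<bullet> x))"
      unfolding A_def scaleR_left_diff_distrib
      using A\<Psi> AG[of a n] by (subst Bochner_Integration.integral_diff) (auto simp: has_bochner_integral_iff)
    also have "\<dots> \<le> (LINT x::real^3|lborel. e * exp (- (norm x)\<^sup>2))"
    proof (rule Bochner_Integration.integral_norm_bound_integral)
      show "integrable lborel (\<lambda>x. (\<Psi> (norm x) - G a n (norm x)) *\<^sub>R cis (\<xi> \<bullet> x))"
        unfolding scaleR_left_diff_distrib using A\<Psi> AG[of a n] by (auto simp: has_bochner_integral_iff)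
      show "integrable lborel (\<lambda>x::real^3. e * exp (- (norm x)\<^sup>2))" using gauss3 by (auto simp: has_bochner_integral_iff)
    qed (use diff in auto)
    also have "\<dots> = e * sqrt pi ^ 3" using gauss3 by (simp add: has_bochner_integral_iff)
    finally have 1: "norm (A \<Psi> - A (G a n)) \<le> e * sqrt pi ^ 3" .
    have "norm (B \<Psi> - B (G a n)) = norm (LINT r|lborel. b \<Psi> r - b (G a n) r)"
      unfolding B_def using b\<Psi> BG[of a n] by (subst Bochner_Integration.integral_diff) (auto simp: has_bochner_integral_iff)
    also have "\<dots> \<le> (LINT r|lborel. e * (indicator {0..} r *\<^sub>R (exp (- r\<^sup>2) * r)))"
    proof (rule Bochner_Integration.integral_norm_bound_integral)
      show "integrable lborel (\<lambda>x. b \<Psi> x - b (G a n) x)"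
        using b\<Psi> BG[of a n] by (auto simp: has_bochner_integral_iff)
      show "integrable lborel (\<lambda>r::real. e * (indicator {0..} r *\<^sub>R (exp (- r\<^sup>2) * r)))"
        using gauss1 by (auto simp: has_bochner_integral_iff)
      fix r :: real
      show "norm (b \<Psi> r - b (G a n) r) \<le> e * (indicator {0..} r *\<^sub>R (exp (- r\<^sup>2) * r))"
      proof (cases "r \<ge> 0")
        case True
        have "norm (b \<Psi> r - b (G a n) r) = \<bar>\<Psi> r - G a n r\<bar> * r * \<bar>sin (s * r)\<bar>"
          using True by (simp add: b_def left_diff_distrib[symmetric] abs_mult)
        also have "\<dots> \<le> (e * exp (- r\<^sup>2)) * r * 1"
          using diff[OF True] True e by (intro mult_mono) auto
        finally show ?thesis using True by simp
      qed (simp add: b_def)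
    qed
    also have "\<dots> = e * (1 / 2)" using gauss1 by (simp add: has_bochner_integral_iff)
    finally have 2: "norm (B \<Psi> - B (G a n)) \<le> e * (1 / 2)" .
    have "A \<Psi> - of_real (4 * pi / s * B \<Psi>) = (A \<Psi> - A (G a n)) - of_real (4 * pi / s * (B \<Psi> - B (G a n)))"
      unfolding ABG by (simp add: right_diff_distrib diff_divide_distrib)
    then have "norm (A \<Psi> - of_real (4 * pi / s * B \<Psi>)) \<le> norm (A \<Psi> - A (G a n)) + norm (of_real (4 * pi / s * (B \<Psi> - B (G a n))) :: complex)"
      by (metis norm_triangle_ineq4)
    also have "norm (of_real (4 * pi / s * (B \<Psi> - B (G a n))) :: complex) = 4 * pi / s * norm (B \<Psi> - B (G a n))"
      unfolding norm_of_real using s by (simp add: abs_mult)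
    also have "norm (A \<Psi> - A (G a n)) + 4 * pi / s * norm (B \<Psi> - B (G a n)) \<le> e * sqrt pi ^ 3 + 4 * pi / s * (e * (1 / 2))"
      using 1 2 s by (intro add_mono mult_left_mono) auto
    finally show ?thesis by (simp add: C_def algebra_simps)
  qed
  have "A \<Psi> - of_real (4 * pi / s * B \<Psi>) = 0"
  proof (rule ccontr)
    assume "A \<Psi> - of_real (4 * pi / s * B \<Psi>) \<noteq> 0"
    then have "norm (A \<Psi> - of_real (4 * pi / s * B \<Psi>)) > 0" by simp
    then show False using est[of "norm (A \<Psi> - of_real (4 * pi / s * B \<Psi>)) / (2 * C)"] C by (simp add: field_simps)
  qed
  moreover have "B \<Psi> = integral {0..R} (\<lambda>r. \<Psi> r * r * sin (s * r))"
    using set_borel_integral_eq_integral(2)[of "{0..R}" "\<lambda>r. \<Psi> r * r * sin (s * r)"] b\<Psi>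
    unfolding B_def b\<Psi>_eq set_lebesgue_integral_def set_integrable_def by simp
  ultimately show ?thesis unfolding A_def s_def by simp
qed

lemma radial_fourier:
  fixes \<Psi> :: "real \<Rightarrow> complex" and \<xi> :: "real^3"
  assumes cont: "continuous_on {0..} \<Psi>" and supp: "\<And>r. r \<ge> R \<Longrightarrow> \<Psi> r = 0" and R: "R > 0" and \<xi>: "\<xi> \<noteq> 0"
  shows "(LINT x|lborel. cis (\<xi> \<bullet> x) * \<Psi> (norm x)) =
    of_real (4 * pi / norm \<xi>) * integral {0..R} (\<lambda>r. \<Psi> r * of_real (r * sin (norm \<xi> * r)))"
proof -
  let ?c = "4 * pi / norm \<xi>"
  have re: "continuous_on {0..} (\<lambda>r. Re (\<Psi> r))" and im: "continuous_on {0..} (\<lambda>r. Im (\<Psi> r))"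
    using cont by (auto intro!: continuous_intros)
  have int: "integrable lborel (\<lambda>x::real^3. f (\<Psi> (norm x)) *\<^sub>R cis (\<xi> \<bullet> x))" if "continuous_on {0..} (\<lambda>r. f (\<Psi> r))" "f 0 = 0" for f :: "complex \<Rightarrow> real"
    by (rule integrable_continuous_bounded_support[where R=R])
       (use that in \<open>auto intro!: continuous_intros continuous_on_compose2[OF that(1)] simp: cis_conv_exp supp\<close>)
  have "(LINT x|lborel. cis (\<xi> \<bullet> x) * \<Psi> (norm x)) = 
      (LINT x|lborel. Re (\<Psi> (norm x)) *\<^sub>R cis (\<xi> \<bullet> x) + \<i> * (Im (\<Psi> (norm x)) *\<^sub>R cis (\<xi> \<bullet> x)))"
    by (rule Bochner_Integration.integral_cong) (auto simp: complex_eq_iff algebra_simps)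
  also have "\<dots> = (LINT x|lborel. Re (\<Psi> (norm x)) *\<^sub>R cis (\<xi> \<bullet> x)) + \<i> * (LINT x|lborel. Im (\<Psi> (norm x)) *\<^sub>R cis (\<xi> \<bullet> x))"
    using int[OF re] int[OF im] by (simp only: integrable_mult_right integral_mult_right_zero Bochner_Integration.integral_add zero_complex.sel)
  also have "\<dots> = of_real ?c * (of_real (integral {0..R} (\<lambda>r. Re (\<Psi> r) * r * sin (norm \<xi> * r))) + 
       \<i> * of_real (integral {0..R} (\<lambda>r. Im (\<Psi> r) * r * sin (norm \<xi> * r))))"
    using radial_fourier_real[OF re _ R \<xi>] radial_fourier_real[OF im _ R \<xi>] supp by (simp add: algebra_simps)
  also have "of_real (integral {0..R} (\<lambda>r. Re (\<Psi> r) * r * sin (norm \<xi> * r))) + 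
       \<i> * of_real (integral {0..R} (\<lambda>r. Im (\<Psi> r) * r * sin (norm \<xi> * r))) = integral {0..R} (\<lambda>r. \<Psi> r * of_real (r * sin (norm \<xi> * r)))"
  proof -
    have "(\<lambda>r. \<Psi> r * of_real (r * sin (norm \<xi> * r))) integrable_on {0..R}"
      by (intro integrable_continuous_interval continuous_intros continuous_on_subset[OF cont]) auto
    from integral_linear[OF this bounded_linear_Re] integral_linear[OF this bounded_linear_Im]
    show ?thesis by (simp add: complex_eq_iff o_def mult.assoc)
  qed
  finally show ?thesis .
qed

section \<open>Fourier multipliers\<close>

lemma has_bochner_integral_lborel_affine:
  fixes f :: "'a::euclidean_space \<Rightarrow> 'b::{banach, second_countable_topology}"
  assumes f: "has_bochner_integral lborel f I" and c: "c \<noteq> 0"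
  shows "has_bochner_integral lborel (\<lambda>x. f (t + c *\<^sub>R x)) (I /\<^sub>R \<bar>c\<bar> ^ DIM('a))"
proof -
  let ?T = "\<lambda>x::'a. t + c *\<^sub>R x"
  have [measurable]: "f \<in> borel_measurable borel" using f by (auto simp: has_bochner_integral_iff dest: borel_measurable_integrable)
  have "has_bochner_integral (density (distr lborel borel ?T) (\<lambda>_. ennreal (\<bar>c\<bar> ^ DIM('a)))) f I"
    using f lborel_affine[OF c, of t] by (simp add: ennreal_power)
  then have "has_bochner_integral (distr lborel borel ?T) (\<lambda>x. \<bar>c\<bar> ^ DIM('a) *\<^sub>R f x) I"
    by (simp add: has_bochner_integral_iff integrable_density integral_density)
  then have "has_bochner_integral lborel (\<lambda>x. \<bar>c\<bar> ^ DIM('a) *\<^sub>R f (?T x)) I"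
    by (simp add: has_bochner_integral_iff integrable_distr_eq integral_distr)
  from has_bochner_integral_scaleR_right[OF this, of "inverse (\<bar>c\<bar> ^ DIM('a))"] c
  show ?thesis by simp
qed

lemma has_bochner_integral_lborel_translate:
  fixes f :: "'a::euclidean_space \<Rightarrow> 'b::{banach, second_countable_topology}"
  assumes "has_bochner_integral lborel f I"
  shows "has_bochner_integral lborel (\<lambda>x. f (x - t)) I" "has_bochner_integral lborel (\<lambda>x. f (t - x)) I"
  using has_bochner_integral_lborel_affine[OF assms, of 1 "-t"] has_bochner_integral_lborel_affine[OF assms, of "-1" t] by simp_all

lemma has_bochner_integral_lborel_prod:
  fixes f :: "'a::euclidean_space \<Rightarrow> complex" and g :: "'b::euclidean_space \<Rightarrow> complex"
  assumes f: "integrable lborel f" and g: "integrable lborel g"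
  shows "has_bochner_integral lborel (\<lambda>p. f (fst p) * g (snd p)) ((LINT x|lborel. f x) * (LINT y|lborel. g y))"
proof -
  have [measurable]: "f \<in> borel_measurable borel" "g \<in> borel_measurable borel" using f g by (auto dest: borel_measurable_integrable)
  have int: "integrable (lborel \<Otimes>\<^sub>M lborel) (\<lambda>p. f (fst p) * g (snd p))"
  proof (rule lborel_pair.Fubini_integrable)
    show "integrable lborel (\<lambda>x. LINT y|lborel. norm (f (fst (x, y)) * g (snd (x, y))))"
      using f by (simp add: norm_mult)
  qed (use g in auto)
  from lborel_pair.integral_fst'[OF this]
  have "(LINT p|(lborel \<Otimes>\<^sub>M lborel). f (fst p) * g (snd p)) = (LINT x|lborel. f x) * (LINT y|lborel. g y)"
    by simp
  with int show ?thesis by (simp add: has_bochner_integral_iff lborel_prod)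
qed

text \<open>The exponent is positive and there is no prefactor: a derivative in direction
  \<open>e\<close> becomes the factor \<open>- \<i> * (\<xi> \<bullet> e)\<close>, and energies
  carry \<open>(2 * pi) ^ DIM('a)\<close>.\<close>

definition fourier :: "('a::euclidean_space \<Rightarrow> complex) \<Rightarrow> 'a \<Rightarrow> complex" where
  "fourier h \<xi> = (LINT x|lborel. cis (\<xi> \<bullet> x) * h x)"

lemma borel_measurable_cis [measurable (raw)]:
  "f \<in> borel_measurable M \<Longrightarrow> (\<lambda>x. cis (f x)) \<in> borel_measurable M"
  unfolding cis_conv_exp by measurable

lemma borel_measurable_cnj_compose [measurable (raw)]:
  assumes "f \<in> borel_measurable M"
  shows "(\<lambda>x. cnj (f x)) \<in> borel_measurable M"
  using measurable_compose[OF assms, of cnj borel] borel_measurable_continuous_onI[of cnj] continuous_on_cnj[OF continuous_on_id] by simp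

lemma borel_measurable_complex_of_real_compose [measurable (raw)]:
  assumes "f \<in> borel_measurable M"
  shows "(\<lambda>x. complex_of_real (f x)) \<in> borel_measurable M"
  using measurable_compose[OF assms, of complex_of_real borel] borel_measurable_continuous_onI[of complex_of_real] 
    continuous_on_of_real[OF continuous_on_id] by simp

lemma integrable_cis_mult:
  assumes h: "integrable lborel h" and [measurable]: "w \<in> borel_measurable lborel"
  shows "integrable lborel (\<lambda>x::'a::euclidean_space. cis (w x) * h x)"
proof -
  have [measurable]: "h \<in> borel_measurable borel" using h by (auto dest: borel_measurable_integrable)
  show ?thesis by (rule Bochner_Integration.integrable_bound[OF h]) (auto simp: norm_mult)
qed

text \<open>A substitute for the Plancherel theorem: the Gaussian weight makes Fubini's theorem applicable, and it
  disappears in the limit \<open>t \<rightarrow> \<infinity>\<close>.\<close>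

lemma fourier_gaussian_energy:
  fixes h :: "'a::euclidean_space \<Rightarrow> complex"
  assumes h: "integrable lborel h"
  shows "has_bochner_integral lborel (\<lambda>\<xi>. (cmod (fourier h (t *\<^sub>R \<xi>)))\<^sup>2 * exp (- (norm \<xi>)\<^sup>2 / 2))
     (sqrt (2 * pi) ^ DIM('a) * Re (LINT p|lborel. h (fst p) * cnj (h (snd p)) * exp (- t\<^sup>2 * (norm (fst p - snd p))\<^sup>2 / 2)))"
proof -
  have hm[measurable]: "h \<in> borel_measurable borel" using h by (auto dest: borel_measurable_integrable)
  have hc: "integrable lborel (\<lambda>x. cnj (h x))" using h by simp
  let ?H = "\<lambda>p. h (fst p) * cnj (h (snd p))"
  let ?c = "sqrt (2 * pi) ^ DIM('a)"
  let ?e = "\<lambda>\<xi>::'a. complex_of_real (exp (- (norm \<xi>)\<^sup>2 / 2))"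
  have Hint: "integrable lborel ?H"
    using has_bochner_integral_lborel_prod[OF h hc] by (simp add: has_bochner_integral_iff)
  have eint: "integrable lborel ?e"
    using integral_gaussian[where 'a='a, of "1/2"] by (auto simp: has_bochner_integral_iff)
  \<comment> \<open>Integrating over the pair of points first gives the squared modulus of the
    transform; integrating over the frequency first gives a Gaussian in the difference of the
    points.\<close>
  let ?F = "\<lambda>q. cis ((t *\<^sub>R fst q) \<bullet> (fst (snd q) - snd (snd q))) * (?e (fst q) * ?H (snd q))"
  have Fint: "integrable (lborel \<Otimes>\<^sub>M lborel) ?F"
    unfolding lborel_prod
  proof (rule integrable_cis_mult)
    show "integrable lborel (\<lambda>q. ?e (fst q) * ?H (snd q))"
      using has_bochner_integral_lborel_prod[OF eint Hint] unfolding has_bochner_integral_iff by blast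
    show "(\<lambda>q::'a \<times> 'a \<times> 'a. (t *\<^sub>R fst q) \<bullet> (fst (snd q) - snd (snd q))) \<in> borel_measurable lborel"
      unfolding measurable_lborel2 by (intro borel_measurable_continuous_onI continuous_intros)
  qed
  have 1: "(LINT p|lborel. ?F (\<xi>, p)) = of_real ((cmod (fourier h (t *\<^sub>R \<xi>)))\<^sup>2 * exp (- (norm \<xi>)\<^sup>2 / 2))" for \<xi>
  proof -
    let ?a = "\<lambda>x. cis ((t *\<^sub>R \<xi>) \<bullet> x) * h x"
    have a: "integrable lborel ?a" by (rule integrable_cis_mult[OF h]) auto
    then have ac: "integrable lborel (\<lambda>x. cnj (?a x))" by (simp del: complex_cnj_mult)
    have "(LINT p|lborel. ?F (\<xi>, p)) = (LINT p|lborel. ?e \<xi> * (?a (fst p) * cnj (?a (snd p))))"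
    proof -
      have "cis (u - v) = cis u * cnj (cis v)" for u v by (simp add: cis_cnj cis_mult)
      then show ?thesis by (simp only: inner_diff_right complex_cnj_mult fst_conv snd_conv mult_ac)
    qed
    also have "\<dots> = ?e \<xi> * ((LINT x|lborel. ?a x) * (LINT x|lborel. cnj (?a x)))"
      by (simp only: integral_mult_right_zero has_bochner_integral_integral_eq[OF has_bochner_integral_lborel_prod[OF a ac]])
    also have "(LINT x|lborel. cnj (?a x)) = cnj (LINT x|lborel. ?a x)"
      by (rule Bochner_Integration.integral_cnj)
    also have "?e \<xi> * ((LINT x|lborel. ?a x) * cnj (LINT x|lborel. ?a x)) = of_real ((cmod (fourier h (t *\<^sub>R \<xi>)))\<^sup>2 * exp (- (norm \<xi>)\<^sup>2 / 2))"
      by (simp add: fourier_def complex_norm_square[symmetric] mult.commute)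
    finally show ?thesis .
  qed
  have 2: "(LINT \<xi>|lborel. ?F (\<xi>, p)) = of_real ?c * (?H p * exp (- t\<^sup>2 * (norm (fst p - snd p))\<^sup>2 / 2))" for p
  proof -
    let ?z = "fst p - snd p"
    have "(LINT \<xi>|lborel. ?F (\<xi>, p)) = (LINT \<xi>|lborel. ?H p * (exp (- (1/2) * (norm \<xi>)\<^sup>2) *\<^sub>R cis ((t *\<^sub>R ?z) \<bullet> \<xi>)))"
      by (rule Bochner_Integration.integral_cong) (auto simp: scaleR_conv_of_real inner_commute)
    also have "\<dots> = ?H p * of_real (sqrt (pi / (1/2)) ^ DIM('a) * exp (- (norm (t *\<^sub>R ?z))\<^sup>2 / (4 * (1/2))))"
      using integral_gaussian_cis[where z="t *\<^sub>R ?z" and a="1/2"] unfolding has_bochner_integral_iff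
      by (simp only: integral_mult_right_zero)
    finally show ?thesis by (simp add: power_mult_distrib mult_ac exp_of_real[symmetric])
  qed
  have "integrable lborel (\<lambda>\<xi>. LINT p|lborel. ?F (\<xi>, p))" using lborel_pair.integrable_fst'[OF Fint] .
  then have I: "integrable lborel (\<lambda>\<xi>. (cmod (fourier h (t *\<^sub>R \<xi>)))\<^sup>2 * exp (- (norm \<xi>)\<^sup>2 / 2))"
    unfolding 1 by (simp only: complex_of_real_integrable_eq)
  have "of_real (LINT \<xi>|lborel. (cmod (fourier h (t *\<^sub>R \<xi>)))\<^sup>2 * exp (- (norm \<xi>)\<^sup>2 / 2)) = (LINT \<xi>|lborel. LINT p|lborel. ?F (\<xi>, p))"
    unfolding 1 by (rule integral_complex_of_real[symmetric])
  also have "\<dots> = (LINT p|lborel. LINT \<xi>|lborel. ?F (\<xi>, p))"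
    by (rule lborel_pair.Fubini_integral[symmetric]) (use Fint in \<open>simp add: case_prod_unfold\<close>)
  also have "\<dots> = of_real ?c * (LINT p|lborel. ?H p * exp (- t\<^sup>2 * (norm (fst p - snd p))\<^sup>2 / 2))"
    unfolding 2 by (rule integral_mult_right_zero)
  finally have "Re (of_real (LINT \<xi>|lborel. (cmod (fourier h (t *\<^sub>R \<xi>)))\<^sup>2 * exp (- (norm \<xi>)\<^sup>2 / 2))) = Re (of_real ?c * (LINT p|lborel. ?H p * exp (- t\<^sup>2 * (norm (fst p - snd p))\<^sup>2 / 2)))"
    by (rule arg_cong)
  then have "(LINT \<xi>|lborel. (cmod (fourier h (t *\<^sub>R \<xi>)))\<^sup>2 * exp (- (norm \<xi>)\<^sup>2 / 2)) = ?c * Re (LINT p|lborel. ?H p * exp (- t\<^sup>2 * (norm (fst p - snd p))\<^sup>2 / 2))"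
    by (simp only: Re_complex_of_real times_complex.sel Im_complex_of_real mult_zero_left diff_zero)
  with I show ?thesis unfolding has_bochner_integral_iff by blast
qed

text \<open>A Schur test: the product of \<open>cmod (h x)\<close> and \<open>cmod (h y)\<close> is
  at most half the sum of their squares, and the Gaussian in \<open>x - y\<close> has mass
  \<open>sqrt (2 * pi) ^ DIM('a) / t ^ DIM('a)\<close>. The powers of \<open>t\<close> cancel, which
  makes the bound uniform. It serves for the components of \<open>f\<close>, which are merely
  integrable and square integrable.\<close>

lemma fourier_gaussian_energy_le:
  fixes h :: "'a::euclidean_space \<Rightarrow> complex"
  assumes h: "integrable lborel h" and h2: "integrable lborel (\<lambda>x. (cmod (h x))\<^sup>2)" and t: "t > 0"
  shows "t ^ DIM('a) * (LINT \<xi>|lborel. (cmod (fourier h (t *\<^sub>R \<xi>)))\<^sup>2 * exp (- (norm \<xi>)\<^sup>2 / 2))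
     \<le> (2 * pi) ^ DIM('a) * (LINT x|lborel. (cmod (h x))\<^sup>2)"
proof -
  have hm[measurable]: "h \<in> borel_measurable borel" using h by (auto dest: borel_measurable_integrable)
  let ?E = "\<lambda>z::'a. exp (- t\<^sup>2 * (norm z)\<^sup>2 / 2)"
  let ?c = "sqrt (2 * pi) ^ DIM('a)"
  let ?I = "LINT x|lborel. (cmod (h x))\<^sup>2"
  have E: "has_bochner_integral lborel ?E (?c / t ^ DIM('a))"
    using integral_gaussian[where 'a='a, of "t\<^sup>2 / 2"] t by (simp add: real_sqrt_divide power_divide mult.commute)
  note Etr = has_bochner_integral_lborel_translate[OF E]
  have q1: "integrable (lborel \<Otimes>\<^sub>M lborel) (\<lambda>p. (cmod (h (fst p)))\<^sup>2 * ?E (fst p - snd p))"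
  proof (rule lborel_pair.Fubini_integrable)
    show "integrable lborel (\<lambda>x. LINT y|lborel. norm ((cmod (h (fst (x, y))))\<^sup>2 * ?E (fst (x, y) - snd (x, y))))"
      using Etr(2) h2 by (simp add: has_bochner_integral_iff)
    show "AE x in lborel. integrable lborel (\<lambda>y. (cmod (h (fst (x, y))))\<^sup>2 * ?E (fst (x, y) - snd (x, y)))"
      using Etr(2) by (auto simp: has_bochner_integral_iff)
  qed measurable
  have v1: "(LINT p|(lborel \<Otimes>\<^sub>M lborel). (cmod (h (fst p)))\<^sup>2 * ?E (fst p - snd p)) = ?I * (?c / t ^ DIM('a))"
    using lborel_pair.integral_fst'[OF q1] Etr(2) by (simp add: has_bochner_integral_iff)
  have q2: "integrable (lborel \<Otimes>\<^sub>M lborel) (\<lambda>p. (cmod (h (snd p)))\<^sup>2 * ?E (fst p - snd p))"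
    using lborel_pair.integrable_product_swap[OF q1] by (simp add: case_prod_beta' norm_minus_commute)
  have v2: "(LINT p|(lborel \<Otimes>\<^sub>M lborel). (cmod (h (snd p)))\<^sup>2 * ?E (fst p - snd p)) = ?I * (?c / t ^ DIM('a))"
    using lborel_pair.integral_product_swap[of "\<lambda>p. (cmod (h (fst p)))\<^sup>2 * ?E (fst p - snd p)"] v1 q1
    by (simp add: case_prod_beta' norm_minus_commute)
  let ?Q = "\<lambda>p. h (fst p) * cnj (h (snd p)) * exp (- t\<^sup>2 * (norm (fst p - snd p))\<^sup>2 / 2)"
  have "Re (LINT p|lborel. ?Q p) \<le> norm (LINT p|lborel. ?Q p)" by (rule complex_Re_le_cmod)
  also have "\<dots> \<le> (LINT p|(lborel \<Otimes>\<^sub>M lborel). (1/2) * ((cmod (h (fst p)))\<^sup>2 * ?E (fst p - snd p)) + (1/2) * ((cmod (h (snd p)))\<^sup>2 * ?E (fst p - snd p)))"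
    unfolding lborel_prod[symmetric]
  proof (rule Bochner_Integration.integral_norm_bound_integral)
    show int: "integrable (lborel \<Otimes>\<^sub>M lborel) (\<lambda>p. (1/2) * ((cmod (h (fst p)))\<^sup>2 * ?E (fst p - snd p)) + (1/2) * ((cmod (h (snd p)))\<^sup>2 * ?E (fst p - snd p)))"
      using q1 q2 by (intro Bochner_Integration.integrable_add integrable_mult_right)
    show le: "norm (?Q p) \<le> (1/2) * ((cmod (h (fst p)))\<^sup>2 * ?E (fst p - snd p)) + (1/2) * ((cmod (h (snd p)))\<^sup>2 * ?E (fst p - snd p))" for p
    proof -
      have "cmod (h (fst p)) * cmod (h (snd p)) \<le> (1/2) * (cmod (h (fst p)))\<^sup>2 + (1/2) * (cmod (h (snd p)))\<^sup>2"
        using sum_squares_bound[of "cmod (h (fst p))" "cmod (h (snd p))"] by simp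
      then have "(cmod (h (fst p)) * cmod (h (snd p))) * ?E (fst p - snd p) \<le> ((1/2) * (cmod (h (fst p)))\<^sup>2 + (1/2) * (cmod (h (snd p)))\<^sup>2) * ?E (fst p - snd p)"
        by (rule mult_right_mono) simp
      then show ?thesis by (simp add: norm_mult exp_of_real[symmetric] algebra_simps)
    qed
    show "integrable (lborel \<Otimes>\<^sub>M lborel) ?Q"
    proof (rule Bochner_Integration.integrable_bound[OF int])
      show "AE p in lborel \<Otimes>\<^sub>M lborel. norm (?Q p) \<le> norm ((1/2) * ((cmod (h (fst p)))\<^sup>2 * ?E (fst p - snd p)) + (1/2) * ((cmod (h (snd p)))\<^sup>2 * ?E (fst p - snd p)))"
        by (rule AE_I2) (rule order_trans[OF le], simp)
    qed measurable
  qed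
  also have "\<dots> = ?I * (?c / t ^ DIM('a))"
    using q1 q2 v1 v2 by (subst Bochner_Integration.integral_add) auto
  finally have *: "Re (LINT p|lborel. ?Q p) \<le> ?I * (?c / t ^ DIM('a))" .
  have "t ^ DIM('a) * (LINT \<xi>|lborel. (cmod (fourier h (t *\<^sub>R \<xi>)))\<^sup>2 * exp (- (norm \<xi>)\<^sup>2 / 2)) = t ^ DIM('a) * ?c * Re (LINT p|lborel. ?Q p)"
    using fourier_gaussian_energy[OF h, of t] by (simp add: has_bochner_integral_iff)
  also have "\<dots> \<le> t ^ DIM('a) * ?c * (?I * (?c / t ^ DIM('a)))"
    using * t by (intro mult_left_mono) auto
  also have "\<dots> = (2 * pi) ^ DIM('a) * ?I"
  proof -
    have "?c * ?c = (2 * pi) ^ DIM('a)" unfolding power_mult_distrib[symmetric] by simp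
    then show ?thesis using t by (simp add: mult_ac)
  qed
  finally show ?thesis .
qed

text \<open>The substitution \<open>y = x - z / (n + 1)\<close> turns the narrowing Gaussian into a
  fixed weight in \<open>z\<close>; its Jacobian uses up the power of \<open>n + 1\<close>.
  Continuity gives the pointwise limit and boundedness the dominating function. It serves for the
  convolution side, which is continuous and bounded.\<close>

lemma fourier_gaussian_energy_tendsto:
  fixes h :: "'a::euclidean_space \<Rightarrow> complex"
  assumes h: "integrable lborel h" and cont: "continuous_on UNIV h" and bd: "\<And>x. cmod (h x) \<le> B"
  shows "(\<lambda>n. real (Suc n) ^ DIM('a) * (LINT \<xi>|lborel. (cmod (fourier h (real (Suc n) *\<^sub>R \<xi>)))\<^sup>2 * exp (- (norm \<xi>)\<^sup>2 / 2)))
     \<longlonglongrightarrow> (2 * pi) ^ DIM('a) * (LINT x|lborel. (cmod (h x))\<^sup>2)"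
proof -
  have hm[measurable]: "h \<in> borel_measurable borel" using h by (auto dest: borel_measurable_integrable)
  let ?e = "\<lambda>z::'a. complex_of_real (exp (- (norm z)\<^sup>2 / 2))"
  let ?c = "sqrt (2 * pi) ^ DIM('a)"
  let ?Q = "\<lambda>n p. h (fst p) * cnj (h (snd p)) * exp (- (real (Suc n))\<^sup>2 * (norm (fst p - snd p))\<^sup>2 / 2)"
  have e: "has_bochner_integral lborel ?e (of_real ?c)"
    using integral_gaussian[where 'a='a, of "1/2"] 
    by (auto simp: has_bochner_integral_iff mult.commute)
  have B: "B \<ge> 0" using bd[of 0] norm_ge_zero order_trans by blast
  let ?P = "\<lambda>n p. h (fst p) * cnj (h (fst p - inverse (real (Suc n)) *\<^sub>R snd p)) * ?e (snd p)"
  have hcont: "isCont h x" for x using cont by (simp add: continuous_on_eq_continuous_at)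
  have dom: "integrable (lborel \<Otimes>\<^sub>M lborel) (\<lambda>p. of_real B * (h (fst p) * ?e (snd p)))"
    unfolding lborel_prod by (rule integrable_mult_right) (use has_bochner_integral_lborel_prod[OF h, of ?e] e in \<open>simp add: has_bochner_integral_iff\<close>)
  have Pdom: "norm (?P n p) \<le> norm (of_real B * (h (fst p) * ?e (snd p)))" for n p
  proof -
    have "norm (?P n p) = cmod (h (fst p - inverse (real (Suc n)) *\<^sub>R snd p)) * (cmod (h (fst p)) * norm (?e (snd p)))"
      by (simp add: norm_mult)
    also have "\<dots> \<le> B * (cmod (h (fst p)) * norm (?e (snd p)))" by (intro mult_right_mono bd) simp
    finally show ?thesis using B by (simp add: norm_mult)
  qed
  have Pint: "integrable (lborel \<Otimes>\<^sub>M lborel) (?P n)" for n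
    by (rule Bochner_Integration.integrable_bound[OF dom]) (measurable, intro AE_I2 Pdom)
  have lim: "(\<lambda>n. LINT p|(lborel \<Otimes>\<^sub>M lborel). ?P n p) \<longlonglongrightarrow> (LINT p|(lborel \<Otimes>\<^sub>M lborel). h (fst p) * cnj (h (fst p)) * ?e (snd p))"
  proof (rule integral_dominated_convergence[where w="\<lambda>p. norm (of_real B * (h (fst p) * ?e (snd p)))"])
    show "AE p in lborel \<Otimes>\<^sub>M lborel. (\<lambda>n. ?P n p) \<longlonglongrightarrow> h (fst p) * cnj (h (fst p)) * ?e (snd p)"
    proof (rule AE_I2)
      fix p :: "'a \<times> 'a"
      have "(\<lambda>n. fst p - inverse (real (Suc n)) *\<^sub>R snd p) \<longlonglongrightarrow> fst p - 0 *\<^sub>R snd p"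
        by (intro tendsto_intros LIMSEQ_inverse_real_of_nat)
      then have "(\<lambda>n. h (fst p - inverse (real (Suc n)) *\<^sub>R snd p)) \<longlonglongrightarrow> h (fst p)"
        by (intro isCont_tendsto_compose[OF hcont]) simp
      then show "(\<lambda>n. ?P n p) \<longlonglongrightarrow> h (fst p) * cnj (h (fst p)) * ?e (snd p)"
        by (intro tendsto_intros)
    qed
    show "AE p in lborel \<Otimes>\<^sub>M lborel. norm (?P n p) \<le> norm (of_real B * (h (fst p) * ?e (snd p)))" for n
      by (intro AE_I2 Pdom)
    show "integrable (lborel \<Otimes>\<^sub>M lborel) (\<lambda>p. norm (of_real B * (h (fst p) * ?e (snd p))))"
      using dom by (rule integrable_norm)
  qed measurable
  have h2: "integrable lborel (\<lambda>x. h x * cnj (h x))"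
  proof (rule Bochner_Integration.integrable_bound[where f="\<lambda>x. of_real B * h x"])
    show "integrable lborel (\<lambda>x. of_real B * h x)" using h by (rule integrable_mult_right)
    show "AE x in lborel. norm (h x * cnj (h x)) \<le> norm (of_real B * h x)"
      using B by (intro AE_I2) (simp add: norm_mult mult_right_mono bd)
  qed measurable
  have "(LINT p|(lborel \<Otimes>\<^sub>M lborel). h (fst p) * cnj (h (fst p)) * ?e (snd p)) = (LINT x|lborel. h x * cnj (h x)) * of_real ?c"
    using has_bochner_integral_lborel_prod[OF h2, of ?e] e by (simp add: has_bochner_integral_iff lborel_prod)
  also have "(LINT x|lborel. h x * cnj (h x)) = of_real (LINT x|lborel. (cmod (h x))\<^sup>2)"
    by (simp only: complex_norm_square[symmetric] integral_complex_of_real)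
  finally have lim_val: "Re (LINT p|(lborel \<Otimes>\<^sub>M lborel). h (fst p) * cnj (h (fst p)) * ?e (snd p)) = (LINT x|lborel. (cmod (h x))\<^sup>2) * ?c"
    by (simp only: Re_complex_of_real times_complex.sel Im_complex_of_real mult_zero_right diff_zero)
  have QP: "real (Suc n) ^ DIM('a) *\<^sub>R (LINT p|lborel. ?Q n p) = (LINT p|(lborel \<Otimes>\<^sub>M lborel). ?P n p)" for n
  proof -
    let ?n = "real (Suc n)"
    have le1: "a * cmod (of_real (exp (- ?n\<^sup>2 * b\<^sup>2 / 2))) \<le> a" if "a \<ge> 0" for a b :: real
      using that by (intro mult_left_le) auto
    have E: "integrable lborel (\<lambda>y. cnj (h y) * exp (- ?n\<^sup>2 * (norm (x - y))\<^sup>2 / 2))" for x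
    proof (rule Bochner_Integration.integrable_bound[OF h])
      show "AE y in lborel. norm (cnj (h y) * exp (- ?n\<^sup>2 * (norm (x - y))\<^sup>2 / 2)) \<le> norm (h y)"
        by (intro AE_I2) (simp only: norm_mult complex_mod_cnj le1 norm_ge_zero)
    qed measurable
    have inner: "?n ^ DIM('a) *\<^sub>R (LINT y|lborel. cnj (h y) * exp (- ?n\<^sup>2 * (norm (x - y))\<^sup>2 / 2)) = 
        (LINT z|lborel. cnj (h (x - inverse ?n *\<^sub>R z)) * ?e z)" for x
    proof -
      have "has_bochner_integral lborel (\<lambda>y. cnj (h y) * exp (- ?n\<^sup>2 * (norm (x - y))\<^sup>2 / 2)) (LINT y|lborel. cnj (h y) * exp (- ?n\<^sup>2 * (norm (x - y))\<^sup>2 / 2))"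
        using E[of x] by (simp add: has_bochner_integral_iff)
      moreover have "- inverse ?n \<noteq> 0" by simp
      moreover have "- ?n\<^sup>2 * (norm (x - (x + (- inverse ?n) *\<^sub>R z)))\<^sup>2 / 2 = - (norm z)\<^sup>2 / 2" for z
      proof -
        have "norm (x - (x + (- inverse ?n) *\<^sub>R z)) = inverse ?n * norm z" by simp
        moreover have "?n\<^sup>2 * (inverse ?n)\<^sup>2 = 1" unfolding power_mult_distrib[symmetric] by simp
        ultimately show ?thesis by (simp only: power_mult_distrib) (simp only: mult_minus_left mult.assoc[symmetric] mult_1)
      qed
      ultimately have "has_bochner_integral lborel (\<lambda>z. cnj (h (x + (- inverse ?n) *\<^sub>R z)) * ?e z) 
          ((LINT y|lborel. cnj (h y) * exp (- ?n\<^sup>2 * (norm (x - y))\<^sup>2 / 2)) /\<^sub>R \<bar>- inverse ?n\<bar> ^ DIM('a))"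
        using has_bochner_integral_lborel_affine[where c="- inverse ?n" and t=x and f="\<lambda>y. cnj (h y) * complex_of_real (exp (- ?n\<^sup>2 * (norm (x - y))\<^sup>2 / 2))"]
        by (simp only: not_False_eq_True simp_thms)
      moreover have "inverse (\<bar>- inverse ?n\<bar> ^ DIM('a)) = ?n ^ DIM('a)" by (simp add: power_inverse)
      ultimately show ?thesis by (simp only: has_bochner_integral_iff scaleR_minus_left add_uminus_conv_diff)
    qed
    have Qint: "integrable (lborel \<Otimes>\<^sub>M lborel) (?Q n)"
    proof (rule Bochner_Integration.integrable_bound)
      show "integrable (lborel \<Otimes>\<^sub>M lborel) (\<lambda>p. h (fst p) * cnj (h (snd p)))"
        using has_bochner_integral_lborel_prod[OF h, of "\<lambda>x. cnj (h x)"] h by (simp add: has_bochner_integral_iff lborel_prod)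
      show "AE p in lborel \<Otimes>\<^sub>M lborel. norm (?Q n p) \<le> norm (h (fst p) * cnj (h (snd p)))"
        unfolding norm_mult[of "h _ * cnj _" "of_real _"] by (intro AE_I2 le1 norm_ge_zero)
    qed measurable
    have "(LINT p|lborel. ?Q n p) = (LINT x|lborel. LINT y|lborel. ?Q n (x, y))"
      using lborel_pair.integral_fst'[OF Qint] by (simp only: lborel_prod)
    also have "\<dots> = (LINT x|lborel. h x * (LINT y|lborel. cnj (h y) * exp (- ?n\<^sup>2 * (norm (x - y))\<^sup>2 / 2)))"
      by (simp only: fst_conv snd_conv mult.assoc integral_mult_right_zero)
    finally have "?n ^ DIM('a) *\<^sub>R (LINT p|lborel. ?Q n p) = (LINT x|lborel. h x * (?n ^ DIM('a) *\<^sub>R (LINT y|lborel. cnj (h y) * exp (- ?n\<^sup>2 * (norm (x - y))\<^sup>2 / 2))))"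
      by (simp only: mult_scaleR_right integral_scaleR_right)
    also have "\<dots> = (LINT x|lborel. LINT z|lborel. ?P n (x, z))"
      by (simp only: inner fst_conv snd_conv mult.assoc integral_mult_right_zero)
    also have "\<dots> = (LINT p|(lborel \<Otimes>\<^sub>M lborel). ?P n p)"
      using lborel_pair.integral_fst'[OF Pint] by simp
    finally show ?thesis .
  qed
  have "real (Suc n) ^ DIM('a) * (LINT \<xi>|lborel. (cmod (fourier h (real (Suc n) *\<^sub>R \<xi>)))\<^sup>2 * exp (- (norm \<xi>)\<^sup>2 / 2)) = ?c * Re (LINT p|(lborel \<Otimes>\<^sub>M lborel). ?P n p)" for n
    using fourier_gaussian_energy[OF h, of "real (Suc n)"] QP[of n, symmetric] by (simp add: has_bochner_integral_iff)
  moreover have "(\<lambda>n. ?c * Re (LINT p|(lborel \<Otimes>\<^sub>M lborel). ?P n p)) \<longlonglongrightarrow> ?c * ((LINT x|lborel. (cmod (h x))\<^sup>2) * ?c)"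
    unfolding lim_val[symmetric] by (intro tendsto_intros lim)
  moreover have "?c * ((LINT x|lborel. (cmod (h x))\<^sup>2) * ?c) = (2 * pi) ^ DIM('a) * (LINT x|lborel. (cmod (h x))\<^sup>2)"
  proof -
    have "?c * ?c = (2 * pi) ^ DIM('a)" unfolding power_mult_distrib[symmetric] by simp
    then show ?thesis by (simp only: mult.assoc[symmetric] mult.commute)
  qed
  ultimately show ?thesis by simp
qed

section \<open>Convolution with a continuous kernel of bounded support\<close>

lemma continuous_bounded_support_bounded:
  fixes k :: "'a::euclidean_space \<Rightarrow> complex"
  assumes "continuous_on UNIV k" and "\<And>x. norm x > R \<Longrightarrow> k x = 0"
  obtains B where "B \<ge> 0" "\<And>x. cmod (k x) \<le> B"
proof -
  have "compact (k ` cball 0 R)"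
    by (rule compact_continuous_image) (use assms(1) continuous_on_subset in auto)
  then obtain b where b: "\<And>x. x \<in> cball 0 R \<Longrightarrow> cmod (k x) \<le> b"
    by (force simp: bounded_iff dest!: compact_imp_bounded)
  show thesis
  proof (rule that[of "max b 0"])
    fix x
    show "cmod (k x) \<le> max b 0"
      using b[of x] assms(2)[of x] by (cases "norm x \<le> R") auto
  qed simp
qed

definition convolve :: "('a::euclidean_space \<Rightarrow> complex) \<Rightarrow> ('a \<Rightarrow> complex) \<Rightarrow> 'a \<Rightarrow> complex" where
  "convolve k h x = (LINT y|lborel. k (x - y) * h y)"

context
  fixes k h :: "'a::euclidean_space \<Rightarrow> complex" and R :: real
  assumes k: "continuous_on UNIV k" "\<And>x. norm x > R \<Longrightarrow> k x = 0" and h: "integrable lborel h"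
begin

private lemma meas: "k \<in> borel_measurable borel" "h \<in> borel_measurable borel"
  using borel_measurable_continuous_onI[OF k(1)] h by (auto dest: borel_measurable_integrable)

private lemma kint: "integrable lborel k"
  by (rule integrable_continuous_bounded_support[OF k])

lemma convolve_integrand_integrable: "integrable lborel (\<lambda>y. k (x - y) * h y)"
proof -
  note [measurable] = meas
  obtain B where B: "B \<ge> 0" "\<And>x. cmod (k x) \<le> B" using continuous_bounded_support_bounded[OF k] by blast
  show ?thesis
  proof (rule Bochner_Integration.integrable_bound)
    show "integrable lborel (\<lambda>y. of_real B * h y)" using h by (rule integrable_mult_right)
    show "AE y in lborel. norm (k (x - y) * h y) \<le> norm (of_real B * h y)"
      using B by (auto simp: norm_mult mult_right_mono)
  qed measurable
qed

lemma convolve_bounded: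
  obtains B where "\<And>x. cmod (convolve k h x) \<le> B"
proof -
  obtain B where B: "B \<ge> 0" "\<And>x. cmod (k x) \<le> B" using continuous_bounded_support_bounded[OF k] by blast
  show thesis
  proof (rule that)
    fix x
    show "cmod (convolve k h x) \<le> (LINT y|lborel. B * cmod (h y))"
      unfolding convolve_def
      by (rule Bochner_Integration.integral_norm_bound_integral[OF convolve_integrand_integrable])
         (use h B in \<open>auto simp: norm_mult mult_right_mono\<close>)
  qed
qed

lemma continuous_on_convolve: "continuous_on UNIV (convolve k h)"
proof -
  note [measurable] = meas
  obtain B where B: "B \<ge> 0" "\<And>x. cmod (k x) \<le> B" using continuous_bounded_support_bounded[OF k] by blast
  have kc: "isCont k x" for x using k(1) by (simp add: continuous_on_eq_continuous_at)
  have "isCont (convolve k h) x" for x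
    unfolding continuous_at_sequentially comp_def
  proof (intro allI impI)
    fix u assume u: "u \<longlonglongrightarrow> x"
    show "(\<lambda>n. convolve k h (u n)) \<longlonglongrightarrow> convolve k h x"
      unfolding convolve_def
    proof (rule integral_dominated_convergence[where w="\<lambda>y. B * cmod (h y)"])
      show "AE y in lborel. (\<lambda>n. k (u n - y) * h y) \<longlonglongrightarrow> k (x - y) * h y"
        by (intro AE_I2 tendsto_intros isCont_tendsto_compose[OF kc] u)
      show "AE y in lborel. norm (k (u n - y) * h y) \<le> B * cmod (h y)" for n
        using B by (auto simp: norm_mult mult_right_mono)
    qed (use h in \<open>measurable, auto\<close>)
  qed
  then show ?thesis by (simp add: continuous_on_eq_continuous_at)
qed

private lemma pair_int: "integrable (lborel \<Otimes>\<^sub>M lborel) (\<lambda>(y, x). k (x - y) * h y)"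
proof (rule lborel_pair.Fubini_integrable)
  note [measurable] = meas
  have kn: "has_bochner_integral lborel (\<lambda>x. cmod (k x)) (LINT x|lborel. cmod (k x))"
    using kint by (simp add: has_bochner_integral_iff)
  show "integrable lborel (\<lambda>y. LINT x|lborel. norm (case (y, x) of (y, x) \<Rightarrow> k (x - y) * h y))"
    using has_bochner_integral_lborel_translate(1)[OF kn] h by (simp add: norm_mult has_bochner_integral_iff)
  show "AE y in lborel. integrable lborel (\<lambda>x. case (y, x) of (y, x) \<Rightarrow> k (x - y) * h y)"
    using has_bochner_integral_lborel_translate(1)[OF has_bochner_integral_integrable[OF kint]]
    by (auto simp: has_bochner_integral_iff)
  show "(\<lambda>(y, x). k (x - y) * h y) \<in> borel_measurable (lborel \<Otimes>\<^sub>M lborel)" by measurable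
qed

lemma integrable_convolve: "integrable lborel (convolve k h)"
  unfolding convolve_def[abs_def] using lborel_pair.integrable_snd[OF pair_int] by simp

lemma fourier_convolve: "fourier (convolve k h) \<xi> = fourier k \<xi> * fourier h \<xi>"
proof -
  note [measurable] = meas
  have int: "integrable (lborel \<Otimes>\<^sub>M lborel) (\<lambda>(y, x). cis (\<xi> \<bullet> x) * (k (x - y) * h y))"
    by (rule Bochner_Integration.integrable_bound[OF pair_int]) (auto simp: norm_mult)
  have "fourier (convolve k h) \<xi> = (LINT x|lborel. LINT y|lborel. cis (\<xi> \<bullet> x) * (k (x - y) * h y))"
    by (simp add: fourier_def convolve_def)
  also have "\<dots> = (LINT y|lborel. LINT x|lborel. cis (\<xi> \<bullet> x) * (k (x - y) * h y))"
    using lborel_pair.Fubini_integral[OF int] by simp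
  also have "\<dots> = (LINT y|lborel. fourier k \<xi> * (cis (\<xi> \<bullet> y) * h y))"
  proof (rule Bochner_Integration.integral_cong[OF refl])
    fix y
    have "has_bochner_integral lborel (\<lambda>x. cis (\<xi> \<bullet> (x - y)) * k (x - y)) (fourier k \<xi>)"
      unfolding fourier_def
      by (rule has_bochner_integral_lborel_translate(1)[where f="\<lambda>x. cis (\<xi> \<bullet> x) * k x", OF has_bochner_integral_integrable])
         (rule integrable_cis_mult[OF kint], measurable)
    from has_bochner_integral_mult_left[OF this, of "cis (\<xi> \<bullet> y) * h y"]
    have "has_bochner_integral lborel (\<lambda>x. (cis (\<xi> \<bullet> (x - y)) * k (x - y)) * (cis (\<xi> \<bullet> y) * h y)) (fourier k \<xi> * (cis (\<xi> \<bullet> y) * h y))"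
      by simp
    moreover have "(cis (\<xi> \<bullet> (x - y)) * k (x - y)) * (cis (\<xi> \<bullet> y) * h y) = cis (\<xi> \<bullet> x) * (k (x - y) * h y)" for x
    proof -
      have "cis (\<xi> \<bullet> x) = cis (\<xi> \<bullet> (x - y)) * cis (\<xi> \<bullet> y)" by (simp add: cis_mult inner_diff_right)
      then show ?thesis by simp
    qed
    ultimately show "(LINT x|lborel. cis (\<xi> \<bullet> x) * (k (x - y) * h y)) = fourier k \<xi> * (cis (\<xi> \<bullet> y) * h y)"
      by (simp add: has_bochner_integral_iff)
  qed
  also have "\<dots> = fourier k \<xi> * fourier h \<xi>" by (simp add: fourier_def)
  finally show ?thesis .
qed

end

lemma norm_vec_complex_power2: "(norm (v :: complex^'n))\<^sup>2 = (\<Sum>i\<in>UNIV. (cmod (v $ i))\<^sup>2)"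
  by (simp add: norm_vec_def L2_set_def sum_nonneg)

lemma integrable_vec_lambda:
  fixes u :: "'i::finite \<Rightarrow> 'a \<Rightarrow> complex"
  assumes "\<And>i. integrable M (u i)"
  shows "integrable M (\<lambda>x. \<chi> i. u i x)"
proof -
  have "bounded_linear (\<lambda>z::complex. axis i z)" for i :: 'i
    unfolding linear_conv_bounded_linear[symmetric] by (auto simp: linear_iff axis_def vec_eq_iff)
  then have "integrable M (\<lambda>x. \<Sum>i\<in>UNIV. axis i (u i x))"
    by (intro Bochner_Integration.integrable_sum) (rule integrable_bounded_linear[OF _ assms])
  also have "(\<lambda>x. \<Sum>i\<in>UNIV. axis i (u i x)) = (\<lambda>x. \<chi> i. u i x)"
    by (auto simp: fun_eq_iff vec_eq_iff axis_def if_distrib[where f="\<lambda>f. f _"] cong: if_cong)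
  finally show ?thesis .
qed

lemma fourier_sum:
  assumes "\<And>j. j \<in> J \<Longrightarrow> integrable lborel (h j)"
  shows "fourier (\<lambda>x. \<Sum>j\<in>J. h j x) \<xi> = (\<Sum>j\<in>J. fourier (h j) \<xi>)"
  unfolding fourier_def sum_distrib_left
  by (rule Bochner_Integration.integral_sum) (auto intro!: integrable_cis_mult assms)

text \<open>The pointwise bound by \<open>M\<close> is multiplied by a Gaussian weight, integrated
  and summed over the components. The energies of the components of \<open>f\<close> are bounded
  from above and those of the components of \<open>g\<close> converge, so the inequality passes to
  the norms of \<open>f\<close> and \<open>g\<close>. Since \<open>M\<close> bounds the matrix as an
  operator, the number of components does not enter the constant.\<close>

lemma fourier_multiplier_bound:
  fixes K :: "'a::euclidean_space \<Rightarrow> complex^'n^'n" and f :: "'a \<Rightarrow> complex^'n"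
  assumes K: "continuous_on UNIV K" "\<And>x. norm x > R \<Longrightarrow> K x = 0"
    and f: "integrable lborel f" "integrable lborel (\<lambda>x. (norm (f x))\<^sup>2)"
    and M: "\<And>\<xi> v. \<xi> \<noteq> 0 \<Longrightarrow> norm ((\<chi> i j. fourier (\<lambda>x. K x $ i $ j) \<xi>) *v v) \<le> M * norm v"
  defines "g \<equiv> \<lambda>x. LINT y|lborel. K (x - y) *v f y"
  shows "integrable lborel (\<lambda>x. (norm (g x))\<^sup>2)"
    and "(LINT x|lborel. (norm (g x))\<^sup>2) \<le> M\<^sup>2 * (LINT x|lborel. (norm (f x))\<^sup>2)"
    and "continuous_on UNIV g"
proof -
  define k where "k i j = (\<lambda>x. K x $ i $ j)" for i j
  define h where "h j = (\<lambda>x. f x $ j)" for j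
  have kc: "continuous_on UNIV (k i j)" and k0: "norm x > R \<Longrightarrow> k i j x = 0" for i j x
    using K by (auto simp: k_def intro!: continuous_intros)
  have hint: "integrable lborel (h j)" for j
    unfolding h_def by (rule integrable_bounded_linear[OF bounded_linear_vec_nth f(1)])
  note cv = convolve_integrand_integrable[OF kc k0 hint]
  have [measurable]: "h j \<in> borel_measurable borel" for j using hint by (auto dest: borel_measurable_integrable)
  have h2: "integrable lborel (\<lambda>x. (cmod (h j x))\<^sup>2)" for j
  proof (rule Bochner_Integration.integrable_bound[OF f(2)])
    show "AE x in lborel. norm ((cmod (h j x))\<^sup>2) \<le> norm ((norm (f x))\<^sup>2)"
      unfolding h_def norm_vec_complex_power2 by (intro AE_I2) (auto simp: sum_nonneg intro!: member_le_sum)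
  qed measurable
  define c where "c i = (\<lambda>x. \<Sum>j\<in>UNIV. convolve (k i j) (h j) x)" for i
  have gi: "g x $ i = c i x" for x i
  proof -
    have "integrable lborel (\<lambda>y. K (x - y) *v f y)"
    proof -
      have "integrable lborel (\<lambda>y. (K (x - y) *v f y) $ i)" for i
        unfolding matrix_vector_mult_def vec_lambda_beta
        by (intro Bochner_Integration.integrable_sum cv[unfolded k_def h_def])
      then have "integrable lborel (\<lambda>y. \<chi> i. (K (x - y) *v f y) $ i)" by (rule integrable_vec_lambda)
      then show ?thesis by simp
    qed
    then have "g x $ i = (LINT y|lborel. (K (x - y) *v f y) $ i)"
      unfolding g_def by (rule integral_bounded_linear[OF bounded_linear_vec_nth, symmetric])
    also have "\<dots> = c i x"
      unfolding c_def convolve_def using cv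
      by (simp add: matrix_vector_mult_def k_def h_def Bochner_Integration.integral_sum)
    finally show ?thesis .
  qed
  have g_vec: "g = (\<lambda>x. \<chi> i. c i x)" using gi by (auto simp: fun_eq_iff vec_eq_iff)
  have cint: "integrable lborel (c i)" for i
    unfolding c_def by (intro Bochner_Integration.integrable_sum integrable_convolve[OF kc k0 hint])
  have cc: "continuous_on UNIV (c i)" for i
    unfolding c_def by (intro continuous_on_sum continuous_on_convolve[OF kc k0 hint])
  have "\<exists>B. \<forall>x. cmod (c i x) \<le> B" for i
  proof -
    have "\<exists>B. \<forall>x. cmod (convolve (k i j) (h j) x) \<le> B" for j
      using convolve_bounded[OF kc k0 hint] by blast
    then obtain B where "\<And>j x. cmod (convolve (k i j) (h j) x) \<le> B j" by metis
    then show ?thesis unfolding c_def by (intro exI[of _ "\<Sum>j\<in>UNIV. B j"] allI sum_norm_le) auto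
  qed
  then obtain B where B: "\<And>i x. cmod (c i x) \<le> B i" by metis
  have [measurable]: "c i \<in> borel_measurable borel" for i using cint by (auto dest: borel_measurable_integrable)
  have c2: "integrable lborel (\<lambda>x. (cmod (c i x))\<^sup>2)" for i
  proof (rule Bochner_Integration.integrable_bound[where f="\<lambda>x. B i * cmod (c i x)"])
    show "integrable lborel (\<lambda>x. B i * cmod (c i x))" using cint by auto
    show "AE x in lborel. norm ((cmod (c i x))\<^sup>2) \<le> norm (B i * cmod (c i x))"
      using B[of i] order_trans[OF norm_ge_zero B[of i]] by (auto simp: power2_eq_square abs_mult mult_right_mono)
  qed measurable
  have g2: "(norm (g x))\<^sup>2 = (\<Sum>i\<in>UNIV. (cmod (c i x))\<^sup>2)" for x
    by (simp add: norm_vec_complex_power2 gi)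
  show "integrable lborel (\<lambda>x. (norm (g x))\<^sup>2)" unfolding g2 by (intro Bochner_Integration.integrable_sum c2)
  show "continuous_on UNIV g" unfolding g_vec by (intro continuous_intros cc)
  have fc: "fourier (c i) \<xi> = (\<Sum>j\<in>UNIV. fourier (k i j) \<xi> * fourier (h j) \<xi>)" for i \<xi>
    unfolding c_def by (subst fourier_sum) (auto simp: fourier_convolve[OF kc k0 hint] intro!: integrable_convolve[OF kc k0 hint])
  have mult: "(\<Sum>i\<in>UNIV. (cmod (fourier (c i) \<xi>))\<^sup>2) \<le> M\<^sup>2 * (\<Sum>i\<in>UNIV. (cmod (fourier (h i) \<xi>))\<^sup>2)" if "\<xi> \<noteq> 0" for \<xi>
  proof -
    let ?w = "\<chi> j. fourier (h j) \<xi>"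
    have "(norm ((\<chi> i j. fourier (k i j) \<xi>) *v ?w))\<^sup>2 \<le> (M * norm ?w)\<^sup>2"
      using M[OF that, of ?w] by (intro power_mono) (auto simp: k_def)
    moreover have "(\<chi> i j. fourier (k i j) \<xi>) *v ?w = (\<chi> i. fourier (c i) \<xi>)"
      by (simp add: vec_eq_iff matrix_vector_mult_def fc)
    ultimately show ?thesis by (simp add: norm_vec_complex_power2 power_mult_distrib)
  qed
  let ?J = "\<lambda>n h. LINT \<xi>|lborel. (cmod (fourier h (real (Suc n) *\<^sub>R \<xi>)))\<^sup>2 * exp (- (norm (\<xi>::'a))\<^sup>2 / 2)"
  let ?d = "\<lambda>n. real (Suc n) ^ DIM('a)"
  have Jint: "integrable lborel (\<lambda>\<xi>. (cmod (fourier u (real (Suc n) *\<^sub>R \<xi>)))\<^sup>2 * exp (- (norm \<xi>)\<^sup>2 / 2))" if "integrable lborel u" for u :: "'a \<Rightarrow> complex" and n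
    using fourier_gaussian_energy[OF that] by (auto simp: has_bochner_integral_iff)
  have Jle: "(\<Sum>i\<in>UNIV. ?d n * ?J n (c i)) \<le> M\<^sup>2 * ((2 * pi) ^ DIM('a) * (LINT x|lborel. (norm (f x))\<^sup>2))" for n
  proof -
    have "(\<Sum>i\<in>UNIV. ?J n (c i)) = (LINT \<xi>|lborel. (\<Sum>i\<in>UNIV. (cmod (fourier (c i) (real (Suc n) *\<^sub>R \<xi>)))\<^sup>2 * exp (- (norm \<xi>)\<^sup>2 / 2)))"
      by (rule Bochner_Integration.integral_sum[symmetric]) (rule Jint[OF cint])
    also have "\<dots> \<le> (LINT \<xi>|lborel. M\<^sup>2 * (\<Sum>i\<in>UNIV. (cmod (fourier (h i) (real (Suc n) *\<^sub>R \<xi>)))\<^sup>2 * exp (- (norm \<xi>)\<^sup>2 / 2)))"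
    proof (rule integral_mono_AE)
      \<comment> \<open>The symbol is controlled at nonzero frequencies only, hence up to a null
        set.\<close>
      have "AE \<xi> in lborel. \<xi> \<noteq> (0::'a)" by (rule AE_lborel_singleton)
      then show "AE \<xi> in lborel. (\<Sum>i\<in>UNIV. (cmod (fourier (c i) (real (Suc n) *\<^sub>R \<xi>)))\<^sup>2 * exp (- (norm \<xi>)\<^sup>2 / 2)) \<le>
          M\<^sup>2 * (\<Sum>i\<in>UNIV. (cmod (fourier (h i) (real (Suc n) *\<^sub>R \<xi>)))\<^sup>2 * exp (- (norm \<xi>)\<^sup>2 / 2))"
      proof eventually_elim
        case (elim \<xi>)
        then have "real (Suc n) *\<^sub>R \<xi> \<noteq> 0" by simp
        from mult_right_mono[OF mult[OF this], of "exp (- (norm \<xi>)\<^sup>2 / 2)"]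
        show ?case unfolding sum_distrib_right[symmetric] by (simp only: mult.assoc exp_ge_zero)
      qed
    qed (intro Bochner_Integration.integrable_sum integrable_mult_right Jint cint hint)+
    also have "\<dots> = M\<^sup>2 * (\<Sum>i\<in>UNIV. ?J n (h i))"
      unfolding integral_mult_right_zero by (subst Bochner_Integration.integral_sum[OF Jint[OF hint]]) (rule refl)
    finally have "?d n * (\<Sum>i\<in>UNIV. ?J n (c i)) \<le> ?d n * (M\<^sup>2 * (\<Sum>i\<in>UNIV. ?J n (h i)))"
      by (rule mult_left_mono) simp
    then have "(\<Sum>i\<in>UNIV. ?d n * ?J n (c i)) \<le> M\<^sup>2 * (\<Sum>i\<in>UNIV. ?d n * ?J n (h i))"
      by (simp only: sum_distrib_left mult.left_commute)
    also have "\<dots> \<le> M\<^sup>2 * (\<Sum>i\<in>UNIV. (2 * pi) ^ DIM('a) * (LINT x|lborel. (cmod (h i x))\<^sup>2))"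
      by (intro mult_left_mono sum_mono fourier_gaussian_energy_le hint h2) auto
    also have "(\<Sum>i\<in>UNIV. (2 * pi) ^ DIM('a) * (LINT x|lborel. (cmod (h i x))\<^sup>2)) = (2 * pi) ^ DIM('a) * (LINT x|lborel. (norm (f x))\<^sup>2)"
      unfolding sum_distrib_left[symmetric] norm_vec_complex_power2
      by (subst Bochner_Integration.integral_sum) (use h2 in \<open>auto simp: h_def\<close>)
    finally show ?thesis .
  qed
  have "(\<lambda>n. \<Sum>i\<in>UNIV. ?d n * ?J n (c i)) \<longlonglongrightarrow> (\<Sum>i\<in>UNIV. (2 * pi) ^ DIM('a) * (LINT x|lborel. (cmod (c i x))\<^sup>2))"
    by (rule tendsto_sum) (rule fourier_gaussian_energy_tendsto[OF cint cc B])
  then have "(\<Sum>i\<in>UNIV. (2 * pi) ^ DIM('a) * (LINT x|lborel. (cmod (c i x))\<^sup>2)) \<le> M\<^sup>2 * ((2 * pi) ^ DIM('a) * (LINT x|lborel. (norm (f x))\<^sup>2))"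
    by (rule LIMSEQ_le_const2) (use Jle in auto)
  moreover have "(\<Sum>i\<in>UNIV. (2 * pi) ^ DIM('a) * (LINT x|lborel. (cmod (c i x))\<^sup>2)) = (2 * pi) ^ DIM('a) * (LINT x|lborel. (norm (g x))\<^sup>2)"
    unfolding sum_distrib_left[symmetric] g2 by (subst Bochner_Integration.integral_sum) (use c2 in auto)
  ultimately have "(2 * pi) ^ DIM('a) * (LINT x|lborel. (norm (g x))\<^sup>2) \<le> (2 * pi) ^ DIM('a) * (M\<^sup>2 * (LINT x|lborel. (norm (f x))\<^sup>2))"
    by (simp only: mult.left_commute)
  then show "(LINT x|lborel. (norm (g x))\<^sup>2) \<le> M\<^sup>2 * (LINT x|lborel. (norm (f x))\<^sup>2)"
    by (rule mult_left_le_imp_le) simp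
qed

section \<open>Fourier transforms of derivatives\<close>

text \<open>Passage to the gauge integral over a box, where the derivative is moved under the
  integral sign.\<close>

lemma lborel_integral_eq_cbox_integral:
  fixes f :: "'a::euclidean_space \<Rightarrow> 'b::euclidean_space"
  assumes "integrable lborel f" and "\<And>x. x \<notin> cbox a b \<Longrightarrow> f x = 0"
  shows "integral (cbox a b) f = integral\<^sup>L lborel f"
proof -
  have "(\<lambda>x. if x \<in> cbox a b then f x else 0) = f" using assms(2) by auto
  then show ?thesis
    using integral_restrict_UNIV[of "cbox a b" f] integral_lborel[OF assms(1)] by simp
qed

text \<open>By translation invariance the integral of \<open>\<psi> (x + t *\<^sub>R e)\<close> does
  not depend on \<open>t\<close>, and its derivative at \<open>t = 0\<close> is the integral of
  \<open>\<psi>'\<close>.\<close>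

lemma integral_directional_derivative_eq_0:
  fixes \<psi> :: "'a::euclidean_space \<Rightarrow> complex"
  assumes deriv: "\<And>x. ((\<lambda>t. \<psi> (x + t *\<^sub>R e)) has_vector_derivative \<psi>' x) (at 0)"
    and cont: "continuous_on UNIV \<psi>" and cont': "continuous_on UNIV \<psi>'"
    and supp: "\<And>x. norm x > R \<Longrightarrow> \<psi> x = 0" and supp': "\<And>x. norm x > R \<Longrightarrow> \<psi>' x = 0"
  shows "(LINT x|lborel. \<psi>' x) = 0"
proof -
  \<comment> \<open>The margin \<open>norm e\<close> keeps the support of every translate with
    \<open>\<bar>t\<bar> \<le> 1\<close> inside one fixed box.\<close>
  have "bounded (cball (0::'a) (R + norm e))" by simp
  then obtain a where a: "cball (0::'a) (R + norm e) \<subseteq> cbox (-a) a" using bounded_subset_cbox_symmetric by blast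
  let ?B = "cbox (-a) a"
  let ?U = "{-1..1::real}"
  have out: "norm x > R + norm e" if "x \<notin> ?B" for x using that a by (force simp: not_le[symmetric])
  have deriv_at: "((\<lambda>s. \<psi> (x + s *\<^sub>R e)) has_vector_derivative \<psi>' (x + t *\<^sub>R e)) (at t)" for x t
  proof -
    have "((\<lambda>s. s - t) has_vector_derivative 1) (at t)" by (auto intro!: derivative_eq_intros)
    from vector_diff_chain_at[OF this, of "\<lambda>s. \<psi> ((x + t *\<^sub>R e) + s *\<^sub>R e)"] deriv[of "x + t *\<^sub>R e"]
    have "((\<lambda>s. \<psi> ((x + t *\<^sub>R e) + s *\<^sub>R e)) \<circ> (\<lambda>s. s - t) has_vector_derivative \<psi>' (x + t *\<^sub>R e)) (at t)" by simp
    then show ?thesis by (simp add: o_def algebra_simps)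
  qed
  have int: "integrable lborel \<psi>" by (rule integrable_continuous_bounded_support[OF cont supp])
  have int': "integrable lborel \<psi>'" by (rule integrable_continuous_bounded_support[OF cont' supp'])
  have const: "integral ?B (\<lambda>x. \<psi> (x + t *\<^sub>R e)) = integral\<^sup>L lborel \<psi>" if "t \<in> ?U" for t
  proof -
    have tr: "has_bochner_integral lborel (\<lambda>x. \<psi> (x - (- (t *\<^sub>R e)))) (integral\<^sup>L lborel \<psi>)"
      by (rule has_bochner_integral_lborel_translate(1)[OF has_bochner_integral_integrable[OF int]])
    have "\<psi> (x + t *\<^sub>R e) = 0" if "x \<notin> ?B" for x
    proof (rule supp)
      have "norm (t *\<^sub>R e) \<le> norm e" using \<open>t \<in> ?U\<close> by (auto simp: abs_le_iff intro!: mult_left_le_one_le)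
      then show "R < norm (x + t *\<^sub>R e)" using out[OF that] norm_triangle_ineq2[of x "- (t *\<^sub>R e)"] by simp
    qed
    then show ?thesis using tr by (subst lborel_integral_eq_cbox_integral) (auto simp: has_bochner_integral_iff)
  qed
  have "((\<lambda>t. integral ?B (\<lambda>x. \<psi> (x + t *\<^sub>R e))) has_vector_derivative integral ?B (\<lambda>x. \<psi>' (x + 0 *\<^sub>R e))) (at 0 within ?U)"
  proof (rule leibniz_rule_vector_derivative)
    show "((\<lambda>t. \<psi> (x + t *\<^sub>R e)) has_vector_derivative \<psi>' (x + t *\<^sub>R e)) (at t within ?U)" for x t
      by (rule has_vector_derivative_at_within[OF deriv_at])
    show "(\<lambda>x. \<psi> (x + t *\<^sub>R e)) integrable_on ?B" for t
      by (intro integrable_continuous continuous_on_compose2[OF cont]) (auto intro!: continuous_intros)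
    show "continuous_on (?U \<times> ?B) (\<lambda>(t, x). \<psi>' (x + t *\<^sub>R e))"
      unfolding case_prod_unfold by (intro continuous_on_compose2[OF cont']) (auto intro!: continuous_intros)
  qed auto
  moreover have "((\<lambda>t. integral ?B (\<lambda>x. \<psi> (x + t *\<^sub>R e))) has_vector_derivative 0) (at 0 within ?U)"
    by (rule has_vector_derivative_transform[OF _ _ has_vector_derivative_const[of "integral\<^sup>L lborel \<psi>"]]) (use const in auto)
  ultimately have "integral ?B (\<lambda>x. \<psi>' (x + 0 *\<^sub>R e)) = 0"
    by (rule vector_derivative_unique_within[rotated]) (simp add: trivial_limit_within islimpt_Icc)
  moreover have "integral ?B \<psi>' = integral\<^sup>L lborel \<psi>'"
  proof (rule lborel_integral_eq_cbox_integral[OF int' supp'])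
    show "R < norm x" if "x \<notin> ?B" for x using out[OF that] norm_ge_zero[of e] by linarith
  qed
  ultimately show ?thesis by simp
qed

text \<open>The directional derivative of \<open>cis (\<xi> \<bullet> x) * \<psi> x\<close> has
  integral 0, and the product rule splits that integral into the two transforms.\<close>

lemma fourier_directional_derivative:
  fixes \<psi> :: "'a::euclidean_space \<Rightarrow> complex"
  assumes deriv: "\<And>x. ((\<lambda>t. \<psi> (x + t *\<^sub>R e)) has_vector_derivative \<psi>' x) (at 0)"
    and cont: "continuous_on UNIV \<psi>" and cont': "continuous_on UNIV \<psi>'"
    and supp: "\<And>x. norm x > R \<Longrightarrow> \<psi> x = 0" and supp': "\<And>x. norm x > R \<Longrightarrow> \<psi>' x = 0"
  shows "fourier \<psi>' \<xi> = - \<i> * of_real (\<xi> \<bullet> e) * fourier \<psi> \<xi>"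
proof -
  let ?c = "\<i> * complex_of_real (\<xi> \<bullet> e)"
  have cis': "((\<lambda>t. cis (\<xi> \<bullet> (x + t *\<^sub>R e))) has_vector_derivative ?c * cis (\<xi> \<bullet> x)) (at 0)" for x
  proof -
    have "((\<lambda>t. cis (\<xi> \<bullet> (x + t *\<^sub>R e))) has_derivative (\<lambda>t. (t * (\<xi> \<bullet> e)) *\<^sub>R (\<i> * cis (\<xi> \<bullet> (x + 0 *\<^sub>R e))))) (at 0)"
      by (auto intro!: derivative_eq_intros simp: inner_add_right)
    then show ?thesis by (simp add: has_vector_derivative_def scaleR_conv_of_real mult_ac)
  qed
  have int: "integrable lborel \<psi>" by (rule integrable_continuous_bounded_support[OF cont supp])
  have int': "integrable lborel \<psi>'" by (rule integrable_continuous_bounded_support[OF cont' supp'])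
  have cc: "continuous_on UNIV (\<lambda>x. cis (\<xi> \<bullet> x))" by (auto simp: cis_conv_exp intro!: continuous_intros)
  have "(LINT x|lborel. cis (\<xi> \<bullet> x) * \<psi>' x + ?c * (cis (\<xi> \<bullet> x) * \<psi> x)) = 0"
  proof (rule integral_directional_derivative_eq_0[where \<psi>="\<lambda>x. cis (\<xi> \<bullet> x) * \<psi> x" and e=e and R=R])
    show "((\<lambda>t. cis (\<xi> \<bullet> (x + t *\<^sub>R e)) * \<psi> (x + t *\<^sub>R e)) has_vector_derivative cis (\<xi> \<bullet> x) * \<psi>' x + ?c * (cis (\<xi> \<bullet> x) * \<psi> x)) (at 0)" for x
      using has_vector_derivative_mult[OF cis' deriv, of x] by (simp add: mult.assoc)
  qed (auto intro!: continuous_intros cc cont cont' simp: supp supp')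
  moreover have "integrable lborel (\<lambda>x. cis (\<xi> \<bullet> x) * \<psi> x)" "integrable lborel (\<lambda>x. cis (\<xi> \<bullet> x) * \<psi>' x)"
    by (intro integrable_cis_mult int int', measurable)+
  ultimately have "fourier \<psi>' \<xi> + ?c * fourier \<psi> \<xi> = 0"
    unfolding fourier_def by (subst (asm) Bochner_Integration.integral_add) auto
  then show ?thesis by (simp add: eq_neg_iff_add_eq_0)
qed

section \<open>The truncated outgoing wave\<close>

lemma has_real_derivative_max_0_power:
  "((\<lambda>x::real. max 0 x ^ Suc (Suc n)) has_real_derivative real (Suc (Suc n)) * max 0 x ^ Suc n) (at x)"
proof -
  consider "x > 0" | "x < 0" | "x = 0" by linarith
  then show ?thesis
  proof cases
    case 1
    have "((\<lambda>x::real. x ^ Suc (Suc n)) has_real_derivative real (Suc (Suc n)) * max 0 x ^ Suc n) (at x)"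
      using 1 by (intro DERIV_cong[OF DERIV_pow]) (simp add: max_def)
    then show ?thesis
      by (rule has_field_derivative_transform_within_open[of _ _ _ "{0<..}"]) (use 1 in \<open>auto simp: max_def\<close>)
  next
    case 2
    have "((\<lambda>x::real. 0) has_real_derivative real (Suc (Suc n)) * max 0 x ^ Suc n) (at x)"
      using 2 by (auto simp: max_def)
    then show ?thesis
      by (rule has_field_derivative_transform_within_open[of _ _ _ "{..<0}"]) (use 2 in \<open>auto simp: max_def\<close>)
  next
    case 3
    \<comment> \<open>At the kink the difference quotient is bounded by a positive power of
      \<open>\<bar>h\<bar>\<close>, because the exponent is at least 2.\<close>
    have "((\<lambda>h::real. max 0 h ^ Suc (Suc n) / h) \<longlongrightarrow> 0) (at 0)"
    proof (rule Lim_null_comparison)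
      show "\<forall>\<^sub>F h in at 0. norm (max 0 h ^ Suc (Suc n) / h) \<le> \<bar>h\<bar> ^ Suc n"
      proof (intro always_eventually allI)
        fix h :: real
        show "norm (max 0 h ^ Suc (Suc n) / h) \<le> \<bar>h\<bar> ^ Suc n" by (cases "h \<le> 0") (simp_all add: max_absorb1 max_def zero_le_power_abs del: power_Suc, simp)
      qed
      show "((\<lambda>h::real. \<bar>h\<bar> ^ Suc n) \<longlongrightarrow> 0) (at 0)"
        by (rule tendsto_eq_intros | simp)+
    qed
    then show ?thesis using 3 by (simp add: has_field_derivative_iff)
  qed
qed

text \<open>Descends from 1 at \<open>3 * l\<close> to 0 at \<open>4 * l\<close>. The cube is the
  lowest power of a positive part with a continuous second derivative, which is what a continuous
  Hessian requires; the outer cube smooths the arrival at 0, the inner one the departure from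
  1.\<close>

definition cutoff :: "real \<Rightarrow> real \<Rightarrow> real" where
  "cutoff l \<rho> = max 0 (1 - max 0 ((\<rho> - 3 * l) / l) ^ 3) ^ 3"

definition cutoff' :: "real \<Rightarrow> real \<Rightarrow> real" where
  "cutoff' l \<rho> = - (9 / l) * (max 0 (1 - max 0 ((\<rho> - 3 * l) / l) ^ 3) ^ 2 * max 0 ((\<rho> - 3 * l) / l) ^ 2)"

definition cutoff'' :: "real \<Rightarrow> real \<Rightarrow> real" where
  "cutoff'' l \<rho> = (let t = max 0 ((\<rho> - 3 * l) / l); m = max 0 (1 - t ^ 3) in
     - (9 / l) * (2 * m * (- (3 * t\<^sup>2 / l)) * t\<^sup>2 + m\<^sup>2 * (2 * t / l)))"

context
  fixes l :: real
  assumes l: "l > 0"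
begin

lemma cutoff_has_derivative: "(cutoff l has_real_derivative cutoff' l \<rho>) (at \<rho>)"
proof -
  let ?t = "\<lambda>\<rho>. (\<rho> - 3 * l) / l"
  have t: "(?t has_real_derivative 1 / l) (at \<rho>)" using l by (auto intro!: derivative_eq_intros)
  have p: "((\<lambda>x::real. max 0 x ^ 3) has_real_derivative 3 * max 0 x ^ 2) (at x)" for x
    using has_real_derivative_max_0_power[of 1 x] by (simp add: numeral_3_eq_3 numeral_2_eq_2)
  have "((\<lambda>\<rho>. 1 - max 0 (?t \<rho>) ^ 3) has_real_derivative 0 - 3 * max 0 (?t \<rho>) ^ 2 * (1 / l)) (at \<rho>)"
    by (intro DERIV_diff DERIV_const DERIV_chain2[OF p t])
  from DERIV_chain2[OF p this] show ?thesis
    by (simp add: cutoff_def[abs_def] cutoff'_def mult_ac)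
qed

lemma cutoff'_has_derivative: "(cutoff' l has_real_derivative cutoff'' l \<rho>) (at \<rho>)"
proof -
  let ?t = "\<lambda>\<rho>. (\<rho> - 3 * l) / l"
  have t: "(?t has_real_derivative 1 / l) (at \<rho>)" using l by (auto intro!: derivative_eq_intros)
  have p: "((\<lambda>x::real. max 0 x ^ 3) has_real_derivative 3 * max 0 x ^ 2) (at x)" for x
    using has_real_derivative_max_0_power[of 1 x] by (simp add: numeral_3_eq_3 numeral_2_eq_2)
  have q: "((\<lambda>x::real. max 0 x ^ 2) has_real_derivative 2 * max 0 x) (at x)" for x
    using has_real_derivative_max_0_power[of 0 x] by (simp add: numeral_2_eq_2)
  have m: "((\<lambda>\<rho>. 1 - max 0 (?t \<rho>) ^ 3) has_real_derivative 0 - 3 * max 0 (?t \<rho>) ^ 2 * (1 / l)) (at \<rho>)"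
    by (intro DERIV_diff DERIV_const DERIV_chain2[OF p t])
  from DERIV_cmult[OF DERIV_mult[OF DERIV_chain2[OF q m] DERIV_chain2[OF q t]], of "- (9 / l)"]
  show ?thesis
    unfolding cutoff'_def[abs_def] cutoff''_def Let_def by (rule DERIV_cong) simp
qed

lemma continuous_cutoff: "continuous_on A (cutoff l)" "continuous_on A (cutoff' l)" "continuous_on A (cutoff'' l)"
  using l by (auto simp: cutoff_def[abs_def] cutoff'_def[abs_def] cutoff''_def[abs_def] Let_def intro!: continuous_intros)

lemma cutoff_inner:
  assumes "\<rho> \<le> 3 * l"
  shows "cutoff l \<rho> = 1" "cutoff' l \<rho> = 0" "cutoff'' l \<rho> = 0"
proof -
  have "max 0 ((\<rho> - 3 * l) / l) = 0" using l assms by (simp add: divide_nonpos_pos max_absorb1)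
  then show "cutoff l \<rho> = 1" "cutoff' l \<rho> = 0" "cutoff'' l \<rho> = 0" by (simp_all add: cutoff_def cutoff'_def cutoff''_def)
qed

lemma cutoff_outer:
  assumes "\<rho> \<ge> 4 * l"
  shows "cutoff l \<rho> = 0" "cutoff' l \<rho> = 0" "cutoff'' l \<rho> = 0"
proof -
  have "(\<rho> - 3 * l) / l \<ge> 1" using l assms by (simp add: field_simps)
  then have "max 0 ((\<rho> - 3 * l) / l) ^ 3 \<ge> 1" by (simp add: one_le_power)
  then have "max 0 (1 - max 0 ((\<rho> - 3 * l) / l) ^ 3) = 0" by simp
  then show "cutoff l \<rho> = 0" "cutoff' l \<rho> = 0" "cutoff'' l \<rho> = 0" by (simp_all add: cutoff_def cutoff'_def cutoff''_def)
qed

text \<open>The sign of \<open>cutoff'\<close> matters most: it makes the integral of the absolute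
  derivative along the radius equal to a difference of end values, hence at most 1.\<close>

lemma cutoff_bounds: "0 \<le> cutoff l \<rho>" "cutoff l \<rho> \<le> 1" "cutoff' l \<rho> \<le> 0"
proof -
  show "0 \<le> cutoff l \<rho>" by (simp add: cutoff_def)
  show "cutoff l \<rho> \<le> 1" by (simp add: cutoff_def power_le_one)
  show "cutoff' l \<rho> \<le> 0" using l unfolding cutoff'_def by (intro mult_nonpos_nonneg) auto
qed

end

section \<open>Oscillatory sine integrals of the regularised wave\<close>

lemma sqrt_shift_has_derivative:
  assumes "e > 0"
  shows "((\<lambda>r. sqrt (r\<^sup>2 + e)) has_real_derivative r / sqrt (r\<^sup>2 + e)) (at r)"
proof -
  have "r\<^sup>2 + e > 0" using assms by (simp add: add_nonneg_pos)
  then show ?thesis by (auto intro!: derivative_eq_intros simp: field_simps)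
qed

lemma cis_has_vector_derivative:
  assumes "(u has_real_derivative u') (at r within A)"
  shows "((\<lambda>r. cis (u r)) has_vector_derivative \<i> * of_real u' * cis (u r)) (at r within A)"
proof -
  have "((\<lambda>r. cis (u r)) has_derivative (\<lambda>t. (u' * t) *\<^sub>R (\<i> * cis (u r)))) (at r within A)"
    using assms by (auto intro!: derivative_eq_intros simp: has_field_derivative_def)
  then show ?thesis by (simp add: has_vector_derivative_def scaleR_conv_of_real mult_ac)
qed

text \<open>The singularity of the outgoing wave is removed by replacing the radius by the square root of \<open>r\<^sup>2 + e\<close>.\<close>

definition wave_profile :: "real \<Rightarrow> real \<Rightarrow> real \<Rightarrow> real \<Rightarrow> complex" where
  "wave_profile l k e r = of_real (cutoff l (sqrt (r\<^sup>2 + e)) / sqrt (r\<^sup>2 + e)) * cis (k * sqrt (r\<^sup>2 + e))"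

context
  fixes l k e s :: real
  assumes l: "l > 0" and k: "k > 0" and e: "e > 0" and s: "s > 0"
begin

private abbreviation "\<rho> \<equiv> \<lambda>r. sqrt (r\<^sup>2 + e)"

private lemma pos: "r\<^sup>2 + e > 0" "\<rho> r > 0" using e by (auto simp: add_nonneg_pos)

private lemma rho_ge: "r \<ge> 0 \<Longrightarrow> r \<le> \<rho> r" using e by (auto intro!: real_le_rsqrt)

private lemma rho_le: "r \<ge> 0 \<Longrightarrow> r / \<rho> r \<le> 1" using rho_ge[of r] pos(2)[of r] by simp

private lemma rho': "(\<rho> has_real_derivative r / \<rho> r) (at r)" by (rule sqrt_shift_has_derivative[OF e])

private lemma eta': "((\<lambda>r. cutoff l (\<rho> r)) has_real_derivative cutoff' l (\<rho> r) * (r / \<rho> r)) (at r)"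
  by (rule DERIV_chain2[OF cutoff_has_derivative[OF l] rho'])

private lemma cis': "((\<lambda>r. cis (k * \<rho> r)) has_vector_derivative \<i> * of_real (k * (r / \<rho> r)) * cis (k * \<rho> r)) (at r)"
  by (intro cis_has_vector_derivative DERIV_cmult rho')

private lemma cont_wave: "continuous_on A (\<lambda>r. wave_profile l k e r * of_real (r * sin (s * r)))"
  unfolding wave_profile_def cis_conv_exp using pos(2)
  by (intro continuous_intros continuous_on_compose2[OF continuous_cutoff(1)[OF l, of UNIV]]) (auto simp: less_imp_neq[symmetric])

private abbreviation "I \<equiv> integral {0..4*l} (\<lambda>r. wave_profile l k e r * of_real (r * sin (s * r)))"

private lemma I_int: "(\<lambda>r. wave_profile l k e r * of_real (r * sin (s * r))) integrable_on {0..4*l}"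
  by (intro integrable_continuous_interval cont_wave)

private lemma ftc:
  fixes F :: "real \<Rightarrow> 'b::banach"
  assumes "\<And>r. (F has_vector_derivative f r) (at r)"
  shows "(f has_integral F (4 * l) - F 0) {0..4*l}"
proof (rule fundamental_theorem_of_calculus)
  show "(F has_vector_derivative f r) (at r within {0..4*l})" for r
    by (rule has_vector_derivative_at_within) (rule assms)
qed (use l in simp)

private lemma end_zero: "cutoff l (\<rho> (4 * l)) = 0"
  using rho_ge[of "4 * l"] l by (intro cutoff_outer) auto

private lemma eta'_int: "((\<lambda>r. - (cutoff' l (\<rho> r) * (r / \<rho> r))) has_integral cutoff l (\<rho> 0)) {0..4*l}"
proof -
  have "((\<lambda>r. - (cutoff' l (\<rho> r) * (r / \<rho> r))) has_integral (- cutoff l (\<rho> (4*l)) - (- cutoff l (\<rho> 0)))) {0..4*l}"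
    by (rule ftc) (rule has_vector_derivative_minus[OF eta'[unfolded has_real_derivative_iff_has_vector_derivative]])
  then show ?thesis using end_zero by simp
qed

text \<open>The derivative of \<open>cis (k * \<rho> r)\<close> is \<open>\<i> * k * (r / \<rho> r) * cis (k * \<rho> r)\<close>, so an integration by parts
  against this factor gains \<open>1 / k\<close>.\<close>

lemma wave_profile_sine_integral_bound1: "k * cmod I \<le> 8 * l * s"
proof -
  let ?F = "\<lambda>r. cis (k * \<rho> r) * of_real (cutoff l (\<rho> r) * sin (s * r))"
  let ?h = "\<lambda>r. cis (k * \<rho> r) * of_real (cutoff l (\<rho> r) * (s * cos (s * r)) + cutoff' l (\<rho> r) * (r / \<rho> r) * sin (s * r))"
  let ?f = "\<lambda>r. ?h r + (\<i> * of_real k) * (wave_profile l k e r * of_real (r * sin (s * r)))"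
  have der: "(?F has_vector_derivative ?f r) (at r)" for r
  proof -
    have "((\<lambda>r. cutoff l (\<rho> r) * sin (s * r)) has_real_derivative cutoff l (\<rho> r) * (s * cos (s * r)) + cutoff' l (\<rho> r) * (r / \<rho> r) * sin (s * r)) (at r)"
      by (rule DERIV_cong[OF DERIV_mult[OF eta', of "\<lambda>r. sin (s * r)" "s * cos (s * r)"]]) (auto intro!: derivative_eq_intros)
    then have "((\<lambda>r. complex_of_real (cutoff l (\<rho> r) * sin (s * r))) has_vector_derivative of_real (cutoff l (\<rho> r) * (s * cos (s * r)) + cutoff' l (\<rho> r) * (r / \<rho> r) * sin (s * r))) (at r)"
      by (intro has_vector_derivative_of_real) (simp only: has_real_derivative_iff_has_vector_derivative)
    from has_vector_derivative_mult[OF cis' this]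
    have "(?F has_vector_derivative ?h r + \<i> * of_real (k * (r / \<rho> r)) * cis (k * \<rho> r) * of_real (cutoff l (\<rho> r) * sin (s * r))) (at r)" .
    moreover have "\<i> * of_real (k * (r / \<rho> r)) * cis (k * \<rho> r) * of_real (cutoff l (\<rho> r) * sin (s * r)) = (\<i> * of_real k) * (wave_profile l k e r * of_real (r * sin (s * r)))"
      by (simp add: wave_profile_def)
    ultimately show "(?F has_vector_derivative ?f r) (at r)" by simp
  qed
  have "(?f has_integral ?F (4*l) - ?F 0) {0..4*l}"
    by (rule ftc) (rule der)
  \<comment> \<open>The sine removes the boundary term at 0, the cutoff the one at
    \<open>4 * l\<close>.\<close>
  then have f0: "(?f has_integral 0) {0..4*l}" using end_zero by simp
  have kI: "((\<lambda>r. (\<i> * of_real k) * (wave_profile l k e r * of_real (r * sin (s * r)))) has_integral (\<i> * of_real k) * I) {0..4*l}"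
    by (intro has_integral_mult_right integrable_integral I_int)
  have h: "(?h has_integral - ((\<i> * of_real k) * I)) {0..4*l}"
    using has_integral_diff[OF f0 kI] by simp
  \<comment> \<open>The constant 8 is 4 + 4: the cosine term is at most \<open>s\<close> on an
    interval of length \<open>4 * l\<close>, and the term with \<open>cutoff'\<close> is at most
    \<open>4 * l * s\<close> times the variation of the cutoff. The estimate
    \<open>\<bar>sin (s * r)\<bar> \<le> s * r\<close> provides the factor \<open>s\<close> that
    later cancels the \<open>1 / s\<close> of the radial formula.\<close>
  have g: "((\<lambda>r. s * (4 * l) * - (cutoff' l (\<rho> r) * (r / \<rho> r)) + s) has_integral s * (4 * l) * cutoff l (\<rho> 0) + s * (4 * l)) {0..4*l}"
    using has_integral_add[OF has_integral_mult_right[OF eta'_int, of "s * (4 * l)"] has_integral_const_real[of s 0 "4 * l"]] l by (simp add: mult_ac)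
  have "norm (- ((\<i> * of_real k) * I)) \<le> s * (4 * l) * cutoff l (\<rho> 0) + s * (4 * l)"
    unfolding integral_unique[OF h, symmetric] integral_unique[OF g, symmetric]
  proof (rule Henstock_Kurzweil_Integration.integral_norm_bound_integral)
    show "?h integrable_on {0..4*l}" using h by blast
    show "(\<lambda>r. s * (4 * l) * - (cutoff' l (\<rho> r) * (r / \<rho> r)) + s) integrable_on {0..4*l}" using g by blast
    fix r assume r: "r \<in> {0..4*l}"
    have a: "cutoff' l (\<rho> r) * (r / \<rho> r) \<le> 0"
      using r pos(2)[of r] cutoff_bounds(3)[OF l, of "\<rho> r"] by (intro mult_nonpos_nonneg) auto
    have "\<bar>sin (s * r)\<bar> \<le> s * r" using abs_sin_le_one abs_sin_x_le_abs_x[of "s * r"] r s by simp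
    also have "\<dots> \<le> s * (4 * l)" using r s by (intro mult_left_mono) auto
    finally have b: "\<bar>cutoff' l (\<rho> r) * (r / \<rho> r) * sin (s * r)\<bar> \<le> \<bar>cutoff' l (\<rho> r) * (r / \<rho> r)\<bar> * (s * (4 * l))"
      unfolding abs_mult[of _ "sin (s * r)"] by (intro mult_left_mono) auto
    have "\<bar>cutoff l (\<rho> r) * (s * cos (s * r))\<bar> \<le> 1 * (s * 1)"
      unfolding abs_mult using s cutoff_bounds(1,2)[OF l, of "\<rho> r"] by (intro mult_mono) auto
    then have "\<bar>cutoff l (\<rho> r) * (s * cos (s * r)) + cutoff' l (\<rho> r) * (r / \<rho> r) * sin (s * r)\<bar> \<le> s + \<bar>cutoff' l (\<rho> r) * (r / \<rho> r)\<bar> * (s * (4 * l))"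
      using b by (intro order_trans[OF abs_triangle_ineq]) linarith
    then show "norm (?h r) \<le> s * (4 * l) * - (cutoff' l (\<rho> r) * (r / \<rho> r)) + s"
      unfolding norm_mult norm_cis norm_of_real abs_of_nonpos[OF a] by (simp add: mult_ac)
  qed
  moreover have "s * (4 * l) * cutoff l (\<rho> 0) \<le> s * (4 * l) * 1"
    using s l cutoff_bounds(2)[OF l] by (intro mult_left_mono) auto
  moreover have "norm (- ((\<i> * of_real k) * I)) = k * cmod I" using k by (simp only: norm_minus_cancel norm_mult norm_ii norm_of_real abs_of_pos mult_1)
  moreover have "8 * l * s = s * (4 * l) * 1 + s * (4 * l)" by simp
  ultimately show ?thesis by linarith
qed

text \<open>Here the sine is integrated. The derivative \<open>e / \<rho> r ^ 3\<close> of \<open>r / \<rho> r\<close> has integral at most 1, uniformly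
  in \<open>e\<close>.\<close>

lemma wave_profile_sine_integral_bound2: "s * cmod I \<le> 2 + 4 * k * l"
proof -
  let ?V = "\<lambda>r. cis (k * \<rho> r) * of_real (r / \<rho> r * cutoff l (\<rho> r))"
  let ?v = "\<lambda>r. e / \<rho> r ^ 3 * cutoff l (\<rho> r) + r / \<rho> r * (cutoff' l (\<rho> r) * (r / \<rho> r))"
  let ?V' = "\<lambda>r. cis (k * \<rho> r) * of_real (?v r) + \<i> * of_real (k * (r / \<rho> r)) * cis (k * \<rho> r) * of_real (r / \<rho> r * cutoff l (\<rho> r))"
  let ?h = "\<lambda>r. ?V' r * of_real (cos (s * r))"
  have q: "((\<lambda>r. r / \<rho> r) has_real_derivative e / \<rho> r ^ 3) (at r)" for r
  proof -
    have "((\<lambda>r. r / \<rho> r) has_real_derivative (1 * \<rho> r - r * (r / \<rho> r)) / (\<rho> r * \<rho> r)) (at r)"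
      using pos(2)[of r] by (intro DERIV_divide DERIV_ident rho') auto
    moreover have "(1 * \<rho> r - r * (r / \<rho> r)) / (\<rho> r * \<rho> r) = e / \<rho> r ^ 3"
    proof -
      have "\<rho> r * \<rho> r = r\<^sup>2 + e" using pos(1)[of r] by simp
      then show ?thesis using pos(2)[of r] by (simp add: divide_simps power3_eq_cube) (simp add: power2_eq_square algebra_simps)
    qed
    ultimately show ?thesis by simp
  qed
  have V: "(?V has_vector_derivative ?V' r) (at r)" for r
  proof -
    have "((\<lambda>r. r / \<rho> r * cutoff l (\<rho> r)) has_real_derivative ?v r) (at r)"
      by (rule DERIV_cong[OF DERIV_mult[OF q eta']]) simp
    then have "((\<lambda>r. complex_of_real (r / \<rho> r * cutoff l (\<rho> r))) has_vector_derivative of_real (?v r)) (at r)"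
      by (intro has_vector_derivative_of_real) (simp only: has_real_derivative_iff_has_vector_derivative)
    from has_vector_derivative_mult[OF cis' this] show ?thesis .
  qed
  let ?F = "\<lambda>r. ?V r * of_real (cos (s * r))"
  let ?f = "\<lambda>r. ?V r * of_real (- (s * sin (s * r))) + ?h r"
  have der: "(?F has_vector_derivative ?f r) (at r)" for r
  proof -
    have "((\<lambda>r. cos (s * r)) has_real_derivative - (s * sin (s * r))) (at r)"
      by (auto intro!: derivative_eq_intros)
    then have "((\<lambda>r. complex_of_real (cos (s * r))) has_vector_derivative of_real (- (s * sin (s * r)))) (at r)"
      by (intro has_vector_derivative_of_real) (simp only: has_real_derivative_iff_has_vector_derivative)
    from has_vector_derivative_mult[OF V this]
    show "(?F has_vector_derivative ?f r) (at r)" .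
  qed
  have "(?f has_integral ?F (4*l) - ?F 0) {0..4*l}"
    by (rule ftc) (rule der)
  \<comment> \<open>The factor \<open>r / \<rho> r\<close> vanishes at 0 and the cutoff at
    \<open>4 * l\<close>. The boundary value 1 that the unregularised wave has at the origin
    reappears in the integral of \<open>e / \<rho> r ^ 3\<close>.\<close>
  then have f0: "(?f has_integral 0) {0..4*l}" using end_zero by simp
  have "((\<lambda>r. of_real (- s) * (wave_profile l k e r * of_real (r * sin (s * r)))) has_integral of_real (- s) * I) {0..4*l}"
    by (intro has_integral_mult_right integrable_integral I_int)
  also have "(\<lambda>r. of_real (- s) * (wave_profile l k e r * of_real (r * sin (s * r)))) = (\<lambda>r. ?V r * of_real (- (s * sin (s * r))))"
    by (simp add: wave_profile_def fun_eq_iff)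
  finally have sI: "((\<lambda>r. ?V r * of_real (- (s * sin (s * r)))) has_integral of_real (- s) * I) {0..4*l}" .
  have h: "(?h has_integral - (of_real (- s) * I)) {0..4*l}"
    using has_integral_diff[OF f0 sI] by simp
  have qi: "((\<lambda>r. e / \<rho> r ^ 3) has_integral 4 * l / \<rho> (4 * l) - 0 / \<rho> 0) {0..4*l}"
    by (rule ftc) (rule q[unfolded has_real_derivative_iff_has_vector_derivative])
  \<comment> \<open>To the first integral are added the variation of the cutoff, at most 1, and the
    derivative of the phase, at most \<open>k\<close> over a length \<open>4 * l\<close>; together
    they give \<open>2 + 4 * k * l\<close>.\<close>
  have g: "((\<lambda>r. e / \<rho> r ^ 3 + - (cutoff' l (\<rho> r) * (r / \<rho> r)) + k) has_integral (4 * l / \<rho> (4 * l) - 0 / \<rho> 0) + cutoff l (\<rho> 0) + k * (4 * l)) {0..4*l}"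
    using has_integral_add[OF has_integral_add[OF qi eta'_int] has_integral_const_real[of k 0 "4 * l"]] l by (simp add: mult_ac)
  have "norm (- (of_real (- s) * I)) \<le> (4 * l / \<rho> (4 * l) - 0 / \<rho> 0) + cutoff l (\<rho> 0) + k * (4 * l)"
    unfolding integral_unique[OF h, symmetric] integral_unique[OF g, symmetric]
  proof (rule Henstock_Kurzweil_Integration.integral_norm_bound_integral)
    show "?h integrable_on {0..4*l}" using h by blast
    show "(\<lambda>r. e / \<rho> r ^ 3 + - (cutoff' l (\<rho> r) * (r / \<rho> r)) + k) integrable_on {0..4*l}" using g by blast
    fix r assume r: "r \<in> {0..4*l}"
    have c: "0 \<le> cutoff l (\<rho> r)" "cutoff l (\<rho> r) \<le> 1" using cutoff_bounds[OF l] by auto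
    have rr: "0 \<le> r / \<rho> r" "r / \<rho> r \<le> 1" using r pos(2)[of r] rho_le[of r] by auto
    have a: "cutoff' l (\<rho> r) * (r / \<rho> r) \<le> 0"
      using rr cutoff_bounds(3)[OF l, of "\<rho> r"] by (intro mult_nonpos_nonneg) auto
    have e3: "e / \<rho> r ^ 3 \<ge> 0" using e pos(2)[of r] by (intro divide_nonneg_nonneg) auto
    have 1: "\<bar>e / \<rho> r ^ 3 * cutoff l (\<rho> r)\<bar> \<le> e / \<rho> r ^ 3"
      using c e3 by (simp only: abs_mult abs_of_nonneg) (rule mult_left_le)
    have 2: "\<bar>r / \<rho> r * (cutoff' l (\<rho> r) * (r / \<rho> r))\<bar> \<le> - (cutoff' l (\<rho> r) * (r / \<rho> r))"
      unfolding abs_mult[of "r / \<rho> r"] abs_of_nonpos[OF a] abs_of_nonneg[OF rr(1)] using rr a by (intro mult_left_le_one_le) auto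
    have 3: "norm (\<i> * of_real (k * (r / \<rho> r)) * cis (k * \<rho> r) * of_real (r / \<rho> r * cutoff l (\<rho> r))) \<le> k"
    proof -
      have "norm (\<i> * of_real (k * (r / \<rho> r)) * cis (k * \<rho> r) * of_real (r / \<rho> r * cutoff l (\<rho> r))) = k * ((r / \<rho> r) * ((r / \<rho> r) * cutoff l (\<rho> r)))"
        unfolding norm_mult norm_of_real norm_cis abs_mult abs_of_nonneg[OF rr(1)] using k c by simp
      also have "\<dots> \<le> k * 1"
        using k rr c mult_nonneg_nonneg[OF rr(1) c(1)] by (intro mult_left_mono mult_le_one) (simp_all only: less_imp_le)
      finally show ?thesis by simp
    qed
    have "norm (cis (k * \<rho> r) * of_real (?v r)) \<le> e / \<rho> r ^ 3 + - (cutoff' l (\<rho> r) * (r / \<rho> r))"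
      unfolding norm_mult norm_of_real norm_cis mult_1 using 1 2 by (intro order_trans[OF abs_triangle_ineq] add_mono)
    then have "norm (?V' r) \<le> e / \<rho> r ^ 3 + - (cutoff' l (\<rho> r) * (r / \<rho> r)) + k"
      using 3 by (intro order_trans[OF norm_triangle_ineq] add_mono)
    moreover have "norm (?h r) \<le> norm (?V' r)"
      unfolding norm_mult[of "?V' r"] norm_of_real by (intro mult_left_le) auto
    ultimately show "norm (?h r) \<le> e / \<rho> r ^ 3 + - (cutoff' l (\<rho> r) * (r / \<rho> r)) + k" by linarith
  qed
  moreover have "4 * l / \<rho> (4 * l) \<le> 1" using rho_le[of "4 * l"] l by simp
  moreover have "cutoff l (\<rho> 0) \<le> 1" using cutoff_bounds(2)[OF l] by blast
  ultimately show ?thesis using s by (simp add: norm_mult)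
qed

end

lemma continuous_wave_profile:
  assumes "l > 0" "e > 0"
  shows "continuous_on A (wave_profile l k e)"
proof -
  have "sqrt (r\<^sup>2 + e) \<noteq> 0" for r using assms(2) by (simp add: add_nonneg_eq_0_iff)
  then show ?thesis unfolding wave_profile_def[abs_def] cis_conv_exp
    by (intro continuous_intros continuous_on_compose2[OF continuous_cutoff(1)[OF assms(1), of UNIV]]) auto
qed

lemma wave_profile_eq_0:
  assumes "l > 0" "e \<ge> 0" "r \<ge> 4 * l"
  shows "wave_profile l k e r = 0"
proof -
  have "r \<le> sqrt (r\<^sup>2 + e)" using assms by (intro real_le_rsqrt) auto
  then show ?thesis using assms by (simp add: wave_profile_def cutoff_outer)
qed

text \<open>The radial formula has the prefactor \<open>4 * pi / norm \<xi>\<close>. In the first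
  bound it is cancelled by the factor \<open>s\<close> in the estimate of the sine integral, so
  nothing blows up as \<xi> tends to 0; in the second it leaves one power of
  \<open>norm \<xi>\<close>, which is what integrating the sine gains.\<close>

lemma fourier_wave_bounds:
  fixes \<xi> :: "real^3"
  assumes l: "l > 0" and k: "k > 0" and e: "e > 0" and \<xi>: "\<xi> \<noteq> 0"
  shows "k\<^sup>2 * cmod (fourier (\<lambda>x. wave_profile l k e (norm x)) \<xi>) \<le> 4 * pi * (8 * (k * l))"
    and "(norm \<xi>)\<^sup>2 * cmod (fourier (\<lambda>x. wave_profile l k e (norm x)) \<xi>) \<le> 4 * pi * (2 + 4 * (k * l))"
proof -
  let ?s = "norm \<xi>"
  let ?I = "cmod (integral {0..4*l} (\<lambda>r. wave_profile l k e r * of_real (r * sin (?s * r))))"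
  have s: "?s > 0" using \<xi> by simp
  have "cmod (fourier (\<lambda>x. wave_profile l k e (norm x)) \<xi>) = 4 * pi / ?s * ?I"
    unfolding fourier_def
    by (subst radial_fourier[where R="4 * l"]) (use l e \<xi> in \<open>auto simp: continuous_wave_profile wave_profile_eq_0 norm_mult norm_divide\<close>)
  moreover have "k\<^sup>2 * (4 * pi / ?s * ?I) \<le> 4 * pi * (8 * (k * l))"
  proof -
    have "4 * pi * (k / ?s) * (k * ?I) \<le> 4 * pi * (k / ?s) * (8 * l * ?s)"
      using k s by (intro mult_left_mono wave_profile_sine_integral_bound1 l e) auto
    moreover have "k\<^sup>2 * (4 * pi / ?s * ?I) = 4 * pi * (k / ?s) * (k * ?I)" by (simp add: power2_eq_square)
    moreover have "4 * pi * (k / ?s) * (8 * l * ?s) = 4 * pi * (8 * (k * l))" using s by simp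
    ultimately show ?thesis by (simp only:)
  qed
  moreover have "?s\<^sup>2 * (4 * pi / ?s * ?I) \<le> 4 * pi * (2 + 4 * (k * l))"
  proof -
    have "4 * pi * (?s * ?I) \<le> 4 * pi * (2 + 4 * k * l)"
      by (intro mult_left_mono wave_profile_sine_integral_bound2 l e k s) auto
    moreover have "?s\<^sup>2 * (4 * pi / ?s * ?I) = 4 * pi * (?s * ?I)" using s by (simp add: power2_eq_square)
    ultimately show ?thesis by (simp only: mult.assoc)
  qed
  ultimately show "k\<^sup>2 * cmod (fourier (\<lambda>x. wave_profile l k e (norm x)) \<xi>) \<le> 4 * pi * (8 * (k * l))"
    "?s\<^sup>2 * cmod (fourier (\<lambda>x. wave_profile l k e (norm x)) \<xi>) \<le> 4 * pi * (2 + 4 * (k * l))"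
    by (simp_all only:)
qed

section \<open>Hessians of radial functions\<close>

text \<open>The difference quotient extends to an entire function, which makes the Hessian of the difference of two
  outgoing waves only weakly singular.\<close>

lemma exists_wave_difference:
  fixes a b :: real
  obtains D D1 D2 :: "real \<Rightarrow> complex" where
    "\<And>\<rho>. \<rho> \<noteq> 0 \<Longrightarrow> D \<rho> = (cis (a * \<rho>) - cis (b * \<rho>)) / of_real \<rho>"
    "\<And>\<rho>. (D has_vector_derivative D1 \<rho>) (at \<rho>)"
    "\<And>\<rho>. (D1 has_vector_derivative D2 \<rho>) (at \<rho>)"
    "continuous_on UNIV D2"
proof -
  define g :: "complex \<Rightarrow> complex" where "g = (\<lambda>z. exp (\<i> * of_real a * z) - exp (\<i> * of_real b * z))"
  \<comment> \<open>\<open>g\<close> vanishes at 0, so the singularity of the quotient is removable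
    with the value \<open>deriv g 0\<close>. The derivatives along the real axis are then
    restrictions of complex ones.\<close>
  define F where "F = (\<lambda>z. if z = 0 then deriv g 0 else g z / z)"
  have g: "g holomorphic_on UNIV" unfolding g_def by (intro holomorphic_intros)
  have F: "F holomorphic_on UNIV"
    by (rule pole_theorem_open_0[OF g open_UNIV, of 0]) (auto simp: F_def g_def)
  then have F1: "deriv F holomorphic_on UNIV" by (rule holomorphic_deriv) simp
  then have F2: "deriv (deriv F) holomorphic_on UNIV" by (rule holomorphic_deriv) simp
  show thesis
  proof (rule that[of "\<lambda>\<rho>. F (of_real \<rho>)" "\<lambda>\<rho>. deriv F (of_real \<rho>)" "\<lambda>\<rho>. deriv (deriv F) (of_real \<rho>)"])
    show "F (of_real \<rho>) = (cis (a * \<rho>) - cis (b * \<rho>)) / of_real \<rho>" if "\<rho> \<noteq> 0" for \<rho>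
      using that by (simp add: F_def g_def cis_conv_exp mult.assoc)
    show "((\<lambda>\<rho>. F (of_real \<rho>)) has_vector_derivative deriv F (of_real \<rho>)) (at \<rho>)" for \<rho>
      by (rule has_vector_derivative_real_field) (rule holomorphic_derivI[OF F], auto)
    show "((\<lambda>\<rho>. deriv F (of_real \<rho>)) has_vector_derivative deriv (deriv F) (of_real \<rho>)) (at \<rho>)" for \<rho>
      by (rule has_vector_derivative_real_field) (rule holomorphic_derivI[OF F1], auto)
    show "continuous_on UNIV (\<lambda>\<rho>::real. deriv (deriv F) (of_real \<rho>))"
      by (rule continuous_on_compose2[OF holomorphic_on_imp_continuous_on[OF F2]]) (auto intro!: continuous_intros)
  qed
qed

definition shifted_norm :: "real \<Rightarrow> real^3 \<Rightarrow> real" where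
  "shifted_norm e y = sqrt ((norm y)\<^sup>2 + e)"

definition radial_partial :: "(real \<Rightarrow> complex) \<Rightarrow> real \<Rightarrow> 3 \<Rightarrow> real^3 \<Rightarrow> complex" where
  "radial_partial E1 e j y = E1 (shifted_norm e y) * of_real (y $ j / shifted_norm e y)"

text \<open>The chain rule for the second derivatives of \<open>E (shifted_norm e y)\<close>, with
  \<open>E1\<close> and \<open>E2\<close> in the roles of the first and second derivatives of
  \<open>E\<close>. At \<open>e = 0\<close> it is the Hessian in the true radius away from the
  origin; for positive \<open>e\<close> it is regular at the origin as well, and \<open>e\<close>
  can tend to 0 with \<open>E1\<close> and \<open>E2\<close> fixed.\<close>

definition radial_hessian :: "(real \<Rightarrow> complex) \<Rightarrow> (real \<Rightarrow> complex) \<Rightarrow> real \<Rightarrow> real^3 \<Rightarrow> 3 \<Rightarrow> 3 \<Rightarrow> complex" where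
  "radial_hessian E1 E2 e y i j = E2 (shifted_norm e y) * of_real (y $ i * y $ j / (shifted_norm e y)\<^sup>2) +
     E1 (shifted_norm e y) * of_real ((if i = j then 1 else 0) / shifted_norm e y - y $ i * y $ j / shifted_norm e y ^ 3)"

lemma shifted_norm_has_derivative:
  assumes "shifted_norm e y > 0"
  shows "((\<lambda>t. shifted_norm e (y + t *\<^sub>R axis j 1)) has_real_derivative y $ j / shifted_norm e y) (at 0)"
proof -
  have n: "(norm (y + t *\<^sub>R axis j 1))\<^sup>2 = (norm y)\<^sup>2 + 2 * t * y $ j + t\<^sup>2" for t
    unfolding power2_norm_eq_inner
    by (simp add: inner_add_left inner_add_right inner_axis inner_axis' power2_eq_square[of t] algebra_simps)
  have p: "(norm y)\<^sup>2 + e > 0" using assms by (simp add: shifted_norm_def)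
  have "((\<lambda>t. sqrt ((norm y)\<^sup>2 + 2 * t * y $ j + t\<^sup>2 + e)) has_real_derivative y $ j / sqrt ((norm y)\<^sup>2 + e)) (at 0)"
    using p by (auto intro!: derivative_eq_intros simp: field_simps)
  then show ?thesis by (simp add: shifted_norm_def n)
qed

lemma radial_has_partial:
  assumes y: "shifted_norm e y > 0" and E: "\<And>\<rho>. (E has_vector_derivative E1 \<rho>) (at \<rho>)"
  shows "((\<lambda>t. E (shifted_norm e (y + t *\<^sub>R axis j 1))) has_vector_derivative radial_partial E1 e j y) (at 0)"
proof -
  have "((E \<circ> (\<lambda>t. shifted_norm e (y + t *\<^sub>R axis j 1))) has_vector_derivative (y $ j / shifted_norm e y) *\<^sub>R E1 (shifted_norm e (y + 0 *\<^sub>R axis j 1))) (at 0)"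
    using shifted_norm_has_derivative[OF y] E
    by (intro vector_diff_chain_at) (simp_all only: has_real_derivative_iff_has_vector_derivative)
  then show ?thesis by (simp add: o_def radial_partial_def scaleR_conv_of_real mult.commute)
qed

lemma radial_partial_has_partial:
  assumes y: "shifted_norm e y > 0" and E1: "\<And>\<rho>. (E1 has_vector_derivative E2 \<rho>) (at \<rho>)"
  shows "((\<lambda>t. radial_partial E1 e j (y + t *\<^sub>R axis i 1)) has_vector_derivative radial_hessian E1 E2 e y i j) (at 0)"
proof -
  let ?\<rho> = "shifted_norm e y" and ?\<delta> = "if i = j then 1 else 0 :: real"
  let ?n = "\<lambda>t. shifted_norm e (y + t *\<^sub>R axis i 1)"
  have d: "((\<lambda>t. (y + t *\<^sub>R axis i 1) $ j) has_real_derivative ?\<delta>) (at 0)"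
    by (auto intro!: derivative_eq_intros simp: axis_def)
  have "((\<lambda>t. (y + t *\<^sub>R axis i 1) $ j / ?n t) has_real_derivative ?\<delta> / ?\<rho> - y $ i * y $ j / ?\<rho> ^ 3) (at 0)"
    using y by (intro DERIV_cong[OF DERIV_divide[OF d shifted_norm_has_derivative[OF y]]]) 
      (simp_all add: field_simps power3_eq_cube)
  then have q: "((\<lambda>t. complex_of_real ((y + t *\<^sub>R axis i 1) $ j / ?n t)) has_vector_derivative of_real (?\<delta> / ?\<rho> - y $ i * y $ j / ?\<rho> ^ 3)) (at 0)"
    by (intro has_vector_derivative_of_real) (simp only: has_real_derivative_iff_has_vector_derivative)
  from has_vector_derivative_mult[OF radial_has_partial[OF y E1, of i] q]
  show ?thesis
    unfolding radial_partial_def radial_hessian_def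
    by (simp add: power2_eq_square algebra_simps)
qed

text \<open>\<open>partial3\<close> is total, so its value is meaningful only where a derivative
  exists. The first partial derivatives are therefore identified at every nonzero point; the second
  one is then taken along a line that avoids the origin for small parameters.\<close>

lemma hessian3_wave_difference:
  assumes y: "y \<noteq> 0"
    and D: "\<And>\<rho>. \<rho> \<noteq> 0 \<Longrightarrow> D \<rho> = (cis (a * \<rho>) - cis (b * \<rho>)) / of_real \<rho>"
    and D1: "\<And>\<rho>. (D has_vector_derivative D1 \<rho>) (at \<rho>)" and D2: "\<And>\<rho>. (D1 has_vector_derivative D2 \<rho>) (at \<rho>)"
  shows "hessian3 (\<lambda>z. outgoing_wave a z - outgoing_wave b z) y $ i $ j = radial_hessian D1 D2 0 y i j"
proof -
  let ?w = "\<lambda>z. outgoing_wave a z - outgoing_wave b z"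
  have w: "?w z = D (shifted_norm 0 z)" if "z \<noteq> 0" for z
    using that by (simp add: D outgoing_wave_def shifted_norm_def cis_conv_exp diff_divide_distrib)
  have op: "open {t. z + t *\<^sub>R axis k (1::real) \<noteq> 0}" for z :: "real^3" and k
    by (intro open_Collect_neq continuous_intros)
  have p: "partial3 j ?w z = radial_partial D1 0 j z" if "z \<noteq> 0" for z
  proof -
    have "((\<lambda>t. ?w (z + t *\<^sub>R axis j 1)) has_vector_derivative radial_partial D1 0 j z) (at 0)"
    proof (rule has_vector_derivative_transform_within_open[OF radial_has_partial[OF _ D1] op[of z j]])
      show "shifted_norm 0 z > 0" using that by (simp add: shifted_norm_def)
    qed (use that w in auto)
    then show ?thesis unfolding partial3_def by (rule vector_derivative_at)
  qed
  have "((\<lambda>t. partial3 j ?w (y + t *\<^sub>R axis i 1)) has_vector_derivative radial_hessian D1 D2 0 y i j) (at 0)"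
  proof (rule has_vector_derivative_transform_within_open[OF radial_partial_has_partial[OF _ D2] op[of y i]])
    show "shifted_norm 0 y > 0" using y by (simp add: shifted_norm_def)
  qed (use y p in auto)
  then have "partial3 i (partial3 j ?w) y = radial_hessian D1 D2 0 y i j"
    unfolding partial3_def[of i "partial3 j ?w" y] by (rule vector_derivative_at)
  then show ?thesis by (simp add: hessian3_def)
qed

text \<open>Two applications of \<open>fourier_directional_derivative\<close>; the minus sign is the
  square of \<open>- \<i>\<close>. For positive \<open>e\<close> the function is C^2 across the
  origin, so the singularity of the true radius leaves no extra term.\<close>

lemma fourier_radial_hessian:
  assumes e: "e > 0"
    and E: "\<And>\<rho>. (E has_vector_derivative E1 \<rho>) (at \<rho>)" and E1: "\<And>\<rho>. (E1 has_vector_derivative E2 \<rho>) (at \<rho>)"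
    and E2: "continuous_on UNIV E2"
    and supp: "\<And>\<rho>. \<rho> \<ge> R \<Longrightarrow> E \<rho> = 0" "\<And>\<rho>. \<rho> \<ge> R \<Longrightarrow> E1 \<rho> = 0" "\<And>\<rho>. \<rho> \<ge> R \<Longrightarrow> E2 \<rho> = 0"
  shows "fourier (\<lambda>y. radial_hessian E1 E2 e y i j) \<xi> = - of_real (\<xi> $ i * \<xi> $ j) * fourier (\<lambda>y. E (shifted_norm e y)) \<xi>"
    and "continuous_on UNIV (\<lambda>y. radial_hessian E1 E2 e y i j)"
    and "\<And>y. norm y > R \<Longrightarrow> radial_hessian E1 E2 e y i j = 0"
proof -
  have pos: "shifted_norm e y > 0" for y using e by (simp add: shifted_norm_def add_nonneg_pos)
  then have nz: "shifted_norm e y \<noteq> 0" for y by (simp add: less_imp_neq[symmetric])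
  have big: "shifted_norm e y \<ge> R" if "norm y > R" for y
    using that e unfolding shifted_norm_def by (intro order_trans[OF less_imp_le real_le_rsqrt]) auto
  have cn: "continuous_on UNIV (shifted_norm e)" unfolding shifted_norm_def[abs_def] by (intro continuous_intros)
  have c0: "continuous_on UNIV E" and c1: "continuous_on UNIV E1"
    by (intro continuous_at_imp_continuous_on ballI has_vector_derivative_continuous[OF E] has_vector_derivative_continuous[OF E1])+
  note cc = continuous_on_compose2[OF c0 cn] continuous_on_compose2[OF c1 cn] continuous_on_compose2[OF E2 cn]
  show ch: "continuous_on UNIV (\<lambda>y. radial_hessian E1 E2 e y i j)" for i j
    unfolding radial_hessian_def by (intro continuous_intros cc cn) (use nz in auto)
  have cp: "continuous_on UNIV (radial_partial E1 e j)" for j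
    unfolding radial_partial_def[abs_def] by (intro continuous_intros cc cn) (use nz in auto)
  show sh: "radial_hessian E1 E2 e y i j = 0" if "norm y > R" for y i j
    using supp big[OF that] by (simp add: radial_hessian_def)
  have sp: "radial_partial E1 e j y = 0" if "norm y > R" for y j
    using supp big[OF that] by (simp add: radial_partial_def)
  have s0: "E (shifted_norm e y) = 0" if "norm y > R" for y using supp big[OF that] by simp
  have "fourier (\<lambda>y. radial_hessian E1 E2 e y i j) \<xi> = - \<i> * of_real (\<xi> \<bullet> axis i 1) * fourier (radial_partial E1 e j) \<xi>"
    by (rule fourier_directional_derivative[OF radial_partial_has_partial[OF pos E1] cp ch sp sh])
  also have "fourier (radial_partial E1 e j) \<xi> = - \<i> * of_real (\<xi> \<bullet> axis j 1) * fourier (\<lambda>y. E (shifted_norm e y)) \<xi>"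
    by (rule fourier_directional_derivative[OF radial_has_partial[OF pos E] cc(1) cp s0 sp]) auto
  finally have "fourier (\<lambda>y. radial_hessian E1 E2 e y i j) \<xi> =
      - \<i> * of_real (\<xi> $ i) * (- \<i> * of_real (\<xi> $ j) * fourier (\<lambda>y. E (shifted_norm e y)) \<xi>)"
    by (simp only: inner_axis inner_real_def mult_1_right)
  moreover have "- \<i> * a * (- \<i> * b * c) = - (a * b) * c" for a b c :: complex
  proof -
    have "- \<i> * a * (- \<i> * b * c) = (\<i> * \<i>) * ((a * b) * c)" by (simp only: mult_minus_left mult_minus_right minus_minus mult_ac)
    then show ?thesis by simp
  qed
  ultimately show "fourier (\<lambda>y. radial_hessian E1 E2 e y i j) \<xi> = - of_real (\<xi> $ i * \<xi> $ j) * fourier (\<lambda>y. E (shifted_norm e y)) \<xi>"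
    by (simp only: of_real_mult)
qed

section \<open>The truncated Green function\<close>

text \<open>The function is the integral of \<open>exp (- (1 + t) * (norm y)\<^sup>2)\<close> over
  \<open>t \<ge> 0\<close>. By Tonelli its mass is the integral of the Gaussian masses
  \<open>sqrt (pi / (1 + t)) ^ 3\<close>, which decay like the power -3/2 of \<open>t\<close>. In
  effect, a kernel of order \<open>1 / norm y\<close> is locally square integrable in dimension
  three.\<close>

lemma integrable_gaussian_over_norm_squared:
  "integrable lborel (\<lambda>y::real^3. exp (- (norm y)\<^sup>2) / (norm y)\<^sup>2)"
proof -
  let ?f = "\<lambda>(y::real^3) t. ennreal (exp (- (1 + t) * (norm y)\<^sup>2)) * indicator {0..} t"
  have inner: "(\<integral>\<^sup>+t. ?f y t \<partial>lborel) = ennreal (exp (- (norm y)\<^sup>2) / (norm y)\<^sup>2)" if "y \<noteq> 0" for y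
  proof -
    let ?q = "(norm y)\<^sup>2" and ?F = "\<lambda>t. - exp (- (1 + t) * (norm y)\<^sup>2) / (norm y)\<^sup>2"
    have q: "?q > 0" using that by simp
    have der: "((\<lambda>t. - exp (- (1 + t) * q) / q) has_real_derivative exp (- (1 + t) * q)) (at t)" if "q > 0" for q t :: real
      using that by (auto intro!: derivative_eq_intros)
    have "(\<integral>\<^sup>+t. ?f y t \<partial>lborel) = ennreal (0 - ?F 0)"
    proof (rule nn_integral_FTC_atLeast)
      show "(?F has_real_derivative exp (- (1 + t) * ?q)) (at t)" for t
        by (rule der[OF q])
      show "(?F \<longlongrightarrow> 0) at_top" using q by real_asymp
    qed auto
    then show ?thesis by simp
  qed
  have outer: "(\<integral>\<^sup>+y. ?f y t \<partial>lborel) = ennreal (sqrt (pi / (1 + t)) ^ 3) * indicator {0..} t" for t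
  proof (cases "t \<ge> 0")
    case True
    then have g: "has_bochner_integral lborel (\<lambda>y::real^3. exp (- (1 + t) * (norm y)\<^sup>2)) (sqrt (pi / (1 + t)) ^ 3)"
      using integral_gaussian[of "1 + t", where 'a="real^3"] by simp
    have "(\<integral>\<^sup>+y. ennreal (exp (- (1 + t) * (norm (y::real^3))\<^sup>2)) \<partial>lborel) = ennreal (sqrt (pi / (1 + t)) ^ 3)"
      using g by (subst nn_integral_eq_integral) (auto simp: has_bochner_integral_iff)
    then show ?thesis using True by simp
  qed simp
  have "(\<integral>\<^sup>+y. ennreal (exp (- (norm y)\<^sup>2) / (norm (y::real^3))\<^sup>2) \<partial>lborel) = (\<integral>\<^sup>+y. (\<integral>\<^sup>+t. ?f y t \<partial>lborel) \<partial>lborel)"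
  proof (rule nn_integral_cong_AE)
    have "AE y in lborel. y \<noteq> (0::real^3)" by (rule AE_lborel_singleton)
    then show "AE y in lborel. ennreal (exp (- (norm y)\<^sup>2) / (norm y)\<^sup>2) = (\<integral>\<^sup>+t. ?f y t \<partial>lborel)"
      by eventually_elim (rule inner[symmetric])
  qed
  also have "\<dots> = (\<integral>\<^sup>+t. (\<integral>\<^sup>+y. ?f y t \<partial>lborel) \<partial>lborel)"
    by (rule lborel_pair.Fubini') measurable
  also have "\<dots> = (\<integral>\<^sup>+t. ennreal (sqrt (pi / (1 + t)) ^ 3) * indicator {0..} t \<partial>lborel)"
    by (simp only: outer)
  also have "\<dots> = ennreal (0 - (- (2 * sqrt pi ^ 3 / sqrt (1 + 0))))"
  proof (rule nn_integral_FTC_atLeast)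
    show "((\<lambda>t. - (2 * sqrt pi ^ 3 / sqrt (1 + t))) has_real_derivative sqrt (pi / (1 + t)) ^ 3) (at t)" if "0 \<le> t" for t
    proof -
      have "sqrt (1 + t) * sqrt (1 + t) = 1 + t" using that by simp
      then show ?thesis using that
        by (auto intro!: derivative_eq_intros simp: real_sqrt_divide power3_eq_cube field_simps)
    qed
    show "((\<lambda>t. - (2 * sqrt pi ^ 3 / sqrt (1 + t))) \<longlongrightarrow> 0) at_top" by real_asymp
  qed auto
  finally have "(\<integral>\<^sup>+y. ennreal (exp (- (norm y)\<^sup>2) / (norm (y::real^3))\<^sup>2) \<partial>lborel) < \<infinity>" by simp
  then show ?thesis by (intro integrableI_bounded) auto
qed

text \<open>Truncation precedes differentiation: what is differentiated is a profile of bounded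
  support, so the transform of its Hessian keeps the factor \<open>\<xi> $ i * \<xi> $ j\<close>.
  Below \<open>3 * l\<close> the derivatives of the cutoff vanish, and the Hessian is that of the
  waves themselves. \<open>E1\<close> and \<open>E2\<close> come from the Leibniz rule.\<close>

lemma exists_cutoff_wave_difference:
  fixes a b l :: real
  assumes l: "l > 0"
  obtains E E1 E2 :: "real \<Rightarrow> complex" where
    "\<And>\<rho>. \<rho> \<noteq> 0 \<Longrightarrow> E \<rho> = of_real (cutoff l \<rho> / \<rho>) * (cis (a * \<rho>) - cis (b * \<rho>))"
    "\<And>\<rho>. (E has_vector_derivative E1 \<rho>) (at \<rho>)"
    "\<And>\<rho>. (E1 has_vector_derivative E2 \<rho>) (at \<rho>)"
    "continuous_on UNIV E2"
    "\<And>\<rho>. \<rho> \<ge> 4 * l \<Longrightarrow> E \<rho> = 0" "\<And>\<rho>. \<rho> \<ge> 4 * l \<Longrightarrow> E1 \<rho> = 0" "\<And>\<rho>. \<rho> \<ge> 4 * l \<Longrightarrow> E2 \<rho> = 0"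
    "\<And>y i j. y \<noteq> 0 \<Longrightarrow> norm y < 3 * l \<Longrightarrow>
       hessian3 (\<lambda>z. outgoing_wave a z - outgoing_wave b z) y $ i $ j = radial_hessian E1 E2 0 y i j"
proof -
  obtain D D1 D2 :: "real \<Rightarrow> complex" where D: 
    "\<And>\<rho>. \<rho> \<noteq> 0 \<Longrightarrow> D \<rho> = (cis (a * \<rho>) - cis (b * \<rho>)) / of_real \<rho>"
    "\<And>\<rho>. (D has_vector_derivative D1 \<rho>) (at \<rho>)"
    "\<And>\<rho>. (D1 has_vector_derivative D2 \<rho>) (at \<rho>)"
    "continuous_on UNIV D2"
    using exists_wave_difference[of a b] by blast
  let ?c = "\<lambda>\<rho>. complex_of_real (cutoff l \<rho>)" and ?c1 = "\<lambda>\<rho>. complex_of_real (cutoff' l \<rho>)" and ?c2 = "\<lambda>\<rho>. complex_of_real (cutoff'' l \<rho>)"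
  have c: "(?c has_vector_derivative ?c1 \<rho>) (at \<rho>)" "(?c1 has_vector_derivative ?c2 \<rho>) (at \<rho>)" for \<rho>
    using cutoff_has_derivative[OF l] cutoff'_has_derivative[OF l]
    by (auto intro!: has_vector_derivative_of_real simp: has_real_derivative_iff_has_vector_derivative)
  have c0: "continuous_on UNIV D" and c1: "continuous_on UNIV D1"
    by (intro continuous_at_imp_continuous_on ballI has_vector_derivative_continuous[OF D(2)] has_vector_derivative_continuous[OF D(3)])+
  show thesis
  proof (rule that[of "\<lambda>\<rho>. ?c \<rho> * D \<rho>" "\<lambda>\<rho>. ?c \<rho> * D1 \<rho> + ?c1 \<rho> * D \<rho>" "\<lambda>\<rho>. ?c \<rho> * D2 \<rho> + ?c1 \<rho> * D1 \<rho> + (?c1 \<rho> * D1 \<rho> + ?c2 \<rho> * D \<rho>)"])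
    show "?c \<rho> * D \<rho> = of_real (cutoff l \<rho> / \<rho>) * (cis (a * \<rho>) - cis (b * \<rho>))" if "\<rho> \<noteq> 0" for \<rho>
      by (simp add: D(1)[OF that])
    show "((\<lambda>\<rho>. ?c \<rho> * D \<rho>) has_vector_derivative ?c \<rho> * D1 \<rho> + ?c1 \<rho> * D \<rho>) (at \<rho>)" for \<rho>
      by (rule has_vector_derivative_mult[OF c(1) D(2)])
    show "((\<lambda>\<rho>. ?c \<rho> * D1 \<rho> + ?c1 \<rho> * D \<rho>) has_vector_derivative ?c \<rho> * D2 \<rho> + ?c1 \<rho> * D1 \<rho> + (?c1 \<rho> * D1 \<rho> + ?c2 \<rho> * D \<rho>)) (at \<rho>)" for \<rho>
      by (intro has_vector_derivative_add has_vector_derivative_mult c D)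
    show "continuous_on UNIV (\<lambda>\<rho>. ?c \<rho> * D2 \<rho> + ?c1 \<rho> * D1 \<rho> + (?c1 \<rho> * D1 \<rho> + ?c2 \<rho> * D \<rho>))"
      by (intro continuous_intros continuous_cutoff[OF l] c0 c1 D(4))
    fix y :: "real^3" and i j assume y: "y \<noteq> 0" "norm y < 3 * l"
    have h: "hessian3 (\<lambda>z. outgoing_wave a z - outgoing_wave b z) y $ i $ j = radial_hessian D1 D2 0 y i j"
      by (rule hessian3_wave_difference[OF y(1) D(1-3)])
    have "shifted_norm 0 y \<le> 3 * l" using y by (simp add: shifted_norm_def)
    from cutoff_inner[OF l this]
    show "hessian3 (\<lambda>z. outgoing_wave a z - outgoing_wave b z) y $ i $ j = radial_hessian (\<lambda>\<rho>. ?c \<rho> * D1 \<rho> + ?c1 \<rho> * D \<rho>) (\<lambda>\<rho>. ?c \<rho> * D2 \<rho> + ?c1 \<rho> * D1 \<rho> + (?c1 \<rho> * D1 \<rho> + ?c2 \<rho> * D \<rho>)) 0 y i j"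
      unfolding h radial_hessian_def by simp
  qed (simp_all add: cutoff_outer[OF l])
qed

text \<open>The kernel \<open>omega\<^sup>2\<close> times the Green function, truncated at radius \<open>4 * l\<close> and regularised with parameter \<open>e\<close>;
  \<open>E1\<close> and \<open>E2\<close> stand for the derivatives of the truncated radial profile of the difference of the two waves.\<close>

definition truncated_green :: "real \<Rightarrow> real \<Rightarrow> (real \<Rightarrow> complex) \<Rightarrow> (real \<Rightarrow> complex) \<Rightarrow> real \<Rightarrow> real^3 \<Rightarrow> complex^3^3" where
  "truncated_green l k E1 E2 e y = (\<chi> i j. of_real (1 / (4 * pi)) *
     ((if i = j then of_real (k\<^sup>2) * wave_profile l k e (norm y) else 0) + radial_hessian E1 E2 e y i j))"

lemma truncated_green_L2_bound:
  fixes l kS kP e :: real and f :: "real^3 \<Rightarrow> complex^3"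
  assumes l: "l > 0" and kP: "kP > 0" "kP \<le> kS" and e: "e > 0"
    and E0: "\<And>\<rho>. \<rho> \<noteq> 0 \<Longrightarrow> E \<rho> = of_real (cutoff l \<rho> / \<rho>) * (cis (kS * \<rho>) - cis (kP * \<rho>))"
    and E1: "\<And>\<rho>. (E has_vector_derivative E1 \<rho>) (at \<rho>)"
    and E2: "\<And>\<rho>. (E1 has_vector_derivative E2 \<rho>) (at \<rho>)"
    and cE2: "continuous_on UNIV E2"
    and supp: "\<And>\<rho>. \<rho> \<ge> 4 * l \<Longrightarrow> E \<rho> = 0" "\<And>\<rho>. \<rho> \<ge> 4 * l \<Longrightarrow> E1 \<rho> = 0" "\<And>\<rho>. \<rho> \<ge> 4 * l \<Longrightarrow> E2 \<rho> = 0"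
    and f: "integrable lborel f" "integrable lborel (\<lambda>x. (norm (f x))\<^sup>2)"
  defines "g \<equiv> \<lambda>x. LINT y|lborel. truncated_green l kS E1 E2 e (x - y) *v f y"
  shows "integrable lborel (\<lambda>x. (norm (g x))\<^sup>2)"
    and "(LINT x|lborel. (norm (g x))\<^sup>2) \<le> (4 + 16 * (kS * l))\<^sup>2 * (LINT x|lborel. (norm (f x))\<^sup>2)"
    and "continuous_on UNIV g"
proof -
  let ?c = "complex_of_real (1 / (4 * pi))"
  let ?K = "truncated_green l kS E1 E2 e"
  let ?bS = "\<lambda>y::real^3. wave_profile l kS e (norm y)" and ?bP = "\<lambda>y::real^3. wave_profile l kP e (norm y)"
  let ?H = "\<lambda>i j y. radial_hessian E1 E2 e y i j"
  have kS: "kS > 0" using kP by simp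
  have H: "fourier (?H i j) \<xi> = - of_real (\<xi> $ i * \<xi> $ j) * fourier (\<lambda>y. E (shifted_norm e y)) \<xi>"
    "continuous_on UNIV (?H i j)" "norm y > 4 * l \<Longrightarrow> ?H i j y = 0" for i j \<xi> y
    using fourier_radial_hessian[OF e E1 E2 cE2, of "4 * l"] supp by blast+
  have bcont: "continuous_on UNIV (\<lambda>y::real^3. wave_profile l k e (norm y))" for k
    by (rule continuous_on_compose2[OF continuous_wave_profile[OF l e, of UNIV]]) (auto intro!: continuous_intros)
  have b0: "wave_profile l k e (norm y) = 0" if "norm y > 4 * l" for k and y :: "real^3"
    using that e by (intro wave_profile_eq_0 l) auto
  have bint: "integrable lborel (\<lambda>y::real^3. wave_profile l k e (norm y))" for k
    by (rule integrable_continuous_bounded_support[OF bcont b0])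
  have Hint: "integrable lborel (?H i j)" for i j
    by (rule integrable_continuous_bounded_support[OF H(2) H(3)])
  have Kcont: "continuous_on UNIV ?K"
  proof -
    have "continuous_on UNIV (\<lambda>y::real^3. if i = j then complex_of_real (kS\<^sup>2) * ?bS y else 0)" for i j :: 3
      by (cases "i = j") (simp_all add: continuous_on_mult_left bcont)
    then show ?thesis unfolding truncated_green_def[abs_def] by (intro continuous_intros H(2))
  qed
  have K0: "?K y = 0" if "norm y > 4 * l" for y
    using H(3)[OF that] b0[OF that] by (simp add: truncated_green_def vec_eq_iff)
  \<comment> \<open>\<open>E\<close> and both wave profiles evaluate the cutoff at the same
    regularised radius, so the transform of the profile in the Hessian is a difference of transforms
    that have already been estimated.\<close>
  have phi: "E (shifted_norm e y) = ?bS y - ?bP y" for y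
  proof -
    have "shifted_norm e y \<noteq> 0" using e by (simp add: shifted_norm_def add_nonneg_eq_0_iff)
    then show ?thesis by (simp add: E0 wave_profile_def shifted_norm_def algebra_simps)
  qed
  have phi_ft: "fourier (\<lambda>y. E (shifted_norm e y)) \<xi> = fourier ?bS \<xi> - fourier ?bP \<xi>" for \<xi>
    unfolding phi fourier_def right_diff_distrib
    by (rule Bochner_Integration.integral_diff) (intro integrable_cis_mult bint, measurable)+
  have Kft: "fourier (\<lambda>y. ?K y $ i $ j) \<xi> = ?c * ((if i = j then of_real (kS\<^sup>2) * fourier ?bS \<xi> else 0) 
      - of_real (\<xi> $ i * \<xi> $ j) * (fourier ?bS \<xi> - fourier ?bP \<xi>))" for i j \<xi>
  proof -
    let ?a = "if i = j then complex_of_real (kS\<^sup>2) else 0"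
    have "fourier (\<lambda>y. ?K y $ i $ j) \<xi> = (LINT y|lborel. ?c * (?a * (cis (\<xi> \<bullet> y) * ?bS y) + cis (\<xi> \<bullet> y) * ?H i j y))"
      unfolding fourier_def by (rule Bochner_Integration.integral_cong) (auto simp: truncated_green_def algebra_simps)
    also have "\<dots> = ?c * (?a * fourier ?bS \<xi> + fourier (?H i j) \<xi>)"
    proof -
      have "integrable lborel (\<lambda>y. ?a * (cis (\<xi> \<bullet> y) * ?bS y))" "integrable lborel (\<lambda>y. cis (\<xi> \<bullet> y) * ?H i j y)"
        by (intro integrable_mult_right integrable_cis_mult bint Hint, measurable)+
      then show ?thesis unfolding fourier_def
        by (simp only: integral_mult_right_zero Bochner_Integration.integral_add)
    qed
    finally show ?thesis unfolding H(1) phi_ft by (auto simp: algebra_simps)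
  qed
  have M: "norm ((\<chi> i j. fourier (\<lambda>x. ?K x $ i $ j) \<xi>) *v v) \<le> (4 + 16 * (kS * l)) * norm v" if \<xi>: "\<xi> \<noteq> 0" for \<xi> v
  proof -
    let ?\<alpha> = "?c * (of_real (kS\<^sup>2) * fourier ?bS \<xi>)" and ?\<beta> = "?c * (fourier ?bS \<xi> - fourier ?bP \<xi>)"
    let ?d = "\<Sum>j\<in>UNIV. of_real (\<xi> $ j) * v $ j" and ?x = "(\<chi> i. of_real (\<xi> $ i)) :: complex^3"
    \<comment> \<open>A multiple of the identity and a rank-one matrix: the operator norm is at most
      \<open>cmod ?\<alpha> + (norm \<xi>)\<^sup>2 * cmod ?\<beta>\<close>, by Cauchy-Schwarz for
      \<open>?d\<close>.\<close>
    have split: "(\<chi> i j. fourier (\<lambda>x. ?K x $ i $ j) \<xi>) *v v = ?\<alpha> *s v - (?\<beta> * ?d) *s ?x"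
    proof -
      have "(\<Sum>j\<in>UNIV. fourier (\<lambda>y. ?K y $ i $ j) \<xi> * v $ j) = ?\<alpha> * v $ i - ?\<beta> * ?d * of_real (\<xi> $ i)" for i
      proof -
        have "fourier (\<lambda>y. ?K y $ i $ j) \<xi> * v $ j = (if i = j then ?\<alpha> * v $ j else 0) - ?\<beta> * (of_real (\<xi> $ j) * v $ j) * of_real (\<xi> $ i)" for j
          unfolding Kft by (auto simp: algebra_simps)
        then show ?thesis by (simp add: sum_subtractf sum_distrib_left sum_distrib_right)
      qed
      then show ?thesis by (simp add: vec_eq_iff matrix_vector_mult_def)
    qed
    have smult: "norm (z *s w) = cmod z * norm w" for z and w :: "complex^3"
      by (simp add: norm_vec_def L2_set_def norm_mult power_mult_distrib sum_distrib_left[symmetric] real_sqrt_mult)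
    have xn: "norm ?x = norm \<xi>" by (simp add: norm_vec_def L2_set_def)
    have dn: "cmod ?d \<le> norm \<xi> * norm v"
    proof -
      have "cmod ?d \<le> (\<Sum>j\<in>UNIV. \<bar>\<xi> $ j\<bar> * \<bar>cmod (v $ j)\<bar>)"
        by (intro sum_norm_le) (simp add: norm_mult)
      also have "\<dots> \<le> L2_set (\<lambda>j. \<xi> $ j) UNIV * L2_set (\<lambda>j. cmod (v $ j)) UNIV" by (rule L2_set_mult_ineq)
      finally show ?thesis by (simp add: norm_vec_def L2_set_def)
    qed
    have "norm ((\<chi> i j. fourier (\<lambda>x. ?K x $ i $ j) \<xi>) *v v) \<le> cmod ?\<alpha> * norm v + cmod ?\<beta> * cmod ?d * norm \<xi>"
      using norm_triangle_ineq4[of "?\<alpha> *s v" "(?\<beta> * ?d) *s ?x"] by (simp only: split smult xn norm_mult[of ?\<beta> ?d])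
    also have "cmod ?\<beta> * cmod ?d * norm \<xi> \<le> cmod ?\<beta> * (norm \<xi> * norm v) * norm \<xi>"
      using dn by (intro mult_right_mono mult_left_mono) auto
    also have "cmod ?\<alpha> * norm v + cmod ?\<beta> * (norm \<xi> * norm v) * norm \<xi> = (cmod ?\<alpha> + (norm \<xi>)\<^sup>2 * cmod ?\<beta>) * norm v"
      by (simp add: power2_eq_square algebra_simps)
    also have "\<dots> \<le> (4 + 16 * (kS * l)) * norm v"
    proof (rule mult_right_mono)
      have "cmod ?\<alpha> = (kS\<^sup>2 * cmod (fourier ?bS \<xi>)) / (4 * pi)" by (simp add: norm_mult norm_divide norm_power)
      also have "\<dots> \<le> 8 * (kS * l)"
        using fourier_wave_bounds(1)[OF l kS e \<xi>] by (simp add: divide_le_eq mult_ac)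
      finally have 1: "cmod ?\<alpha> \<le> 8 * (kS * l)" .
      have "(norm \<xi>)\<^sup>2 * cmod ?\<beta> = (norm \<xi>)\<^sup>2 * cmod (fourier ?bS \<xi> - fourier ?bP \<xi>) / (4 * pi)"
        by (simp add: norm_mult norm_divide)
      \<comment> \<open>No cancellation between the two waves is used: each contributes 2 to the
        constant 4, and \<open>kP \<le> kS\<close> merges the linear terms into
        \<open>8 * (kS * l)\<close>.\<close>
      also have "\<dots> \<le> (norm \<xi>)\<^sup>2 * (cmod (fourier ?bS \<xi>) + cmod (fourier ?bP \<xi>)) / (4 * pi)"
        by (intro divide_right_mono mult_left_mono norm_triangle_ineq4) auto
      also have "\<dots> \<le> (4 * pi * (2 + 4 * (kS * l)) + 4 * pi * (2 + 4 * (kP * l))) / (4 * pi)"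
        unfolding distrib_left[of "(norm \<xi>)\<^sup>2"]
        by (intro divide_right_mono add_mono fourier_wave_bounds(2)[OF l kS e \<xi>] fourier_wave_bounds(2)[OF l kP(1) e \<xi>]) auto
      also have "\<dots> = 4 + 4 * (kS * l) + 4 * (kP * l)"
        by (simp only: distrib_left[symmetric]) simp
      also have "\<dots> \<le> 4 + 8 * (kS * l)"
        using mult_right_mono[OF kP(2), of l] l by simp
      finally have "(norm \<xi>)\<^sup>2 * cmod ?\<beta> \<le> 4 + 8 * (kS * l)" .
      with 1 show "cmod ?\<alpha> + (norm \<xi>)\<^sup>2 * cmod ?\<beta> \<le> 4 + 16 * (kS * l)" by simp
    qed simp
    finally show ?thesis by simp
  qed
  show "integrable lborel (\<lambda>x. (norm (g x))\<^sup>2)" unfolding g_def by (rule fourier_multiplier_bound(1)[OF Kcont K0 f M])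
  show "(LINT x|lborel. (norm (g x))\<^sup>2) \<le> (4 + 16 * (kS * l))\<^sup>2 * (LINT x|lborel. (norm (f x))\<^sup>2)"
    unfolding g_def by (rule fourier_multiplier_bound(2)[OF Kcont K0 f M])
  show "continuous_on UNIV g" unfolding g_def by (rule fourier_multiplier_bound(3)[OF Kcont K0 f M])
qed

section \<open>Measurability, domination and convergence of the kernels\<close>

lemma norm_matrix_vector_mult_le:
  fixes A :: "complex^3^3"
  assumes "\<And>i j. cmod (A $ i $ j) \<le> C"
  shows "norm (A *v v) \<le> 9 * (C * norm v)"
proof -
  have vj: "cmod (v $ j) \<le> norm v" for j
    unfolding norm_vec_def by (rule member_le_L2_set) auto
  have "norm (A *v v) \<le> (\<Sum>i\<in>UNIV. cmod ((A *v v) $ i))"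
    unfolding norm_vec_def by (rule L2_set_le_sum) simp
  also have "\<dots> \<le> (\<Sum>i\<in>(UNIV::3 set). \<Sum>j\<in>(UNIV::3 set). C * norm v)"
  proof (rule sum_mono)
    fix i :: 3
    show "cmod ((A *v v) $ i) \<le> (\<Sum>j\<in>(UNIV::3 set). C * norm v)"
      unfolding matrix_vector_mult_def vec_lambda_beta
      by (rule sum_norm_le) (simp add: norm_mult mult_mono assms vj order_trans[OF norm_ge_zero assms])
  qed
  finally show ?thesis by simp
qed

lemma borel_measurable_vec_lambda:
  fixes u :: "'i::finite \<Rightarrow> 'a \<Rightarrow> complex"
  assumes [measurable]: "\<And>i. u i \<in> borel_measurable M"
  shows "(\<lambda>x. \<chi> i. u i x) \<in> borel_measurable M"
proof -
  have "continuous_on UNIV (\<lambda>z::complex. axis i z :: complex^'i)" for i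
  proof -
    have "continuous_on UNIV (\<lambda>z::complex. if j = i then z else 0)" for j
      by (cases "j = i") (simp_all add: continuous_on_id)
    then show ?thesis unfolding axis_def by (rule continuous_on_vec_lambda)
  qed
  then have "(\<lambda>x. axis i (u i x) :: complex^'i) \<in> borel_measurable M" for i
    using measurable_compose[OF assms[of i] borel_measurable_continuous_onI] by blast
  then have "(\<lambda>x. \<Sum>i\<in>UNIV. axis i (u i x) :: complex^'i) \<in> borel_measurable M"
    by (intro borel_measurable_sum)
  also have "(\<lambda>x. \<Sum>i\<in>UNIV. axis i (u i x)) = (\<lambda>x. \<chi> i. u i x)"
    by (auto simp: fun_eq_iff vec_eq_iff axis_def if_distrib[where f="\<lambda>f. f _"] cong: if_cong)
  finally show ?thesis .
qed

lemma borel_measurable_matrix_vector_mult: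
  fixes K :: "'a \<Rightarrow> complex^3^3" and f :: "'a \<Rightarrow> complex^3"
  assumes [measurable]: "\<And>i j. (\<lambda>x. K x $ i $ j) \<in> borel_measurable M" and f: "f \<in> borel_measurable M"
  shows "(\<lambda>x. K x *v f x) \<in> borel_measurable M"
proof -
  have [measurable]: "(\<lambda>x. f x $ j) \<in> borel_measurable M" for j
    using measurable_compose[OF f borel_measurable_continuous_onI[of "\<lambda>v. v $ j"]] by (simp add: continuous_on_component continuous_on_id)
  show ?thesis
    unfolding matrix_vector_mult_def by (rule borel_measurable_vec_lambda) measurable
qed

lemma borel_measurable_vec_nth [measurable]: "(\<lambda>y::real^3. y $ i) \<in> borel_measurable borel"
  by (intro borel_measurable_continuous_onI continuous_intros)

lemma borel_measurable_shifted_norm [measurable]: "shifted_norm e \<in> borel_measurable borel"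
  unfolding shifted_norm_def[abs_def] by measurable

lemma borel_measurable_radial_hessian:
  assumes "continuous_on UNIV E1" "continuous_on UNIV E2"
  shows "(\<lambda>y. radial_hessian E1 E2 e y i j) \<in> borel_measurable borel"
proof -
  have [measurable]: "E1 \<in> borel_measurable borel" "E2 \<in> borel_measurable borel"
    using assms by (auto intro: borel_measurable_continuous_onI)
  show ?thesis unfolding radial_hessian_def by measurable
qed

lemma borel_measurable_truncated_green:
  assumes "l > 0" "continuous_on UNIV E1" "continuous_on UNIV E2"
  shows "(\<lambda>y. truncated_green l k E1 E2 e y $ i $ j) \<in> borel_measurable borel"
proof -
  note [measurable] = borel_measurable_radial_hessian[OF assms(2,3)]
  have [measurable]: "cutoff l \<in> borel_measurable borel"
    by (rule borel_measurable_continuous_onI[OF continuous_cutoff(1)[OF assms(1)]])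
  have [measurable]: "wave_profile l k e \<in> borel_measurable borel"
    unfolding wave_profile_def[abs_def] by measurable
  show ?thesis unfolding truncated_green_def vec_lambda_beta by measurable
qed

text \<open>At the origin \<open>hessian3\<close> has only a default value; splitting off this point
  leaves the closed formula, which is measurable.\<close>

lemma borel_measurable_elastic_green:
  "(\<lambda>y. elastic_green rho mu lam omega y $ i $ j) \<in> borel_measurable borel"
proof -
  have wave[measurable]: "outgoing_wave k \<in> borel_measurable borel" for k
    unfolding outgoing_wave_def[abs_def] cis_conv_exp[symmetric] by measurable
  have [measurable]: "(\<lambda>y. hessian3 (\<lambda>z. outgoing_wave a z - outgoing_wave b z) y $ i $ j) \<in> borel_measurable borel" for a b
  proof -
    obtain D D1 D2 :: "real \<Rightarrow> complex" where D: 
      "\<And>\<rho>. \<rho> \<noteq> 0 \<Longrightarrow> D \<rho> = (cis (a * \<rho>) - cis (b * \<rho>)) / of_real \<rho>"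
      "\<And>\<rho>. (D has_vector_derivative D1 \<rho>) (at \<rho>)"
      "\<And>\<rho>. (D1 has_vector_derivative D2 \<rho>) (at \<rho>)"
      "continuous_on UNIV D2"
      using exists_wave_difference[of a b] by blast
    have "continuous_on UNIV D1"
      by (intro continuous_at_imp_continuous_on ballI has_vector_derivative_continuous[OF D(3)])
    note [measurable] = borel_measurable_radial_hessian[OF this D(4)]
    let ?h = "\<lambda>y. hessian3 (\<lambda>z. outgoing_wave a z - outgoing_wave b z) y $ i $ j"
    have "?h = (\<lambda>y. if y = 0 then ?h 0 else radial_hessian D1 D2 0 y i j)"
      using hessian3_wave_difference[OF _ D(1-3)] by auto
    moreover have "(\<lambda>y. if y = 0 then ?h 0 else radial_hessian D1 D2 0 y i j) \<in> borel_measurable borel"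
      by measurable
    ultimately show ?thesis by (simp only:)
  qed
  show ?thesis unfolding elastic_green_def Let_def vec_lambda_beta by measurable
qed

text \<open>Every term is of order \<open>1 / shifted_norm e y\<close>, hence at most of order
  \<open>1 / norm y\<close> uniformly in \<open>e\<close>. The Gaussian factor is there because the
  square of the right-hand side is then a multiple of the function in
  \<open>integrable_gaussian_over_norm_squared\<close>.\<close>

lemma truncated_green_bound:
  assumes l: "l > 0" and E1: "continuous_on UNIV E1" "\<And>\<rho>. \<rho> \<ge> 4 * l \<Longrightarrow> E1 \<rho> = 0"
    and E2: "continuous_on UNIV E2" "\<And>\<rho>. \<rho> \<ge> 4 * l \<Longrightarrow> E2 \<rho> = 0"
  obtains C where "C \<ge> 0" 
    "\<And>e y i j. e \<ge> 0 \<Longrightarrow> y \<noteq> 0 \<Longrightarrow> cmod (truncated_green l k E1 E2 e y $ i $ j) \<le> C * (exp (- (norm y)\<^sup>2 / 2) / norm y)"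
proof -
  have bd: "\<exists>c\<ge>0. \<forall>\<rho>\<ge>0. cmod (u \<rho>) \<le> c" if "continuous_on UNIV u" "\<And>\<rho>. \<rho> \<ge> 4 * l \<Longrightarrow> u \<rho> = 0" for u :: "real \<Rightarrow> complex"
  proof -
    have "compact (u ` {0..4*l})" by (intro compact_continuous_image continuous_on_subset[OF that(1)]) auto
    then obtain c where c: "\<And>\<rho>. \<rho> \<in> {0..4*l} \<Longrightarrow> cmod (u \<rho>) \<le> c" by (force simp: bounded_iff dest!: compact_imp_bounded)
    have "cmod (u \<rho>) \<le> max c 0" if "\<rho> \<ge> 0" for \<rho>
      using c[of \<rho>] \<open>\<And>\<rho>. \<rho> \<ge> 4 * l \<Longrightarrow> u \<rho> = 0\<close>[of \<rho>] that by (cases "\<rho> \<le> 4 * l") auto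
    then show ?thesis by (intro exI[of _ "max c 0"]) auto
  qed
  obtain c1 where c1: "c1 \<ge> 0" "\<And>\<rho>. \<rho> \<ge> 0 \<Longrightarrow> cmod (E1 \<rho>) \<le> c1" using bd[of E1] E1 by blast
  \<comment> \<open>\<open>E2\<close> is bounded together with the factor \<open>\<rho>\<close>, so
    that its term also takes the form of a constant over the radius.\<close>
  obtain c2 where c2: "c2 \<ge> 0" "\<And>\<rho>. \<rho> \<ge> 0 \<Longrightarrow> cmod (E2 \<rho> * of_real \<rho>) \<le> c2"
  proof -
    have "continuous_on UNIV (\<lambda>\<rho>. E2 \<rho> * of_real \<rho>)" by (intro continuous_intros E2)
    then show thesis using bd[of "\<lambda>\<rho>. E2 \<rho> * of_real \<rho>"] E2(2) that by auto
  qed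
  define B where "B = k\<^sup>2 + c2 + 2 * c1"
  have B: "B \<ge> 0" using c1 c2 by (simp add: B_def)
  show thesis
  proof (rule that[of "B * exp (8 * l\<^sup>2)"])
    fix e :: real and y :: "real^3" and i j assume e: "e \<ge> 0" and y: "y \<noteq> 0"
    let ?\<rho> = "shifted_norm e y"
    have ny: "norm y > 0" using y by simp
    have \<rho>: "norm y \<le> ?\<rho>" using e unfolding shifted_norm_def by (intro real_le_rsqrt) auto
    then have \<rho>0: "?\<rho> > 0" using ny by linarith
    show "cmod (truncated_green l k E1 E2 e y $ i $ j) \<le> B * exp (8 * l\<^sup>2) * (exp (- (norm y)\<^sup>2 / 2) / norm y)"
    proof (cases "norm y \<ge> 4 * l")
      case True
      then have "truncated_green l k E1 E2 e y $ i $ j = 0"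
        using E1(2)[of ?\<rho>] E2(2)[of ?\<rho>] \<rho> wave_profile_eq_0[OF l e True] by (simp add: truncated_green_def radial_hessian_def)
      then show ?thesis using B by simp
    next
      case False
      have comp: "\<bar>y $ i\<bar> / ?\<rho> \<le> 1" for i
        using order_trans[OF component_le_norm_cart \<rho>, of i] \<rho>0 by simp
      have yy: "\<bar>y $ i * y $ j / ?\<rho>\<^sup>2\<bar> \<le> 1"
      proof -
        have "\<bar>y $ i * y $ j / ?\<rho>\<^sup>2\<bar> = (\<bar>y $ i\<bar> / ?\<rho>) * (\<bar>y $ j\<bar> / ?\<rho>)" by (simp add: abs_mult power2_eq_square)
        also have "\<dots> \<le> 1" using comp \<rho>0 by (intro mult_le_one) auto
        finally show ?thesis .
      qed
      have t1: "cmod (E2 ?\<rho> * of_real (y $ i * y $ j / ?\<rho>\<^sup>2)) \<le> c2 / ?\<rho>"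
      proof -
        have "cmod (E2 ?\<rho>) \<le> c2 / ?\<rho>" using c2(2)[of ?\<rho>] \<rho>0 by (simp add: norm_mult pos_le_divide_eq)
        moreover have "cmod (E2 ?\<rho> * of_real (y $ i * y $ j / ?\<rho>\<^sup>2)) \<le> cmod (E2 ?\<rho>)"
          unfolding norm_mult norm_of_real using yy by (intro mult_left_le) auto
        ultimately show ?thesis by linarith
      qed
      have t2: "cmod (E1 ?\<rho> * of_real ((if i = j then 1 else 0) / ?\<rho> - y $ i * y $ j / ?\<rho> ^ 3)) \<le> c1 * (2 / ?\<rho>)"
      proof -
        have "(if i = j then 1 else 0) / ?\<rho> - y $ i * y $ j / ?\<rho> ^ 3 = ((if i = j then 1 else 0) - y $ i * y $ j / ?\<rho>\<^sup>2) / ?\<rho>"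
          by (simp add: diff_divide_distrib power2_eq_square power3_eq_cube)
        moreover have "\<bar>(if i = j then 1 else 0) - y $ i * y $ j / ?\<rho>\<^sup>2\<bar> \<le> 2"
          using yy by (auto simp only: abs_le_iff split: if_splits) 
        ultimately have "\<bar>(if i = j then 1 else 0) / ?\<rho> - y $ i * y $ j / ?\<rho> ^ 3\<bar> \<le> 2 / ?\<rho>"
          using \<rho>0 by (simp add: divide_right_mono)
        then show ?thesis unfolding norm_mult norm_of_real using c1 \<rho>0 by (intro mult_mono) auto
      qed
      have t3: "cmod (if i = j then of_real (k\<^sup>2) * wave_profile l k e (norm y) else 0) \<le> k\<^sup>2 * (1 / ?\<rho>)"
      proof -
        have "cmod (wave_profile l k e (norm y)) = cutoff l ?\<rho> / ?\<rho>"
          using \<rho>0 cutoff_bounds(1)[OF l, of ?\<rho>] by (simp add: wave_profile_def norm_mult norm_divide shifted_norm_def)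
        also have "\<dots> \<le> 1 / ?\<rho>" using \<rho>0 cutoff_bounds(2)[OF l] by (intro divide_right_mono) auto
        finally have "cmod (of_real (k\<^sup>2) * wave_profile l k e (norm y)) \<le> k\<^sup>2 * (1 / ?\<rho>)"
          unfolding norm_mult norm_of_real abs_power2 by (intro mult_left_mono) auto
        then show ?thesis using \<rho>0 by auto
      qed
      have "cmod (truncated_green l k E1 E2 e y $ i $ j) \<le> 1 * (k\<^sup>2 * (1 / ?\<rho>) + (c2 / ?\<rho> + c1 * (2 / ?\<rho>)))"
        unfolding truncated_green_def vec_lambda_beta norm_mult[of "of_real (1 / (4 * pi))"]
      proof (rule mult_mono)
        show "cmod (of_real (1 / (4 * pi))) \<le> 1" using pi_gt3 by (simp add: norm_divide)
        show "cmod ((if i = j then of_real (k\<^sup>2) * wave_profile l k e (norm y) else 0) + radial_hessian E1 E2 e y i j)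
             \<le> k\<^sup>2 * (1 / ?\<rho>) + (c2 / ?\<rho> + c1 * (2 / ?\<rho>))"
          unfolding radial_hessian_def by (intro order_trans[OF norm_triangle_ineq] add_mono t1 t2 t3)
      qed auto
      also have "\<dots> = B / ?\<rho>" by (simp add: B_def add_divide_distrib)
      also have "\<dots> \<le> B * (1 / norm y)" using B \<rho> ny by (simp add: frac_le)
      \<comment> \<open>Below radius \<open>4 * l\<close> the Gaussian factor is at least
        \<open>exp (- 8 * l\<^sup>2)\<close>, since
        \<open>(4 * l)\<^sup>2 / 2 = 8 * l\<^sup>2\<close>.\<close>
      also have "1 / norm y \<le> exp (8 * l\<^sup>2) * (exp (- (norm y)\<^sup>2 / 2) / norm y)"
      proof -
        have "(norm y)\<^sup>2 \<le> (4 * l)\<^sup>2" using False l by (intro power_mono) auto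
        then have "1 \<le> exp (8 * l\<^sup>2 + - (norm y)\<^sup>2 / 2)" by (simp add: power_mult_distrib)
        from divide_right_mono[OF this, of "norm y"] show ?thesis using ny
          by (simp only: exp_add times_divide_eq_right less_imp_le)
      qed
      finally show ?thesis using B by (simp add: mult_left_mono mult.assoc)
    qed
  qed (use B in simp)
qed

lemma truncated_green_tendsto:
  assumes l: "l > 0" and E1: "continuous_on UNIV E1" and E2: "continuous_on UNIV E2" and y: "y \<noteq> 0"
  shows "(\<lambda>n. truncated_green l k E1 E2 (inverse (real (Suc n))) y) \<longlonglongrightarrow> truncated_green l k E1 E2 0 y"
proof -
  let ?e = "\<lambda>n. inverse (real (Suc n))"
  have r: "(\<lambda>n. sqrt ((norm y)\<^sup>2 + ?e n)) \<longlonglongrightarrow> sqrt ((norm y)\<^sup>2 + 0)"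
    by (intro tendsto_intros LIMSEQ_inverse_real_of_nat)
  have nz: "sqrt ((norm y)\<^sup>2 + 0) \<noteq> 0" "shifted_norm 0 y \<noteq> 0" using y by (auto simp: shifted_norm_def)
  have \<rho>: "(\<lambda>n. shifted_norm (?e n) y) \<longlonglongrightarrow> shifted_norm 0 y" using r by (simp add: shifted_norm_def)
  have c: "isCont E1 x" "isCont E2 x" "isCont (cutoff l) x" for x
    using E1 E2 continuous_cutoff(1)[OF l, of UNIV] by (auto simp: continuous_on_eq_continuous_at)
  have h: "(\<lambda>n. radial_hessian E1 E2 (?e n) y i j) \<longlonglongrightarrow> radial_hessian E1 E2 0 y i j" for i j
    unfolding radial_hessian_def
    by (intro tendsto_intros isCont_tendsto_compose[OF c(1)] isCont_tendsto_compose[OF c(2)] \<rho>) (use nz in auto)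
  have w: "(\<lambda>n. wave_profile l k (?e n) (norm y)) \<longlonglongrightarrow> wave_profile l k 0 (norm y)"
    unfolding wave_profile_def cis_conv_exp
    by (intro tendsto_intros isCont_tendsto_compose[OF c(3)] r) (use nz in auto)
  have "(\<lambda>n. if i = j then of_real (k\<^sup>2) * wave_profile l k (?e n) (norm y) else 0) \<longlonglongrightarrow> 
       (if i = j then of_real (k\<^sup>2) * wave_profile l k 0 (norm y) else 0)" for i j :: 3
    by (cases "i = j") (simp_all only: simp_thms if_True if_False tendsto_const tendsto_mult_left[OF w])
  then show ?thesis unfolding truncated_green_def by (intro tendsto_vec_lambda tendsto_mult_left tendsto_add h)
qed

section \<open>Removal of the regularisation\<close>

lemma outgoing_limit_L2_bound:
  fixes l kS kP :: real and f :: "real^3 \<Rightarrow> complex^3"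
  assumes l: "l > 0" and kP: "kP > 0" "kP \<le> kS"
    and E0: "\<And>\<rho>. \<rho> \<noteq> 0 \<Longrightarrow> E \<rho> = of_real (cutoff l \<rho> / \<rho>) * (cis (kS * \<rho>) - cis (kP * \<rho>))"
    and E1: "\<And>\<rho>. (E has_vector_derivative E1 \<rho>) (at \<rho>)"
    and E2: "\<And>\<rho>. (E1 has_vector_derivative E2 \<rho>) (at \<rho>)"
    and cE2: "continuous_on UNIV E2"
    and supp: "\<And>\<rho>. \<rho> \<ge> 4 * l \<Longrightarrow> E \<rho> = 0" "\<And>\<rho>. \<rho> \<ge> 4 * l \<Longrightarrow> E1 \<rho> = 0" "\<And>\<rho>. \<rho> \<ge> 4 * l \<Longrightarrow> E2 \<rho> = 0"
    and f: "integrable lborel f" "integrable lborel (\<lambda>x. (norm (f x))\<^sup>2)"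
  defines "v \<equiv> \<lambda>x. LINT y|lborel. truncated_green l kS E1 E2 0 (x - y) *v f y"
  shows "v \<in> borel_measurable borel"
    and "(\<integral>\<^sup>+x. ennreal ((norm (v x))\<^sup>2) \<partial>lborel) \<le> ennreal ((4 + 16 * (kS * l))\<^sup>2 * (LINT x|lborel. (norm (f x))\<^sup>2))"
proof -
  define e where "e n = inverse (real (Suc n))" for n
  have e: "e n > 0" for n by (simp add: e_def)
  define vn where "vn n x = (LINT y|lborel. truncated_green l kS E1 E2 (e n) (x - y) *v f y)" for n x
  let ?M = "(4 + 16 * (kS * l))\<^sup>2 * (LINT x|lborel. (norm (f x))\<^sup>2)"
  have vn: "integrable lborel (\<lambda>x. (norm (vn n x))\<^sup>2)" "(LINT x|lborel. (norm (vn n x))\<^sup>2) \<le> ?M" "continuous_on UNIV (vn n)" for n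
    unfolding vn_def using truncated_green_L2_bound[OF l kP e E0 E1 E2 cE2 supp f] by blast+
  have cE1: "continuous_on UNIV E1"
    by (intro continuous_at_imp_continuous_on ballI has_vector_derivative_continuous[OF E2])
  obtain C where C: "C \<ge> 0" "\<And>e y i j. e \<ge> 0 \<Longrightarrow> y \<noteq> 0 \<Longrightarrow> cmod (truncated_green l kS E1 E2 e y $ i $ j) \<le> C * (exp (- (norm y)\<^sup>2 / 2) / norm y)"
    using truncated_green_bound[OF l cE1 supp(2) cE2 supp(3), of kS] by blast
  have fm[measurable]: "f \<in> borel_measurable borel" using f(1) by (auto dest: borel_measurable_integrable)
  have meas: "(\<lambda>y. truncated_green l kS E1 E2 e (x - y) *v f y) \<in> borel_measurable lborel" for e x
  proof (rule borel_measurable_matrix_vector_mult)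
    fix i j
    have "(\<lambda>y. x - y) \<in> borel_measurable lborel" by measurable
    from measurable_compose[OF this borel_measurable_truncated_green[OF l cE1 cE2]]
    show "(\<lambda>y. truncated_green l kS E1 E2 e (x - y) $ i $ j) \<in> borel_measurable lborel" .
  qed measurable
  have lim: "(\<lambda>n. vn n x) \<longlonglongrightarrow> v x" for x
    unfolding vn_def v_def
  \<comment> \<open>The kernel has a square-integrable majorant and \<open>f\<close> is square
    integrable, so \<open>a * b \<le> a\<^sup>2 + b\<^sup>2\<close> gives a dominating function for
    every \<open>x\<close>; the convergence therefore holds at every point.\<close>
  proof (rule integral_dominated_convergence[where w="\<lambda>y. 9 * C * (exp (- (norm (x - y))\<^sup>2) / (norm (x - y))\<^sup>2 + (norm (f y))\<^sup>2)"])
    have "integrable lborel (\<lambda>y::real^3. exp (- (norm (x - y))\<^sup>2) / (norm (x - y))\<^sup>2)"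
      using has_bochner_integral_lborel_translate(2)[OF has_bochner_integral_integrable[OF integrable_gaussian_over_norm_squared], of x]
      by (simp add: has_bochner_integral_iff)
    then show "integrable lborel (\<lambda>y. 9 * C * (exp (- (norm (x - y))\<^sup>2) / (norm (x - y))\<^sup>2 + (norm (f y))\<^sup>2))"
      using f(2) by (intro integrable_mult_right Bochner_Integration.integrable_add)
    have ne: "AE y in lborel. y \<noteq> x" by (rule AE_lborel_singleton)
    then show "AE y in lborel. (\<lambda>n. truncated_green l kS E1 E2 (e n) (x - y) *v f y) \<longlonglongrightarrow> truncated_green l kS E1 E2 0 (x - y) *v f y"
    proof eventually_elim
      case (elim y)
      have T: "(\<lambda>n. truncated_green l kS E1 E2 (e n) (x - y)) \<longlonglongrightarrow> truncated_green l kS E1 E2 0 (x - y)"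
        unfolding e_def by (rule truncated_green_tendsto[OF l cE1 cE2]) (use elim in auto)
      show ?case unfolding matrix_vector_mult_def by (intro tendsto_intros T)
    qed
    show "AE y in lborel. norm (truncated_green l kS E1 E2 (e n) (x - y) *v f y) \<le> 9 * C * (exp (- (norm (x - y))\<^sup>2) / (norm (x - y))\<^sup>2 + (norm (f y))\<^sup>2)" for n
      using ne
    proof eventually_elim
      case (elim y)
      let ?a = "exp (- (norm (x - y))\<^sup>2 / 2) / norm (x - y)"
      have "norm (truncated_green l kS E1 E2 (e n) (x - y) *v f y) \<le> 9 * (C * ?a * norm (f y))"
        by (rule norm_matrix_vector_mult_le) (use C(2)[of "e n" "x - y"] e[of n] elim in auto)
      also have "\<dots> = 9 * C * (?a * norm (f y))" by simp
      also have "\<dots> \<le> 9 * C * (?a\<^sup>2 + (norm (f y))\<^sup>2)"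
      proof (rule mult_left_mono)
        have "2 * (?a * norm (f y)) \<le> ?a\<^sup>2 + (norm (f y))\<^sup>2" using sum_squares_bound[of ?a "norm (f y)"] by simp
        moreover have "0 \<le> ?a * norm (f y)" by simp
        ultimately show "?a * norm (f y) \<le> ?a\<^sup>2 + (norm (f y))\<^sup>2" by linarith
      qed (use C in simp)
      also have "?a\<^sup>2 = exp (- (norm (x - y))\<^sup>2) / (norm (x - y))\<^sup>2"
        by (simp add: power_divide exp_double[symmetric])
      finally show ?case .
    qed
  qed (rule meas)+
  have vnm[measurable]: "vn n \<in> borel_measurable borel" for n using vn(3) by (rule borel_measurable_continuous_onI)
  show "v \<in> borel_measurable borel"
    by (rule borel_measurable_LIMSEQ_metric[OF vnm lim])
  have "(\<integral>\<^sup>+x. ennreal ((norm (v x))\<^sup>2) \<partial>lborel) = (\<integral>\<^sup>+x. liminf (\<lambda>n. ennreal ((norm (vn n x))\<^sup>2)) \<partial>lborel)"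
  proof (rule nn_integral_cong)
    fix x
    have "(\<lambda>n. ennreal ((norm (vn n x))\<^sup>2)) \<longlonglongrightarrow> ennreal ((norm (v x))\<^sup>2)"
      by (intro tendsto_ennrealI tendsto_intros lim)
    then show "ennreal ((norm (v x))\<^sup>2) = liminf (\<lambda>n. ennreal ((norm (vn n x))\<^sup>2))"
      by (rule lim_imp_Liminf[symmetric, rotated]) simp
  qed
  \<comment> \<open>Fatou's lemma for nonnegative integrals: the finiteness of the norm of
    \<open>v\<close> comes out as a conclusion.\<close>
  also have "\<dots> \<le> liminf (\<lambda>n. \<integral>\<^sup>+x. ennreal ((norm (vn n x))\<^sup>2) \<partial>lborel)"
    by (rule nn_integral_liminf) measurable
  also have "\<dots> \<le> liminf (\<lambda>n::nat. ennreal ?M)"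
  proof (rule Liminf_mono, rule always_eventually, rule allI)
    fix n
    show "(\<integral>\<^sup>+x. ennreal ((norm (vn n x))\<^sup>2) \<partial>lborel) \<le> ennreal ?M"
      using vn(1,2)[of n] by (subst nn_integral_eq_integral) (auto intro: ennreal_leI)
  qed
  also have "\<dots> = ennreal ?M" by (simp add: Liminf_const)
  finally show "(\<integral>\<^sup>+x. ennreal ((norm (v x))\<^sup>2) \<partial>lborel) \<le> ennreal ?M" .
qed

section \<open>Return to the elastic Green function\<close>

lemma elastic_green_eq_truncated_green:
  fixes rho mu lam omega l :: real and y :: "real^3"
  defines "kS \<equiv> omega / sqrt (mu / rho)" and "kP \<equiv> omega * sqrt (rho / (2 * mu + lam))"
  assumes pos: "rho > 0" "mu > 0" "omega > 0" "l > 0" and y: "y \<noteq> 0" "norm y < 3 * l"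
    and H: "\<And>i j. hessian3 (\<lambda>z. outgoing_wave kS z - outgoing_wave kP z) y $ i $ j = radial_hessian E1 E2 0 y i j"
  shows "of_real (omega\<^sup>2) * elastic_green rho mu lam omega y $ i $ j = truncated_green l kS E1 E2 0 y $ i $ j"
proof -
  have th: "sqrt (mu / rho) > 0" using pos by simp
  have w: "wave_profile l kS 0 (norm y) = outgoing_wave kS y"
    using cutoff_inner(1)[OF pos(4), of "norm y"] y by (simp add: wave_profile_def outgoing_wave_def cis_conv_exp)
  \<comment> \<open>The quotient of \<open>omega\<^sup>2\<close> and the squared shear speed is
    \<open>kS\<^sup>2\<close>; in the Hessian term it cancels the prefactor
    \<open>1 / kS\<^sup>2\<close>.\<close>
  have c1: "omega\<^sup>2 * (1 / (4 * pi * sqrt (mu / rho) ^ 2)) = 1 / (4 * pi) * kS\<^sup>2"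
    by (simp add: kS_def power_divide)
  have c2: "kS\<^sup>2 * (1 / kS\<^sup>2) = 1" using pos th by (simp add: kS_def)
  let ?A = "if i = j then outgoing_wave kS y else 0" and ?H = "radial_hessian E1 E2 0 y i j"
  have "of_real (omega\<^sup>2) * elastic_green rho mu lam omega y $ i $ j = 
      of_real (omega\<^sup>2 * (1 / (4 * pi * sqrt (mu / rho) ^ 2))) * (?A + of_real (1 / kS\<^sup>2) * ?H)"
    unfolding elastic_green_def Let_def vec_lambda_beta kS_def[symmetric] kP_def[symmetric] H
    by (simp only: of_real_mult mult.assoc)
  also have "\<dots> = of_real (1 / (4 * pi)) * (of_real (kS\<^sup>2) * ?A + of_real (kS\<^sup>2 * (1 / kS\<^sup>2)) * ?H)"
    unfolding c1 by (simp only: of_real_mult distrib_left mult.assoc)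
  also have "\<dots> = truncated_green l kS E1 E2 0 y $ i $ j"
    unfolding c2 truncated_green_def w by simp
  finally show ?thesis .
qed

theorem theoremA2:
  fixes rho mu lam omega l :: real and f :: "real^3 \<Rightarrow> complex^3"
  assumes "rho > 0" and "mu > 0" and "lam \<ge> 0" and "omega > 0" and "l > 0"
    and "f \<in> borel_measurable lborel"
    and "integrable lborel (\<lambda>x. (norm (f x))^2)"
    and "AE x in lborel. x \<notin> ball 0 l \<longrightarrow> f x = 0"
  shows "let u = conv3 (elastic_green rho mu lam omega) f;
             kappaS = (omega / sqrt (mu / rho)) * l
         in set_integrable lborel (ball 0 l) (\<lambda>x. (norm (u x))^2) \<and>
            omega ^ 2 * rho_norm rho (ball 0 l) u \<le> (4 + 17 * kappaS) * rho_norm rho (ball 0 l) f"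
proof -
  define kS where "kS = omega / sqrt (mu / rho)"
  define kP where "kP = omega * sqrt (rho / (2 * mu + lam))"
  define u where "u = conv3 (elastic_green rho mu lam omega) f"
  let ?B = "ball (0::real^3) l"
  have kP0: "kP > 0" using assms by (simp add: kP_def)
  have kPS: "kP \<le> kS"
  proof -
    \<comment> \<open>Pressure waves are faster than shear waves, as
      \<open>2 * mu + lam \<ge> mu\<close>, so their wave number is smaller.\<close>
    have "rho / (2 * mu + lam) \<le> rho / mu" using assms by (intro divide_left_mono) auto
    then have "omega * sqrt (rho / (2 * mu + lam)) \<le> omega * sqrt (rho / mu)" using assms by simp
    also have "omega * sqrt (rho / mu) = omega / sqrt (mu / rho)" by (simp add: real_sqrt_divide)
    finally show ?thesis by (simp add: kP_def kS_def)
  qed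
  have fm[measurable]: "f \<in> borel_measurable borel" using assms(6) by simp
  \<comment> \<open>Square-integrable data carried by a ball are integrable, because
    \<open>t \<le> t\<^sup>2 + 1\<close> and the ball has finite measure.\<close>
  have fint: "integrable lborel f"
  proof (rule Bochner_Integration.integrable_bound)
    have "integrable lborel (indicator ?B :: real^3 \<Rightarrow> real)"
      using emeasure_lborel_ball_finite[of "0::real^3" l] by (intro integrable_real_indicator) auto
    then show "integrable lborel (\<lambda>x. (norm (f x))\<^sup>2 + indicator ?B x)" using assms(7) by (intro Bochner_Integration.integrable_add)
    show "AE x in lborel. norm (f x) \<le> norm ((norm (f x))\<^sup>2 + indicator ?B x :: real)"
      using assms(8)
    proof eventually_elim
      case (elim x)
      have "norm (f x) \<le> (norm (f x))\<^sup>2 + 1"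
        using zero_le_power2[of "norm (f x) - 1 / 2"] by (simp add: power2_eq_square algebra_simps)
      then show ?case using elim by (cases "x \<in> ?B") auto
    qed
  qed simp
  obtain E E1 E2 :: "real \<Rightarrow> complex" where E:
    "\<And>\<rho>. \<rho> \<noteq> 0 \<Longrightarrow> E \<rho> = of_real (cutoff l \<rho> / \<rho>) * (cis (kS * \<rho>) - cis (kP * \<rho>))"
    "\<And>\<rho>. (E has_vector_derivative E1 \<rho>) (at \<rho>)"
    "\<And>\<rho>. (E1 has_vector_derivative E2 \<rho>) (at \<rho>)"
    "continuous_on UNIV E2"
    "\<And>\<rho>. \<rho> \<ge> 4 * l \<Longrightarrow> E \<rho> = 0" "\<And>\<rho>. \<rho> \<ge> 4 * l \<Longrightarrow> E1 \<rho> = 0" "\<And>\<rho>. \<rho> \<ge> 4 * l \<Longrightarrow> E2 \<rho> = 0"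
    "\<And>y i j. y \<noteq> 0 \<Longrightarrow> norm y < 3 * l \<Longrightarrow>
       hessian3 (\<lambda>z. outgoing_wave kS z - outgoing_wave kP z) y $ i $ j = radial_hessian E1 E2 0 y i j"
    using exists_cutoff_wave_difference[OF assms(5), of kS kP] by blast
  have cE1: "continuous_on UNIV E1"
    by (intro continuous_at_imp_continuous_on ballI has_vector_derivative_continuous[OF E(3)])
  define v where "v = (\<lambda>x. LINT y|lborel. truncated_green l kS E1 E2 0 (x - y) *v f y)"
  let ?F = "LINT x|lborel. (norm (f x))\<^sup>2" and ?M = "4 + 16 * (kS * l)"
  have V: "v \<in> borel_measurable borel" "(\<integral>\<^sup>+x. ennreal ((norm (v x))\<^sup>2) \<partial>lborel) \<le> ennreal (?M\<^sup>2 * ?F)"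
    unfolding v_def using outgoing_limit_L2_bound[OF assms(5) kP0 kPS E(1-7) fint assms(7)] by blast+
  have vm[measurable]: "v \<in> borel_measurable borel" by (rule V(1))
  have F0: "?F \<ge> 0" by simp
  have v2: "integrable lborel (\<lambda>x. (norm (v x))\<^sup>2)"
    using V(2) by (intro integrableI_bounded) (auto intro: le_less_trans)
  have vle: "(LINT x|lborel. (norm (v x))\<^sup>2) \<le> ?M\<^sup>2 * ?F"
    using V(2) F0 unfolding nn_integral_eq_integral[OF v2 AE_I2[OF zero_le_power2]] by (subst (asm) ennreal_le_iff) auto
  have uv: "omega\<^sup>2 *\<^sub>R u x = v x" if x: "x \<in> ?B" for x
  proof -
    have "omega\<^sup>2 *\<^sub>R u x = (LINT y|lborel. omega\<^sup>2 *\<^sub>R (elastic_green rho mu lam omega (x - y) *v f y))"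
      by (simp add: u_def conv3_def)
    also have "\<dots> = v x" unfolding v_def
    proof (rule integral_cong_AE)
      have sub: "(\<lambda>y. x - y) \<in> borel_measurable lborel" by measurable
      have "(\<lambda>y. elastic_green rho mu lam omega (x - y) *v f y) \<in> borel_measurable lborel"
        by (rule borel_measurable_matrix_vector_mult[OF measurable_compose[OF sub borel_measurable_elastic_green]]) measurable
      then show "(\<lambda>y. omega\<^sup>2 *\<^sub>R (elastic_green rho mu lam omega (x - y) *v f y)) \<in> borel_measurable lborel"
        by (rule borel_measurable_scaleR[OF borel_measurable_const])
      show "(\<lambda>y. truncated_green l kS E1 E2 0 (x - y) *v f y) \<in> borel_measurable lborel"
        by (rule borel_measurable_matrix_vector_mult[OF measurable_compose[OF sub borel_measurable_truncated_green[OF assms(5) cE1 E(4)]]]) measurable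
      \<comment> \<open>At \<open>y = x\<close> both kernels have only default values; this point is
        a null set.\<close>
      have "AE y in lborel. y \<noteq> x" by (rule AE_lborel_singleton)
      then show "AE y in lborel. omega\<^sup>2 *\<^sub>R (elastic_green rho mu lam omega (x - y) *v f y) = truncated_green l kS E1 E2 0 (x - y) *v f y"
        using assms(8)
      proof eventually_elim
        case (elim y)
        show ?case
        proof (cases "y \<in> ?B")
          case True
          have "norm (x - y) < 3 * l"
            using x True norm_triangle_ineq4[of x y] assms(5) by (simp add: dist_norm)
          moreover have "x - y \<noteq> 0" using elim by simp
          ultimately have G: "of_real (omega\<^sup>2) * elastic_green rho mu lam omega (x - y) $ i $ j = truncated_green l kS E1 E2 0 (x - y) $ i $ j" for i j
            unfolding kS_def
            by (intro elastic_green_eq_truncated_green assms E(8)[unfolded kS_def kP_def])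
          have "omega\<^sup>2 *\<^sub>R (elastic_green rho mu lam omega (x - y) *v f y) $ i = (truncated_green l kS E1 E2 0 (x - y) *v f y) $ i" for i
            unfolding matrix_vector_mult_def vec_lambda_beta G[symmetric] scaleR_conv_of_real
            by (simp only: sum_distrib_left mult.assoc)
          then show ?thesis by (simp add: vec_eq_iff)
        next
          case False
          then have "f y = 0" using elim by blast
          then show ?thesis by simp
        qed
      qed
    qed
    finally show ?thesis .
  qed
  have w2: "omega ^ 2 > 0" using assms(4) by simp
  have u2: "(norm (u x))\<^sup>2 = (norm (v x))\<^sup>2 / (omega\<^sup>2)\<^sup>2" if "x \<in> ?B" for x
    using uv[OF that, symmetric] w2 by (simp add: power_mult_distrib)
  have vB: "set_integrable lborel ?B (\<lambda>x. (norm (v x))\<^sup>2)"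
    unfolding set_integrable_def by (rule integrable_mult_indicator) (use v2 in auto)
  have uB: "set_integrable lborel ?B (\<lambda>x. (norm (u x))\<^sup>2)"
  proof -
    have "set_integrable lborel ?B (\<lambda>x. (norm (v x))\<^sup>2 / (omega\<^sup>2)\<^sup>2)" using vB by simp
    then show ?thesis by (rule set_integrable_cong[THEN iffD1, rotated -1]) (auto simp: u2)
  qed
  have "omega\<^sup>2 * rho_norm rho ?B u = sqrt ((omega\<^sup>2)\<^sup>2 * (LINT x:?B|lborel. rho * (norm (u x))\<^sup>2))"
    unfolding rho_norm_def by (simp only: real_sqrt_mult real_sqrt_abs abs_power2)
  also have "(LINT x:?B|lborel. rho * (norm (u x))\<^sup>2) = (LINT x:?B|lborel. rho / (omega\<^sup>2)\<^sup>2 * (norm (v x))\<^sup>2)"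
    by (rule set_lebesgue_integral_cong) (auto simp: u2)
  also have "\<dots> = rho / (omega\<^sup>2)\<^sup>2 * (LINT x:?B|lborel. (norm (v x))\<^sup>2)"
    by (rule set_integral_mult_right)
  also have "(omega\<^sup>2)\<^sup>2 * (rho / (omega\<^sup>2)\<^sup>2 * (LINT x:?B|lborel. (norm (v x))\<^sup>2)) = rho * (LINT x:?B|lborel. (norm (v x))\<^sup>2)"
    using w2 by simp
  also have "sqrt \<dots> \<le> sqrt (rho * (?M\<^sup>2 * ?F))"
  proof -
    have "(LINT x:?B|lborel. (norm (v x))\<^sup>2) \<le> (LINT x|lborel. (norm (v x))\<^sup>2)"
      unfolding set_lebesgue_integral_def
      by (rule integral_mono[OF vB[unfolded set_integrable_def] v2]) (auto simp: indicator_def)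
    then show ?thesis using vle assms(1) by (intro real_sqrt_le_mono mult_left_mono) auto
  qed
  also have "\<dots> = ?M * sqrt (rho * ?F)"
    using kP0 kPS assms(5) by (simp add: real_sqrt_mult)
  also have "rho * ?F = (LINT x:?B|lborel. rho * (norm (f x))\<^sup>2)"
  proof -
    have "(LINT x:?B|lborel. (norm (f x))\<^sup>2) = ?F"
      unfolding set_lebesgue_integral_def
      by (rule integral_cong_AE) (use assms(8) in \<open>auto simp: indicator_def\<close>)
    then show ?thesis by simp
  qed
  \<comment> \<open>\<open>kS * l\<close> is positive, so 16 may be enlarged to the claimed
    17.\<close>
  also have "?M * sqrt (LINT x:?B|lborel. rho * (norm (f x))\<^sup>2) \<le> (4 + 17 * (kS * l)) * rho_norm rho ?B f"
  proof -
    have "sqrt (LINT x:?B|lborel. rho * (norm (f x))\<^sup>2) \<ge> 0"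
      unfolding set_lebesgue_integral_def using assms(1) by (intro real_sqrt_ge_zero Bochner_Integration.integral_nonneg) auto
    then show ?thesis unfolding rho_norm_def using kP0 kPS assms(5) by (intro mult_right_mono) auto
  qed
  finally have "omega\<^sup>2 * rho_norm rho ?B u \<le> (4 + 17 * (kS * l)) * rho_norm rho ?B f" .
  with uB show ?thesis unfolding Let_def u_def kS_def by blast
qed

end
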